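(* Let $(X,d)$ be a complete $\mathrm{CAT}(0)$ space and let $L\ge 1$ be an integer. Then the identity map $\iota:(X,d_L)\to(X,d)$ induces an $\mathrm{Isom}(X)$-equivariant map $\iota_L:\partial_{\mathrm{Grom}}X_L\hookrightarrow\partial_\infty X$ which is a homeomorphism onto its image, where $X_L=(X,d_L)$.
   Context: $\partial_\infty X$ is the visual boundary of $X$ (asymptoty classes of geodesic rays) with the cone topology. Curtains. For a geodesic $\gamma:I\to X$ with nearest-point projection $\pi_\gamma$ onto $\gamma(I)$ and $t$ with $[t-\frac12,t+\frac12]\subseteq I$, the curtain dual to $\gamma$ at $t$ is $h=\pi_\gamma^{-1}(\gamma([t-\frac12,t+\frac12]))$; its half-spaces are $h^-=\pi_\gamma^{-1}(\gamma((-\infty,t-\frac12)\cap I))$ and $h^+=\pi_\gamma^{-1}(\gamma((t+\frac12,\infty)\cap I))$. $h$ separates $A,B\subseteq X$ if $A\subseteq h^-$ and $B\subseteq h^+$ (or vice versa). A chain is a family of curtains $\{h_i\}$ such that $h_i$ separates $h_{i-1}$ from $h_{i+1}$ for all $i$; it separates two sets if each $h_i$ does. Two curtains are $L$-separated if every chain all of whose elements meet both of them has cardinality at most $L$. An $L$-chain is a chain of pairwise $L$-separated curtains. For $x\ne y$, $d_L(x,y)=1+\max\{|c| : c\text{ an }L\text{-chain separating }x\text{ and }y\}$, and $d_L(x,x)=0$. It is known (Petyt–Spriano–Zalloum) that $X_L=(X,d_L)$ is a Gromov-hyperbolic metric space on which $\mathrm{Isom}(X)$ acts by isometries. Gromov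 boundary of a (not necessarily geodesic) hyperbolic space $(Y,\delta_Y)$: with $(x|y)_o=\frac12(\delta_Y(x,o)+\delta_Y(y,o)-\delta_Y(x,y))$, a sequence $(x_i)$ converges at infinity if $(x_i|x_j)_o\to\infty$; two such sequences $(x_i),(y_i)$ are equivalent if $(x_i|y_i)_o\to\infty$; $\partial_{\mathrm{Grom}}Y$ is the set of classes. For $\xi,\eta\in\partial_{\mathrm{Grom}}Y$, $(\xi|\eta)_o=\sup\liminf_i(x_i|y_i)_o$ over representing sequences, and the topology is given by the sets $\{\eta:(\xi|\eta)_o>R\}$. The map $\iota_L$ induced by the identity sends the class of a sequence $(x_n)$ converging at infinity in $X_L$ to its limit in $\partial_\infty X$ for the cone topology. *)

theory Defs
  imports "HOL-Analysis.Analysis"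
begin

section \<open>Geodesics and CAT(0) spaces\<close>

definition geodesic_on :: "real set \<Rightarrow> (real \<Rightarrow> 'a::metric_space) \<Rightarrow> bool" where
  "geodesic_on I c \<longleftrightarrow> is_interval I \<and> (\<forall>s\<in>I. \<forall>t\<in>I. dist (c s) (c t) = \<bar>s - t\<bar>)"

definition geodesic_segment :: "'a::metric_space \<Rightarrow> 'a \<Rightarrow> (real \<Rightarrow> 'a) \<Rightarrow> bool" where
  "geodesic_segment x y c \<longleftrightarrow> geodesic_on {0..dist x y} c \<and> c 0 = x \<and> c (dist x y) = y"

text \<open>Points of the side \<open>c\<close> from \<open>x\<close> to \<open>y\<close>, each paired with its comparison point on
  the Euclidean segment from \<open>x'\<close> to \<open>y'\<close>.\<close>

definition comparison_pairs ::
  "'a::metric_space \<Rightarrow> 'a \<Rightarrow> (real \<Rightarrow> 'a) \<Rightarrow> real^2 \<Rightarrow> real^2 \<Rightarrow> ('a \<times> (real^2)) set" where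
  "comparison_pairs x y c x' y' =
     {(c t, u) | t u. t \<in> {0..dist x y} \<and> u \<in> closed_segment x' y' \<and> dist x' u = t}"

definition CAT0_space :: "'a::metric_space itself \<Rightarrow> bool" where
  "CAT0_space _ \<longleftrightarrow>
     (\<forall>x y::'a. \<exists>c. geodesic_segment x y c) \<and>
     (\<forall>(x::'a) y z c1 c2 c3 (x'::real^2) y' z'.
        geodesic_segment x y c1 \<and> geodesic_segment y z c2 \<and> geodesic_segment z x c3 \<and>
        dist x' y' = dist x y \<and> dist y' z' = dist y z \<and> dist z' x' = dist z x \<longrightarrow>
        (let T = comparison_pairs x y c1 x' y' \<union> comparison_pairs y z c2 y' z'
                   \<union> comparison_pairs z x c3 z' x'
         in \<forall>(a, a')\<in>T. \<forall>(b, b')\<in>T. dist a b \<le> dist a' b'))"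

definition isometry_group :: "('a::metric_space \<Rightarrow> 'a) set" where
  "isometry_group = {g. bij g \<and> (\<forall>x y. dist (g x) (g y) = dist x y)}"

section \<open>Curtains and the metrics \<open>d\<^sub>L\<close>\<close>

definition nearest_point :: "'a::metric_space set \<Rightarrow> 'a \<Rightarrow> 'a" where
  "nearest_point S x = (THE a. a \<in> S \<and> (\<forall>b\<in>S. dist x a \<le> dist x b))"

text \<open>A curtain is handled through its data \<open>(I, \<gamma>, t)\<close>, since the half-spaces are defined in
  terms of these. The interval is taken to be closed, so that in a complete CAT(0) space the
  nearest-point projection onto \<open>\<gamma> ` I\<close> is defined everywhere.\<close>

type_synonym 'a curtain = "real set \<times> (real \<Rightarrow> 'a) \<times> real"

fun is_curtain :: "'a::metric_space curtain \<Rightarrow> bool" where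
  "is_curtain (I, \<gamma>, t) \<longleftrightarrow> closed I \<and> geodesic_on I \<gamma> \<and> {t - 1/2..t + 1/2} \<subseteq> I"

fun curtain_set :: "'a::metric_space curtain \<Rightarrow> 'a set" where
  "curtain_set (I, \<gamma>, t) = nearest_point (\<gamma> ` I) -` (\<gamma> ` {t - 1/2..t + 1/2})"

fun neg_halfspace :: "'a::metric_space curtain \<Rightarrow> 'a set" where
  "neg_halfspace (I, \<gamma>, t) = nearest_point (\<gamma> ` I) -` (\<gamma> ` ({..<t - 1/2} \<inter> I))"

fun pos_halfspace :: "'a::metric_space curtain \<Rightarrow> 'a set" where
  "pos_halfspace (I, \<gamma>, t) = nearest_point (\<gamma> ` I) -` (\<gamma> ` ({t + 1/2<..} \<inter> I))"

definition separates :: "'a::metric_space curtain \<Rightarrow> 'a set \<Rightarrow> 'a set \<Rightarrow> bool" where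
  "separates h A B \<longleftrightarrow>
     A \<subseteq> neg_halfspace h \<and> B \<subseteq> pos_halfspace h \<or> B \<subseteq> neg_halfspace h \<and> A \<subseteq> pos_halfspace h"

text \<open>Disjointness of consecutive curtains follows from the separation condition for chains of at
  least three curtains; it is only a genuine requirement for chains of two, where the separation
  condition is void. Without it any two curtains would form a chain and \<open>d\<^sub>L\<close> would in general not be
  a metric. The curtains of a chain are distinct, so its cardinality is the length of the list.
  Finite chains suffice: an infinite chain contains finite ones of every length.\<close>

definition chain :: "'a::metric_space curtain list \<Rightarrow> bool" where
  "chain hs \<longleftrightarrow>
     (\<forall>h\<in>set hs. is_curtain h) \<and>
     (\<forall>i. Suc i < length hs \<longrightarrow> disjnt (curtain_set (hs ! i)) (curtain_set (hs ! Suc i))) \<and>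
     (\<forall>i. Suc (Suc i) < length hs \<longrightarrow>
        separates (hs ! Suc i) (curtain_set (hs ! i)) (curtain_set (hs ! Suc (Suc i))))"

definition L_separated :: "nat \<Rightarrow> 'a::metric_space curtain \<Rightarrow> 'a curtain \<Rightarrow> bool" where
  "L_separated L h k \<longleftrightarrow>
     (\<forall>cs. chain cs \<and>
        (\<forall>c\<in>set cs. curtain_set c \<inter> curtain_set h \<noteq> {} \<and> curtain_set c \<inter> curtain_set k \<noteq> {})
        \<longrightarrow> length cs \<le> L)"

definition L_chain :: "nat \<Rightarrow> 'a::metric_space curtain list \<Rightarrow> bool" where
  "L_chain L hs \<longleftrightarrow> chain hs \<and>
     (\<forall>i<length hs. \<forall>j<length hs. i \<noteq> j \<longrightarrow> L_separated L (hs ! i) (hs ! j))"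

text \<open>In a CAT(0) space a chain separating \<open>x\<close> from \<open>y\<close> has length at most \<open>dist x y\<close>,
  so that the maximum below is attained; the empty chain makes it at least \<open>0\<close>.\<close>

definition d_L :: "nat \<Rightarrow> 'a::metric_space \<Rightarrow> 'a \<Rightarrow> real" where
  "d_L L x y = (if x = y then 0
     else 1 + real (Max {length hs | hs. L_chain L hs \<and> (\<forall>h\<in>set hs. separates h {x} {y})}))"

section \<open>The Gromov boundary\<close>

definition gromov_product :: "('a \<Rightarrow> 'a \<Rightarrow> real) \<Rightarrow> 'a \<Rightarrow> 'a \<Rightarrow> 'a \<Rightarrow> real" where
  "gromov_product \<delta> p x y = (\<delta> x p + \<delta> y p - \<delta> x y) / 2"

definition converges_at_infinity :: "('a \<Rightarrow> 'a \<Rightarrow> real) \<Rightarrow> 'a \<Rightarrow> (nat \<Rightarrow> 'a) \<Rightarrow> bool" where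
  "converges_at_infinity \<delta> p s \<longleftrightarrow>
     filterlim (\<lambda>(i, j). gromov_product \<delta> p (s i) (s j)) at_top (sequentially \<times>\<^sub>F sequentially)"

definition gromov_equiv :: "('a \<Rightarrow> 'a \<Rightarrow> real) \<Rightarrow> 'a \<Rightarrow> ((nat \<Rightarrow> 'a) \<times> (nat \<Rightarrow> 'a)) set" where
  "gromov_equiv \<delta> p = {(s, t). converges_at_infinity \<delta> p s \<and> converges_at_infinity \<delta> p t \<and>
     filterlim (\<lambda>i. gromov_product \<delta> p (s i) (t i)) at_top sequentially}"

definition gromov_boundary :: "('a \<Rightarrow> 'a \<Rightarrow> real) \<Rightarrow> 'a \<Rightarrow> (nat \<Rightarrow> 'a) set set" where
  "gromov_boundary \<delta> p = {s. converges_at_infinity \<delta> p s} // gromov_equiv \<delta> p"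

definition gromov_product_at_infinity ::
  "('a \<Rightarrow> 'a \<Rightarrow> real) \<Rightarrow> 'a \<Rightarrow> (nat \<Rightarrow> 'a) set \<Rightarrow> (nat \<Rightarrow> 'a) set \<Rightarrow> ereal" where
  "gromov_product_at_infinity \<delta> p \<xi> \<eta> =
     (SUP (s, t)\<in>\<xi> \<times> \<eta>. liminf (\<lambda>i. ereal (gromov_product \<delta> p (s i) (t i))))"

text \<open>The sets \<open>{\<eta>. (\<xi>|\<eta>) > R}\<close> are the basic neighbourhoods of \<open>\<xi>\<close>; they need not
  themselves be open.\<close>

definition gromov_topology :: "('a \<Rightarrow> 'a \<Rightarrow> real) \<Rightarrow> 'a \<Rightarrow> (nat \<Rightarrow> 'a) set topology" where
  "gromov_topology \<delta> p = topology (\<lambda>U. U \<subseteq> gromov_boundary \<delta> p \<and>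
     (\<forall>\<xi>\<in>U. \<exists>R::real. {\<eta> \<in> gromov_boundary \<delta> p. gromov_product_at_infinity \<delta> p \<xi> \<eta> > R} \<subseteq> U))"

lemma openin_gromov_topology:
  "openin (gromov_topology \<delta> p) U \<longleftrightarrow> U \<subseteq> gromov_boundary \<delta> p \<and>
     (\<forall>\<xi>\<in>U. \<exists>R::real. {\<eta> \<in> gromov_boundary \<delta> p. gromov_product_at_infinity \<delta> p \<xi> \<eta> > R} \<subseteq> U)"
proof -
  define B where "B = gromov_boundary \<delta> p"
  define N where "N \<xi> R = {\<eta> \<in> B. gromov_product_at_infinity \<delta> p \<xi> \<eta> > ereal R}" for \<xi> R
  have anti: "N \<xi> R' \<subseteq> N \<xi> R" if "R \<le> R'" for \<xi> R R'
  proof -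
    have "ereal R \<le> ereal R'" using that by simp
    then show ?thesis unfolding N_def using order.strict_trans1 by blast
  qed
  have *: "istopology (\<lambda>U. U \<subseteq> B \<and> (\<forall>\<xi>\<in>U. \<exists>R. N \<xi> R \<subseteq> U))"
    unfolding istopology_def
  proof (rule conjI; intro allI impI; rule conjI; (intro ballI)?)
    fix S T \<xi>
    assume S: "S \<subseteq> B \<and> (\<forall>\<xi>\<in>S. \<exists>R. N \<xi> R \<subseteq> S)"
      and T: "T \<subseteq> B \<and> (\<forall>\<xi>\<in>T. \<exists>R. N \<xi> R \<subseteq> T)" and \<xi>: "\<xi> \<in> S \<inter> T"
    from S \<xi> obtain R where R: "N \<xi> R \<subseteq> S" by blast
    from T \<xi> obtain Q where Q: "N \<xi> Q \<subseteq> T" by blast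
    have "N \<xi> (max R Q) \<subseteq> S \<inter> T"
      using order.trans [OF anti R] order.trans [OF anti Q] by (simp add: Int_greatest)
    then show "\<exists>R. N \<xi> R \<subseteq> S \<inter> T" ..
  next
    fix K \<xi>
    assume K: "\<forall>U\<in>K. U \<subseteq> B \<and> (\<forall>\<xi>\<in>U. \<exists>R. N \<xi> R \<subseteq> U)" and "\<xi> \<in> \<Union>K"
    then obtain U where U: "U \<in> K" "\<xi> \<in> U" by blast
    with K obtain R where "N \<xi> R \<subseteq> U" by blast
    with U have "N \<xi> R \<subseteq> \<Union>K" by blast
    then show "\<exists>R. N \<xi> R \<subseteq> \<Union>K" ..
  next
    fix S T assume "S \<subseteq> B \<and> (\<forall>\<xi>\<in>S. \<exists>R. N \<xi> R \<subseteq> S)"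
    then have "S \<subseteq> B" ..
    then show "S \<inter> T \<subseteq> B" by blast
  next
    fix K assume "\<forall>U\<in>K. U \<subseteq> B \<and> (\<forall>\<xi>\<in>U. \<exists>R. N \<xi> R \<subseteq> U)"
    then have "\<forall>U\<in>K. U \<subseteq> B" by fast
    then show "\<Union>K \<subseteq> B" by (simp only: Union_least)
  qed
  show ?thesis
    unfolding gromov_topology_def
    using topology_inverse' [OF *] unfolding B_def N_def by (rule fun_cong)
qed

lemma topspace_gromov_topology: "topspace (gromov_topology \<delta> p) = gromov_boundary \<delta> p"
proof
  show "topspace (gromov_topology \<delta> p) \<subseteq> gromov_boundary \<delta> p"
    using openin_topspace [of "gromov_topology \<delta> p"] unfolding openin_gromov_topology ..
  have "openin (gromov_topology \<delta> p) (gromov_boundary \<delta> p)"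
    unfolding openin_gromov_topology by (intro conjI ballI exI [of _ 0] subsetI; simp)
  then show "gromov_boundary \<delta> p \<subseteq> topspace (gromov_topology \<delta> p)"
    by (rule openin_subset)
qed

section \<open>The visual boundary and the cone topology\<close>

definition geodesic_ray :: "(real \<Rightarrow> 'a::metric_space) \<Rightarrow> bool" where
  "geodesic_ray c \<longleftrightarrow> geodesic_on {0..} c"

text \<open>The values of a ray at negative arguments are irrelevant; a class contains all the functions
  that restrict to a given ray.\<close>

definition asymptotic :: "((real \<Rightarrow> 'a::metric_space) \<times> (real \<Rightarrow> 'a)) set" where
  "asymptotic = {(c, c'). geodesic_ray c \<and> geodesic_ray c' \<and> (\<exists>K. \<forall>t\<ge>0. dist (c t) (c' t) \<le> K)}"

definition visual_boundary :: "(real \<Rightarrow> 'a::metric_space) set set" where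
  "visual_boundary = {c. geodesic_ray c} // asymptotic"

text \<open>The cone topology is defined on the whole bordification of \<open>X\<close>, with \<open>Inl\<close> marking the
  points of the space and \<open>Inr\<close> those of the boundary. A basic neighbourhood of the class of a
  ray \<open>c\<close> consists of the points and classes whose geodesic from \<open>c 0\<close> passes \<open>e\<close>-close to
  \<open>c r\<close> at time \<open>r\<close>.\<close>

definition cone_nbhd ::
  "(real \<Rightarrow> 'a::metric_space) \<Rightarrow> real \<Rightarrow> real \<Rightarrow> ('a + (real \<Rightarrow> 'a) set) set" where
  "cone_nbhd c r e =
     Inl ` {x. dist (c 0) x > r \<and> (\<exists>b. geodesic_segment (c 0) x b \<and> dist (b r) (c r) < e)} \<union>
     Inr ` {\<eta> \<in> visual_boundary. \<exists>b\<in>\<eta>. b 0 = c 0 \<and> dist (b r) (c r) < e}"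

definition cone_topology :: "'a::metric_space \<Rightarrow> ('a + (real \<Rightarrow> 'a) set) topology" where
  "cone_topology q = topology_generated_by
     ({Inl ` ball x e | x e. e > 0} \<union>
      {cone_nbhd c r e | c r e. geodesic_ray c \<and> c 0 = q \<and> r > 0 \<and> e > 0})"

definition visual_topology :: "'a::metric_space \<Rightarrow> (real \<Rightarrow> 'a) set topology" where
  "visual_topology q = pullback_topology visual_boundary Inr (cone_topology q)"

section \<open>The map of boundaries induced by the identity\<close>

definition is_cone_limit ::
  "'a::metric_space \<Rightarrow> (nat \<Rightarrow> 'a) set \<Rightarrow> (real \<Rightarrow> 'a) set \<Rightarrow> bool" where
  "is_cone_limit q \<xi> \<eta> \<longleftrightarrow> \<eta> \<in> visual_boundary \<and>
     (\<forall>s\<in>\<xi>. limitin (cone_topology q) (\<lambda>n. Inl (s n)) (Inr \<eta>) sequentially)"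

definition boundary_map :: "'a::metric_space \<Rightarrow> (nat \<Rightarrow> 'a) set \<Rightarrow> (real \<Rightarrow> 'a) set" where
  "boundary_map q \<xi> = (THE \<eta>. is_cone_limit q \<xi> \<eta>)"

end

theory Submission
  imports Defs
begin

text \<open>
  A curtain and its half-spaces are only star-shaped, but connectedness of the curtain and of the
  closed half-spaces makes curtains behave as walls: a chain separating two points can be ordered so
  that its half-spaces are nested, and a curtain meeting both sides of a third one meets it.
  If \<open>h\<^sub>1, \<dots>, h\<^sub>n\<close> is an \<open>L\<close>-chain separating \<open>p\<close> from
  \<open>{x, y}\<close>, at most \<open>L\<close> curtains of a chain from \<open>x\<close> to \<open>{p, y}\<close> reach
  back across the last two \<open>h\<^sub>i\<close>, and the others can be glued to the \<open>h\<^sub>i\<close>. Hence, up to an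
  additive constant, the Gromov product \<open>(x|y)\<^sub>p\<close> for \<open>d\<^sub>L\<close> is the largest length of an
  \<open>L\<close>-chain separating \<open>p\<close> from \<open>{x, y}\<close>.

  The geometry enters through two facts about a geodesic crossing an \<open>L\<close>-chain. Two geodesics
  crossing the same three curtains come within \<open>2 L + 3\<close> of each other: otherwise \<open>L + 1\<close> curtains
  dual to the perpendicular from one to the other would meet two \<open>L\<close>-separated curtains.
  And a geodesic that has crossed sufficiently many further curtains never returns to the first one:
  otherwise \<open>L + 1\<close> curtains dual to the geodesic would meet two \<open>L\<close>-separated ones.
  The first fact and convexity of the metric show that a sequence converging at infinity for \<open>d\<^sub>L\<close>
  has a limiting ray; the second shows that this ray crosses arbitrarily long \<open>L\<close>-chains, and that
  these chains then separate the base point from everything whose geodesic is close to the ray at a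
  suitable time. So cone-close limits have large Gromov product and conversely. In particular two
  sequences are equivalent exactly if they have the same limit, and hyperbolicity of \<open>d\<^sub>L\<close> is never
  needed.
\<close>

section \<open>Geometry of CAT(0) spaces\<close>

lemma comparison_triangle:
  fixes a b c :: real
  assumes "0 \<le> a" "0 \<le> b" "0 \<le> c" "a \<le> b + c" "b \<le> a + c" "c \<le> a + b"
  obtains x y z :: "real^2" where "dist x y = a" "dist y z = b" "dist z x = c"
proof -
  have d: "dist (vector [u, v] :: real^2) (vector [u', v']) = sqrt ((u - u')\<^sup>2 + (v - v')\<^sup>2)" for u v u' v'
    by (simp add: dist_vec_def L2_set_def UNIV_2 dist_real_def)
  show thesis
  proof (cases "a = 0")
    case True
    with assms have "b = c" by simp
    show thesis
      by (rule that[of "vector [0, 0]" "vector [0, 0]" "vector [b, 0]"])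
        (use True assms \<open>b = c\<close> in \<open>simp_all add: d\<close>)
  next
    case False
    with assms have a: "a > 0" by simp
    \<comment> \<open>Abscissa of the third vertex by the law of cosines, the side \<open>a\<close>
      lying on the axis. The triangle inequalities give |u| <= c, which makes the ordinate
      real.\<close>
    define u where "u = (a\<^sup>2 + c\<^sup>2 - b\<^sup>2) / (2 * a)"
    have au: "2 * a * u = a\<^sup>2 + c\<^sup>2 - b\<^sup>2" using a by (simp add: u_def)
    have "(a - c)\<^sup>2 \<le> b\<^sup>2" using assms by (intro abs_le_square_iff[THEN iffD1]) auto
    moreover have "b\<^sup>2 \<le> (a + c)\<^sup>2" using assms by (intro power_mono) auto
    ultimately have "\<bar>2 * a * u\<bar> \<le> 2 * a * c"
      unfolding au by (auto simp: power2_eq_square algebra_simps abs_le_iff)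
    then have "\<bar>u\<bar> \<le> c" using a by (simp add: abs_mult)
    then have uc: "u\<^sup>2 \<le> c\<^sup>2" using assms by (intro abs_le_square_iff[THEN iffD1]) auto
    have v: "(sqrt (c\<^sup>2 - u\<^sup>2))\<^sup>2 = c\<^sup>2 - u\<^sup>2" using uc by simp
    have "(a - u)\<^sup>2 + (c\<^sup>2 - u\<^sup>2) = b\<^sup>2"
      using au by (simp add: power2_eq_square algebra_simps)
    then show thesis
      by (intro that[of "vector [0, 0]" "vector [a, 0]" "vector [u, sqrt (c\<^sup>2 - u\<^sup>2)]"])
        (use assms v in \<open>simp_all add: d\<close>)
  qed
qed

text \<open>Stewart's identity. Comparison turns it into the inequality
  \<open>CN_segment\<close>.\<close>

lemma euclidean_CN:
  fixes x y z :: "'b::real_inner"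
  shows "(dist (x + t *\<^sub>R (y - x)) z)\<^sup>2 = (1 - t) * (dist z x)\<^sup>2 + t * (dist z y)\<^sup>2 - t * (1 - t) * (dist x y)\<^sup>2"
  unfolding dist_norm power2_norm_eq_inner
  by (simp add: inner_simps inner_commute algebra_simps power2_eq_square)

lemma geodesic_segment_reverse:
  assumes "geodesic_segment x y c"
  shows "geodesic_segment y x (\<lambda>s. c (dist x y - s))"
  using assms unfolding geodesic_segment_def geodesic_on_def
  by (auto simp: dist_commute is_interval_cc)

lemma geodesic_on_dist:
  "geodesic_on I c \<Longrightarrow> s \<in> I \<Longrightarrow> t \<in> I \<Longrightarrow> dist (c s) (c t) = \<bar>s - t\<bar>"
  by (auto simp: geodesic_on_def)

lemma geodesic_on_subset:
  "geodesic_on I c \<Longrightarrow> J \<subseteq> I \<Longrightarrow> is_interval J \<Longrightarrow> geodesic_on J c"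
  by (auto simp: geodesic_on_def)

lemma geodesic_on_interval:
  assumes "geodesic_on I c" "s \<in> I" "t \<in> I"
  shows "{s..t} \<subseteq> I"
  using assms unfolding geodesic_on_def is_interval_1 subset_iff atLeastAtMost_iff by blast

lemma geodesic_on_continuous: "geodesic_on I c \<Longrightarrow> continuous_on I c"
  unfolding continuous_on_iff by (metis abs_minus_commute dist_real_def geodesic_on_dist)

lemma geodesic_on_segment:
  assumes "geodesic_on I c" "s \<in> I" "t \<in> I" "s \<le> t"
  shows "geodesic_segment (c s) (c t) (\<lambda>r. c (s + r))"
proof -
  have "s + r \<in> I" if "0 \<le> r" "r \<le> t - s" for r
    using geodesic_on_interval[OF assms(1-3)] that by auto
  then show ?thesis
    using assms unfolding geodesic_segment_def geodesic_on_def
    by (auto simp: is_interval_cc)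
qed

section \<open>Comparison inequalities in a CAT(0) space\<close>

locale cat0 =
  fixes X :: "'a::metric_space itself"
  assumes CAT0: "CAT0_space X"
begin

lemma geodesic_segment_exists: "\<exists>c. geodesic_segment (x::'a) y c"
  using CAT0 unfolding CAT0_space_def by blast

text \<open>Geodesic segments turn out to be unique on \<open>{0..dist x y}\<close>, so the choice
  is immaterial there; outside this interval the values are arbitrary.\<close>

definition geod :: "'a \<Rightarrow> 'a \<Rightarrow> real \<Rightarrow> 'a" where
  "geod x y = (SOME c. geodesic_segment x y c)"

lemma geodesic_segment_geod: "geodesic_segment x y (geod x y)"
  unfolding geod_def using geodesic_segment_exists by (rule someI_ex)

text \<open>The form of the axiom used below: one comparison triangle, and a point of the first side
  against a point of another side.\<close>

lemma comparison:
  fixes x y z :: 'a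
  assumes "geodesic_segment x y c1" "geodesic_segment y z c2" "geodesic_segment z x c3"
  obtains x' y' z' :: "real^2" where
    "dist x' y' = dist x y" "dist y' z' = dist y z" "dist z' x' = dist z x"
    "\<forall>(a, a') \<in> comparison_pairs x y c1 x' y'. \<forall>(b, b') \<in> comparison_pairs y z c2 y' z' \<union> comparison_pairs z x c3 z' x'.
      dist a b \<le> dist a' b'"
proof -
  obtain x' y' z' :: "real^2" where
    *: "dist x' y' = dist x y" "dist y' z' = dist y z" "dist z' x' = dist z x"
    using comparison_triangle[of "dist x y" "dist y z" "dist z x"]
    by (metis dist_commute dist_triangle dist_triangle2 zero_le_dist add.commute)
  have "let T = comparison_pairs x y c1 x' y' \<union> comparison_pairs y z c2 y' z'
                   \<union> comparison_pairs z x c3 z' x'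
         in \<forall>(a, a')\<in>T. \<forall>(b, b')\<in>T. dist a b \<le> dist a' b'"
    using CAT0 assms * unfolding CAT0_space_def by blast
  then show thesis
    by (intro that[OF *]) (unfold Let_def, blast)
qed

text \<open>A point of the side \<open>c\<close> is compared with the opposite vertex
  \<open>z\<close>; in the plane Stewart's identity computes that distance.\<close>

lemma CN_segment:
  fixes z :: 'a
  assumes c: "geodesic_segment x y c" and t: "0 \<le> t" "t \<le> 1"
  shows "(dist z (c (t * dist x y)))\<^sup>2 \<le> (1 - t) * (dist z x)\<^sup>2 + t * (dist z y)\<^sup>2 - t * (1 - t) * (dist x y)\<^sup>2"
proof -
  obtain c2 c3 where c2: "geodesic_segment y z c2" and c3: "geodesic_segment z x c3"
    using geodesic_segment_exists by metis
  obtain x' y' z' :: "real^2" where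
    d: "dist x' y' = dist x y" "dist y' z' = dist y z" "dist z' x' = dist z x" and
    T: "\<forall>(a, a') \<in> comparison_pairs x y c x' y'. \<forall>(b, b') \<in> comparison_pairs y z c2 y' z' \<union> comparison_pairs z x c3 z' x'.
      dist a b \<le> dist a' b'"
    using comparison[OF c c2 c3] .
  let ?u = "x' + t *\<^sub>R (y' - x')"
  have du: "dist x' ?u = t * dist x y"
    using t d(1) by (simp add: dist_norm norm_minus_commute)
  have "?u \<in> closed_segment x' y'"
    using t by (auto simp: in_segment algebra_simps intro!: exI[of _ t])
  then have 1: "(c (t * dist x y), ?u) \<in> comparison_pairs x y c x' y'"
    unfolding comparison_pairs_def using t du by (auto intro!: exI simp: mult_left_le_one_le)
  \<comment> \<open>The vertex \<open>z\<close> takes part in the comparison as the end of the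
    second side.\<close>
  have "(c2 (dist y z), z') \<in> comparison_pairs y z c2 y' z'"
    unfolding comparison_pairs_def using d(2) by auto
  then have 2: "(z, z') \<in> comparison_pairs y z c2 y' z'"
    using c2 by (simp add: geodesic_segment_def)
  have "dist (c (t * dist x y)) z \<le> dist ?u z'" using T 1 2 by blast
  then have "(dist z (c (t * dist x y)))\<^sup>2 \<le> (dist ?u z')\<^sup>2" by (simp add: dist_commute)
  then show ?thesis
    unfolding euclidean_CN using d by (simp add: dist_commute)
qed

text \<open>The comparison points divide two sides issuing from \<open>x'\<close> in the same ratio,
  so in the plane the intercept theorem gives equality.\<close>

lemma dist_segments_common_start:
  fixes x y z :: 'a
  assumes c: "geodesic_segment x y c" and c': "geodesic_segment x z c'" and t: "0 \<le> t" "t \<le> 1"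
  shows "dist (c (t * dist x y)) (c' (t * dist x z)) \<le> t * dist y z"
proof -
  obtain c2 where c2: "geodesic_segment y z c2"
    using geodesic_segment_exists by metis
  \<comment> \<open>The third side has to run from \<open>z\<close> to \<open>x\<close>, so
    \<open>c'\<close> is reversed and the ratio \<open>t\<close> becomes
    \<open>1 - t\<close>.\<close>
  note c3 = geodesic_segment_reverse[OF c']
  let ?c3 = "\<lambda>s. c' (dist x z - s)"
  obtain x' y' z' :: "real^2" where
    d: "dist x' y' = dist x y" "dist y' z' = dist y z" "dist z' x' = dist z x" and
    T: "\<forall>(a, a') \<in> comparison_pairs x y c x' y'. \<forall>(b, b') \<in> comparison_pairs y z c2 y' z' \<union> comparison_pairs z x ?c3 z' x'.
      dist a b \<le> dist a' b'"
    using comparison[OF c c2 c3] .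
  let ?u = "x' + t *\<^sub>R (y' - x')"
  let ?w = "x' + t *\<^sub>R (z' - x')"
  have du: "dist x' ?u = t * dist x y"
    using t d(1) by (simp add: dist_norm norm_minus_commute)
  have "?u \<in> closed_segment x' y'"
    using t by (auto simp: in_segment algebra_simps intro!: exI[of _ t])
  then have 1: "(c (t * dist x y), ?u) \<in> comparison_pairs x y c x' y'"
    unfolding comparison_pairs_def using t du by (auto intro!: exI simp: mult_left_le_one_le)
  have "z' - ?w = (1 - t) *\<^sub>R (z' - x')" by (simp add: algebra_simps)
  then have dw: "dist z' ?w = (1 - t) * dist z x"
    using t d(3) by (simp add: dist_norm)
  have "?w \<in> closed_segment z' x'"
    using t by (auto simp: in_segment algebra_simps intro!: exI[of _ "1 - t"])
  then have "(?c3 ((1 - t) * dist z x), ?w) \<in> comparison_pairs z x ?c3 z' x'"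
    unfolding comparison_pairs_def using t dw
    by (intro CollectI exI[of _ "(1 - t) * dist z x"] exI[of _ ?w]) (auto simp: mult_left_le_one_le)
  moreover have "dist x z - (1 - t) * dist z x = t * dist x z"
    by (simp add: dist_commute algebra_simps)
  ultimately have 2: "(c' (t * dist x z), ?w) \<in> comparison_pairs z x ?c3 z' x'"
    by simp
  have "dist (c (t * dist x y)) (c' (t * dist x z)) \<le> dist ?u ?w" using T 1 2 by blast
  also have "?u - ?w = t *\<^sub>R (y' - z')" by (simp add: algebra_simps)
  then have "dist ?u ?w = t * dist y z"
    using t d(2) by (simp add: dist_norm)
  finally show ?thesis .
qed

lemma geodesic_segment_unique:
  fixes x y :: 'a
  assumes "geodesic_segment x y c" "geodesic_segment x y c'" "s \<in> {0..dist x y}"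
  shows "c s = c' s"
proof (cases "x = y")
  case True
  with assms show ?thesis by (simp add: geodesic_segment_def)
next
  case False
  then have "dist (c (s / dist x y * dist x y)) (c' (s / dist x y * dist x y)) \<le> s / dist x y * dist y y"
    using assms by (intro dist_segments_common_start) auto
  with False show ?thesis by simp
qed

lemma CN:
  fixes z :: 'a
  assumes g: "geodesic_on I c" and st: "s \<in> I" "t \<in> I" and l: "0 \<le> l" "l \<le> 1"
  shows "(dist z (c ((1 - l) * s + l * t)))\<^sup>2
    \<le> (1 - l) * (dist z (c s))\<^sup>2 + l * (dist z (c t))\<^sup>2 - l * (1 - l) * (s - t)\<^sup>2"
proof -
  have *: "(dist z (c ((1 - l) * s + l * t)))\<^sup>2
    \<le> (1 - l) * (dist z (c s))\<^sup>2 + l * (dist z (c t))\<^sup>2 - l * (1 - l) * (s - t)\<^sup>2"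
    if "s \<in> I" "t \<in> I" "s \<le> t" "0 \<le> l" "l \<le> 1" for s t l
  proof -
    have dd: "dist (c s) (c t) = t - s"
      using geodesic_on_dist[OF g that(1,2)] that(3) by simp
    have "s + l * dist (c s) (c t) = (1 - l) * s + l * t"
      unfolding dd by (simp add: algebra_simps)
    moreover have "(dist (c s) (c t))\<^sup>2 = (s - t)\<^sup>2"
      using geodesic_on_dist[OF g that(1,2)] by simp
    ultimately show ?thesis
      using CN_segment[OF geodesic_on_segment[OF g that(1-3)] that(4,5), of z] by simp
  qed
  show ?thesis
  proof (cases "s \<le> t")
    case True
    with * st l show ?thesis by blast
  next
    case False
    have "(1 - (1 - l)) * t + (1 - l) * s = (1 - l) * s + l * t" by simp
    with *[of t s "1 - l"] st l False show ?thesis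
      by (simp add: power2_commute algebra_simps)
  qed
qed

subsection \<open>Projection to a geodesic\<close>

text \<open>The parameter of the nearest point instead of the point: curtains and half-spaces become
  preimages of intervals under a 1-Lipschitz real function.\<close>

definition foot :: "real set \<Rightarrow> (real \<Rightarrow> 'a) \<Rightarrow> 'a \<Rightarrow> real" where
  "foot I c x = (SOME t. t \<in> I \<and> (\<forall>s\<in>I. dist x (c t) \<le> dist x (c s)))"

lemma foot_exists:
  assumes g: "geodesic_on I c" "closed I" "I \<noteq> {}"
  shows "\<exists>t. t \<in> I \<and> (\<forall>s\<in>I. dist x (c t) \<le> dist x (c s))"
proof -
  obtain t0 where t0: "t0 \<in> I" using g by blast
  \<comment> \<open>Parameters farther than \<open>R\<close> from \<open>t0\<close> give points
    farther from \<open>x\<close> than \<open>c t0\<close>, so it suffices to minimise over a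
    compact set.\<close>
  define R where "R = 2 * dist x (c t0)"
  let ?K = "I \<inter> cball t0 R"
  have "compact ?K" using g by (simp add: closed_Int_compact)
  moreover have "t0 \<in> ?K" using t0 by (simp add: R_def)
  moreover have "continuous_on ?K (\<lambda>s. dist x (c s))"
    using geodesic_on_continuous[OF g(1)] by (intro continuous_intros) (auto intro: continuous_on_subset)
  ultimately obtain t where t: "t \<in> ?K" "\<And>s. s \<in> ?K \<Longrightarrow> dist x (c t) \<le> dist x (c s)"
    using continuous_attains_inf[of ?K "\<lambda>s. dist x (c s)"] by blast
  have "dist x (c t) \<le> dist x (c s)" if s: "s \<in> I" for s
  proof (cases "s \<in> cball t0 R")
    case True
    with s t show ?thesis by blast
  next
    case False
    then have "dist (c t0) (c s) > R"
      using geodesic_on_dist[OF g(1) t0 s] by (simp add: dist_real_def)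
    moreover have "dist (c t0) (c s) \<le> dist x (c t0) + dist x (c s)" by (metis dist_commute dist_triangle)
    ultimately have "dist x (c t0) \<le> dist x (c s)" unfolding R_def by linarith
    with t(2)[of t0] \<open>t0 \<in> ?K\<close> show ?thesis by simp
  qed
  with t show ?thesis by blast
qed

lemma foot_in:
  assumes "geodesic_on I c" "closed I" "I \<noteq> {}"
  shows "foot I c x \<in> I"
  using someI_ex[OF foot_exists[OF assms, of x]] unfolding foot_def by blast

lemma foot_le:
  assumes "geodesic_on I c" "closed I" "s \<in> I"
  shows "dist x (c (foot I c x)) \<le> dist x (c s)"
  using someI_ex[OF foot_exists[OF assms(1,2), of x]] assms(3) unfolding foot_def by blast

text \<open>Minimality at \<open>t\<close> is played against \<open>CN\<close> at the point dividing
  the way from \<open>t\<close> to \<open>s\<close> in ratio \<open>l\<close>. Dividing by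
  \<open>l\<close> and letting \<open>l\<close> tend to 0 leaves the Pythagorean inequality.\<close>

lemma nearest_pythagoras:
  fixes x :: 'a
  assumes g: "geodesic_on I c" and t: "t \<in> I" "\<And>s. s \<in> I \<Longrightarrow> dist x (c t) \<le> dist x (c s)" and s: "s \<in> I"
  shows "(dist x (c t))\<^sup>2 + (s - t)\<^sup>2 \<le> (dist x (c s))\<^sup>2"
proof -
  have *: "(dist x (c t))\<^sup>2 \<le> (dist x (c s))\<^sup>2 - (1 - l) * (s - t)\<^sup>2" if l: "0 < l" "l \<le> 1" for l
  proof -
    have "{t..s} \<subseteq> I" "{s..t} \<subseteq> I" using geodesic_on_interval g t s by blast+
    moreover have "(1 - l) * t + l * s \<in> {t..s} \<union> {s..t}"
    proof (cases "t \<le> s")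
      case True
      then have "l * t \<le> l * s" "(1 - l) * t \<le> (1 - l) * s"
        using l by (auto intro!: mult_left_mono)
      then show ?thesis by (simp add: algebra_simps)
    next
      case False
      then have "l * s \<le> l * t" "(1 - l) * s \<le> (1 - l) * t"
        using l by (auto intro!: mult_left_mono)
      then show ?thesis by (simp add: algebra_simps)
    qed
    ultimately have "(dist x (c t))\<^sup>2 \<le> (dist x (c ((1 - l) * t + l * s)))\<^sup>2"
      using t(2) by (intro power_mono) auto
    also have "\<dots> \<le> (1 - l) * (dist x (c t))\<^sup>2 + l * (dist x (c s))\<^sup>2 - l * (1 - l) * (t - s)\<^sup>2"
      using CN[OF g t(1) s] l by simp
    finally have "l * (dist x (c t))\<^sup>2 \<le> l * ((dist x (c s))\<^sup>2 - (1 - l) * (s - t)\<^sup>2)"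
      by (simp add: algebra_simps power2_commute)
    with l show ?thesis by simp
  qed
  have "((\<lambda>l. (dist x (c s))\<^sup>2 - (1 - l) * (s - t)\<^sup>2) \<longlongrightarrow> (dist x (c s))\<^sup>2 - (1 - 0) * (s - t)\<^sup>2) (at_right 0)"
    by (intro tendsto_intros)
  moreover have "\<forall>\<^sub>F l in at_right (0::real). (dist x (c t))\<^sup>2 \<le> (dist x (c s))\<^sup>2 - (1 - l) * (s - t)\<^sup>2"
    unfolding eventually_at_right_field using * by (intro exI[of _ 1]) auto
  ultimately have "(dist x (c t))\<^sup>2 \<le> (dist x (c s))\<^sup>2 - (1 - 0) * (s - t)\<^sup>2"
    by (rule tendsto_lowerbound) simp
  then show ?thesis by simp
qed

lemma foot_pythagoras:
  assumes "geodesic_on I c" "closed I" "s \<in> I"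
  shows "(dist x (c (foot I c x)))\<^sup>2 + (s - foot I c x)\<^sup>2 \<le> (dist x (c s))\<^sup>2"
  by (rule nearest_pythagoras[OF assms(1)]) (use assms foot_in foot_le in blast)+

text \<open>Uniqueness of the foot: the Pythagorean inequality leaves no room for two
  minimisers.\<close>

lemma foot_eqI:
  assumes g: "geodesic_on I c" "closed I" and t: "t \<in> I" "\<And>s. s \<in> I \<Longrightarrow> dist x (c t) \<le> dist x (c s)"
  shows "foot I c x = t"
proof -
  have "(dist x (c (foot I c x)))\<^sup>2 + (t - foot I c x)\<^sup>2 \<le> (dist x (c t))\<^sup>2"
    by (rule foot_pythagoras[OF g t(1)])
  also have "\<dots> \<le> (dist x (c (foot I c x)))\<^sup>2"
    using t(2)[OF foot_in] g t(1) by (intro power_mono) auto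
  finally show ?thesis by simp
qed

lemma nearest_point_eq_foot:
  assumes g: "geodesic_on I c" "closed I" "I \<noteq> {}"
  shows "nearest_point (c ` I) x = c (foot I c x)"
  unfolding nearest_point_def
proof (rule the_equality)
  show "c (foot I c x) \<in> c ` I \<and> (\<forall>b\<in>c ` I. dist x (c (foot I c x)) \<le> dist x b)"
    using foot_in[OF g] foot_le[OF g(1,2)] by blast
  show "a = c (foot I c x)" if "a \<in> c ` I \<and> (\<forall>b\<in>c ` I. dist x a \<le> dist x b)" for a
    using that foot_eqI[OF g(1,2)] by blast
qed

lemma foot_geodesic:
  assumes "geodesic_on I c" "closed I" "s \<in> I"
  shows "foot I c (c s) = s"
  by (rule foot_eqI[OF assms]) simp

text \<open>The quadrilateral inequality for \<open>x\<close>, \<open>y\<close> and their feet, obtained from the midpoint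
  \<open>m\<close> of a diagonal, is played off against the two Pythagorean inequalities.\<close>

lemma foot_lipschitz:
  assumes g: "geodesic_on I c" "closed I" "I \<noteq> {}"
  shows "\<bar>foot I c x - foot I c y\<bar> \<le> dist x y"
proof -
  define a b where "a = foot I c x" and "b = foot I c y"
  have ab: "a \<in> I" "b \<in> I" unfolding a_def b_def using foot_in[OF g] by auto
  have 1: "(dist x (c a))\<^sup>2 + (b - a)\<^sup>2 \<le> (dist x (c b))\<^sup>2"
    unfolding a_def by (rule foot_pythagoras[OF g(1,2) ab(2)])
  have 2: "(dist y (c b))\<^sup>2 + (a - b)\<^sup>2 \<le> (dist y (c a))\<^sup>2"
    unfolding b_def by (rule foot_pythagoras[OF g(1,2) ab(1)])
  obtain e where e: "geodesic_segment x (c b) e" using geodesic_segment_exists by metis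
  define m where "m = e (1/2 * dist x (c b))"
  have m: "(dist z m)\<^sup>2 \<le> (dist z x)\<^sup>2 / 2 + (dist z (c b))\<^sup>2 / 2 - (dist x (c b))\<^sup>2 / 4" for z
    using CN_segment[OF e, of "1/2" z] unfolding m_def by simp
  have "dist (c a) (c b) = \<bar>a - b\<bar>" using geodesic_on_dist[OF g(1) ab] .
  then have dab: "(dist (c a) (c b))\<^sup>2 = (a - b)\<^sup>2" by simp
  have "(dist y (c a))\<^sup>2 \<le> (dist y m + dist (c a) m)\<^sup>2"
    by (intro power_mono) (auto intro: dist_triangle2)
  also have "\<dots> \<le> 2 * (dist y m)\<^sup>2 + 2 * (dist (c a) m)\<^sup>2"
    using sum_squares_bound[of "dist y m" "dist (c a) m"] by (simp add: power2_sum)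
  also have "\<dots> \<le> (dist x y)\<^sup>2 + (dist y (c b))\<^sup>2 + (dist x (c a))\<^sup>2 + (a - b)\<^sup>2 - (dist x (c b))\<^sup>2"
    using m[of y] m[of "c a"] dab by (simp add: dist_commute)
  finally have "(a - b)\<^sup>2 \<le> (dist x y)\<^sup>2"
    using 1 2 by (simp add: power2_commute)
  then show ?thesis unfolding a_def b_def
    using abs_le_square_iff[of "foot I c x - foot I c y" "dist x y"] by simp
qed

lemma continuous_on_foot:
  assumes "geodesic_on I c" "closed I" "I \<noteq> {}"
  shows "continuous_on S (foot I c)"
  unfolding continuous_on_iff
  using foot_lipschitz[OF assms] by (metis dist_real_def order_le_less_trans)

text \<open>By the triangle inequality a point of \<open>c\<close> nearer to \<open>e s\<close> than
  the foot of \<open>x\<close> would also be nearer to \<open>x\<close>.\<close>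

lemma foot_on_segment:
  assumes g: "geodesic_on I c" "closed I" "I \<noteq> {}"
    and e: "geodesic_segment x (c (foot I c x)) e" and s: "s \<in> {0..dist x (c (foot I c x))}"
  shows "foot I c (e s) = foot I c x"
proof (rule foot_eqI[OF g(1,2) foot_in[OF g]])
  fix r assume r: "r \<in> I"
  have 1: "dist x (e s) = s" "dist (e s) (c (foot I c x)) = dist x (c (foot I c x)) - s"
    using e s unfolding geodesic_segment_def geodesic_on_def
    by (metis abs_of_nonneg atLeastAtMost_iff diff_zero dist_commute order_refl zero_le_dist,
       metis abs_of_nonneg atLeastAtMost_iff diff_ge_0_iff_ge dist_commute order_refl zero_le_dist)
  have "dist x (c (foot I c x)) \<le> dist x (c r)" by (rule foot_le[OF g(1,2) r])
  also have "\<dots> \<le> dist x (e s) + dist (e s) (c r)" by (rule dist_triangle)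
  finally show "dist (e s) (c (foot I c x)) \<le> dist (e s) (c r)" using 1 by simp
qed

text \<open>The preimage is star-shaped about an arc: each point is joined to its foot by a segment
  on which the foot is constant, and all these segments end on the connected image of
  \<open>J\<close>.\<close>

lemma connected_foot_vimage:
  assumes g: "geodesic_on I c" "closed I" and J: "is_interval J" "J \<subseteq> I"
  shows "connected (foot I c -` J)"
proof (cases "J = {}")
  case False
  then obtain t0 where t0: "t0 \<in> J" by blast
  have ne: "I \<noteq> {}" using J t0 by blast
  define e where "e x = geod x (c (foot I c x))" for x
  have e: "geodesic_segment x (c (foot I c x)) (e x)" for x
    unfolding e_def by (rule geodesic_segment_geod)
  define C where "C x = e x ` {0..dist x (c (foot I c x))} \<union> c ` J" for x
  have gJ: "geodesic_on J c" using geodesic_on_subset g J by blast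
  have "connected (C x)" if "foot I c x \<in> J" for x
    unfolding C_def
  proof (rule connected_Un)
    have "continuous_on {0..dist x (c (foot I c x))} (e x)"
      using e geodesic_on_continuous unfolding geodesic_segment_def by blast
    then show "connected (e x ` {0..dist x (c (foot I c x))})"
      by (intro connected_continuous_image) auto
    show "connected (c ` J)"
      using geodesic_on_continuous[OF gJ] J(1)
      by (intro connected_continuous_image) (auto simp: is_interval_connected)
    have "e x (dist x (c (foot I c x))) = c (foot I c x)"
      using e unfolding geodesic_segment_def by blast
    then show "e x ` {0..dist x (c (foot I c x))} \<inter> c ` J \<noteq> {}"
      using that by (metis IntI atLeastAtMost_iff empty_iff image_eqI order_refl zero_le_dist)
  qed
  then have "connected (\<Union>(C ` (foot I c -` J)))"
    using t0 by (intro connected_Union) (auto simp: C_def)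
  moreover have "\<Union>(C ` (foot I c -` J)) = foot I c -` J"
  proof
    have "foot I c y \<in> J" if "foot I c x \<in> J" "y \<in> C x" for x y
      using that(2) unfolding C_def
    proof
      assume "y \<in> e x ` {0..dist x (c (foot I c x))}"
      then show ?thesis using foot_on_segment[OF g ne e] that(1) by auto
    next
      assume "y \<in> c ` J"
      then show ?thesis using foot_geodesic[OF g] J by auto
    qed
    then show "\<Union>(C ` (foot I c -` J)) \<subseteq> foot I c -` J" by auto
    have "x \<in> C x" for x
    proof -
      have "e x 0 = x" using e unfolding geodesic_segment_def by blast
      then show ?thesis unfolding C_def by (metis UnI1 atLeastAtMost_iff image_eqI order_refl zero_le_dist)
    qed
    then show "foot I c -` J \<subseteq> \<Union>(C ` (foot I c -` J))" by blast
  qed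
  ultimately show ?thesis by simp
qed simp

end

section \<open>Curtains as walls\<close>

abbreviation "neg \<equiv> neg_halfspace"
abbreviation "mid \<equiv> curtain_set"
abbreviation "pos \<equiv> pos_halfspace"

text \<open>Reverses the dual geodesic, which keeps the curtain and exchanges its half-spaces. It
  serves to put a given point on the negative side.\<close>

fun flip :: "'a::metric_space curtain \<Rightarrow> 'a curtain" where
  "flip (I, c, t) = (uminus ` I, \<lambda>s. c (- s), - t)"

lemma flip_parts:
  "mid (flip h) = mid h" "neg (flip h) = pos h" "pos (flip h) = neg h"
proof -
  obtain I c t where h: "h = (I, c, t)" by (cases h)
  have im: "(\<lambda>s. c (- s)) ` S = c ` uminus ` S" for S by (simp add: image_image)
  have "uminus ` ({..<- t - 1 / 2} \<inter> uminus ` I) = {t + 1/2<..} \<inter> I"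
    "uminus ` ({- t + 1 / 2<..} \<inter> uminus ` I) = {..<t - 1/2} \<inter> I"
    by (force simp: image_iff)+
  then show "mid (flip h) = mid h" "neg (flip h) = pos h" "pos (flip h) = neg h"
    by (simp_all add: h im image_comp comp_def add.commute)
qed

lemma is_curtain_flip: "is_curtain h \<Longrightarrow> is_curtain (flip h)"
proof -
  assume "is_curtain h"
  obtain I c t where h: "h = (I, c, t)" by (cases h)
  have I: "closed I" "geodesic_on I c" "{t - 1/2..t + 1/2} \<subseteq> I"
    using \<open>is_curtain h\<close> by (simp_all add: h)
  have "uminus ` {t - 1/2..t + 1/2} \<subseteq> uminus ` I" using I(3) by (rule image_mono)
  moreover have "geodesic_on (uminus ` I) (\<lambda>s. c (- s))"
    using I(2) by (auto simp: geodesic_on_def abs_minus_commute)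
  ultimately show "is_curtain (flip h)"
    using I(1) by (simp add: h closed_negations)
qed

lemma separates_singletons:
  "separates h {x} {y} \<longleftrightarrow> x \<in> neg h \<and> y \<in> pos h \<or> y \<in> neg h \<and> x \<in> pos h"
  by (auto simp: separates_def)

lemma L_separated_commute: "L_separated L h k \<longleftrightarrow> L_separated L k h"
  unfolding L_separated_def by (simp add: conj_commute)

text \<open>L-separation sees a curtain only as a set, and therefore survives
  \<open>flip\<close>.\<close>

lemma L_separated_cong:
  "mid h = mid h' \<Longrightarrow> mid k = mid k' \<Longrightarrow> L_separated L h k \<longleftrightarrow> L_separated L h' k'"
  unfolding L_separated_def by simp

context cat0
begin

text \<open>\<open>c\<close> is injective on \<open>I\<close>, so the nearest point lies on an arc
  exactly if its parameter lies in the corresponding interval. Feet lie in \<open>I\<close>, which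
  absorbs the intersections with \<open>I\<close>.\<close>

lemma curtain_parts_foot:
  assumes "is_curtain (I, c, t)"
  shows "mid (I, c, t) = foot I c -` {t - 1/2..t + 1/2}"
    and "neg (I, c, t) = foot I c -` {..<t - 1/2}"
    and "pos (I, c, t) = foot I c -` {t + 1/2<..}"
proof -
  have g: "geodesic_on I c" "closed I" "{t - 1/2..t + 1/2} \<subseteq> I" using assms by auto
  have ne: "I \<noteq> {}"
  proof -
    have "t \<in> {t - 1/2..t + 1/2}" by simp
    with g(3) show ?thesis by blast
  qed
  have iff: "nearest_point (c ` I) x \<in> c ` J \<longleftrightarrow> foot I c x \<in> J" if "J \<subseteq> I" for x J
  proof -
    have "inj_on c I"
      using geodesic_on_dist[OF g(1)] by (metis dist_eq_0_iff abs_eq_0 eq_iff_diff_eq_0 inj_onI)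
    then show ?thesis
      using nearest_point_eq_foot[OF g(1,2) ne] foot_in[OF g(1,2) ne] that
      by (metis inj_on_image_mem_iff)
  qed
  show "mid (I, c, t) = foot I c -` {t - 1/2..t + 1/2}"
    using iff[OF g(3)] by (intro set_eqI) (simp only: curtain_set.simps vimage_eq)
  show "neg (I, c, t) = foot I c -` {..<t - 1/2}"
    using iff[of "{..<t - 1/2} \<inter> I"] foot_in[OF g(1,2) ne] by auto
  show "pos (I, c, t) = foot I c -` {t + 1/2<..}"
    using iff[of "{t + 1/2<..} \<inter> I"] foot_in[OF g(1,2) ne] by auto
qed

declare curtain_set.simps [simp del] neg_halfspace.simps [simp del] pos_halfspace.simps [simp del]
  is_curtain.simps [simp del] flip.simps [simp del]

text \<open>What makes a curtain a wall, stated without its dual geodesic. Openness comes from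
  continuity of the foot, connectedness from \<open>connected_foot_vimage\<close>, and the gap from
  the foot being 1-Lipschitz and having to pass an interval of length 1.\<close>

lemma curtain_facts:
  fixes h :: "'a curtain"
  assumes "is_curtain h"
  shows curtain_cases: "x \<in> neg h \<or> x \<in> mid h \<or> x \<in> pos h"
    and neg_not_mid: "x \<in> neg h \<Longrightarrow> x \<notin> mid h"
    and neg_not_pos: "x \<in> neg h \<Longrightarrow> x \<notin> pos h"
    and mid_not_pos: "x \<in> mid h \<Longrightarrow> x \<notin> pos h"
    and open_neg: "open (neg h)"
    and open_pos: "open (pos h)"
    and mid_nonempty: "mid h \<noteq> {}"
    and connected_mid: "connected (mid h)"
    and connected_neg_mid: "connected (neg h \<union> mid h)"
    and connected_mid_pos: "connected (mid h \<union> pos h)"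
    and dist_neg_pos: "x \<in> neg h \<Longrightarrow> y \<in> pos h \<Longrightarrow> dist x y > 1"
proof -
  obtain I c t where h: "h = (I, c, t)" by (cases h)
  note parts = curtain_parts_foot[OF assms[unfolded h]]
  have g: "geodesic_on I c" "closed I" and sub: "{t - 1/2..t + 1/2} \<subseteq> I" 
    using assms h by (auto simp: is_curtain.simps)
  have "t \<in> {t - 1/2..t + 1/2}" by simp
  with sub have tI: "t \<in> I" by blast
  then have ne: "I \<noteq> {}" by blast
  note fI = foot_in[OF g ne]
  have cont: "continuous_on UNIV (foot I c)" by (rule continuous_on_foot[OF g ne])
  have i: "is_interval I" using g by (simp add: geodesic_on_def)
  show "x \<in> neg h \<or> x \<in> mid h \<or> x \<in> pos h" "x \<in> neg h \<Longrightarrow> x \<notin> mid h"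
    "x \<in> neg h \<Longrightarrow> x \<notin> pos h" "x \<in> mid h \<Longrightarrow> x \<notin> pos h"
    unfolding h parts by auto
  show "open (neg h)" "open (pos h)"
    unfolding h parts using cont by (auto intro: open_vimage)
  show "mid h \<noteq> {}"
    using foot_geodesic[OF g tI] unfolding h parts by (metis \<open>t \<in> {t - 1/2..t + 1/2}\<close> empty_iff vimageI)
  show "connected (mid h)"
    unfolding h parts by (rule connected_foot_vimage[OF g _ sub]) (simp add: is_interval_cc)
  have "neg h \<union> mid h = foot I c -` (I \<inter> {..t + 1/2})"
    unfolding h parts using fI by auto
  then show "connected (neg h \<union> mid h)"
    using connected_foot_vimage[OF g, of "I \<inter> {..t + 1/2}"] i by (simp add: is_interval_Int)
  have "mid h \<union> pos h = foot I c -` (I \<inter> {t - 1/2..})"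
    unfolding h parts using fI by auto
  then show "connected (mid h \<union> pos h)"
    using connected_foot_vimage[OF g, of "I \<inter> {t - 1/2..}"] i by (simp add: is_interval_Int)
  show "x \<in> neg h \<Longrightarrow> y \<in> pos h \<Longrightarrow> dist x y > 1"
    using foot_lipschitz[OF g ne, of x y] unfolding h parts by auto
qed

text \<open>The half-spaces are open and disjoint, so they cannot cover a connected set that meets
  both.\<close>

lemma connected_crosses:
  fixes h :: "'a curtain"
  assumes h: "is_curtain h" and S: "connected S" and x: "x \<in> S" "x \<in> neg h" and y: "y \<in> S" "y \<in> pos h"
  shows "S \<inter> mid h \<noteq> {}"
proof
  assume "S \<inter> mid h = {}"
  then have "S \<subseteq> neg h \<union> pos h" using curtain_cases[OF h] by blast
  moreover have "neg h \<inter> pos h \<inter> S = {}" using neg_not_pos[OF h] by blast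
  ultimately show False
    using connectedD[OF S open_neg[OF h] open_pos[OF h]] x y by blast
qed

lemma connected_subset_neg:
  fixes h :: "'a curtain"
  assumes "is_curtain h" "connected S" "S \<inter> mid h = {}" "x \<in> S" "x \<in> neg h"
  shows "S \<subseteq> neg h"
  using connected_crosses[OF assms(1,2,4,5)] curtain_cases[OF assms(1)] assms(3) by blast

lemma connected_subset_pos:
  fixes h :: "'a curtain"
  assumes "is_curtain h" "connected S" "S \<inter> mid h = {}" "x \<in> S" "x \<in> pos h"
  shows "S \<subseteq> pos h"
  using connected_crosses[OF assms(1,2) _ _ assms(4,5)] curtain_cases[OF assms(1)] assms(3) by blast

section \<open>Ordered chains\<close>

text \<open>The order of walls with orientation. Disjoint curtains could also have half-spaces
  facing each other; the two inclusions exclude this and force the half-spaces to be nested.\<close>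

definition before :: "'a curtain \<Rightarrow> 'a curtain \<Rightarrow> bool" where
  "before h k \<longleftrightarrow> is_curtain h \<and> is_curtain k \<and> mid h \<subseteq> neg k \<and> mid k \<subseteq> pos h"

text \<open>\<open>neg h\<close> together with \<open>mid h\<close> is connected, avoids
  \<open>mid k\<close> because that lies in \<open>pos h\<close>, and has a point in
  \<open>neg k\<close>. The other side is symmetric.\<close>

lemma before_nested:
  assumes "before h k"
  shows before_neg: "neg h \<union> mid h \<subseteq> neg k" and before_pos: "mid k \<union> pos k \<subseteq> pos h"
proof -
  have c: "is_curtain h" "is_curtain k" and hk: "mid h \<subseteq> neg k" "mid k \<subseteq> pos h"
    using assms by (auto simp: before_def)
  obtain x y where xy: "x \<in> mid h" "y \<in> mid k" using mid_nonempty c by blast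
  have "(neg h \<union> mid h) \<inter> mid k = {}"
    using hk(2) neg_not_pos[OF c(1)] mid_not_pos[OF c(1)] by blast
  then show "neg h \<union> mid h \<subseteq> neg k"
    using connected_subset_neg[OF c(2) connected_neg_mid[OF c(1)]] xy hk by blast
  have "(mid k \<union> pos k) \<inter> mid h = {}"
    using hk(1) neg_not_pos[OF c(2)] neg_not_mid[OF c(2)] by blast
  then show "mid k \<union> pos k \<subseteq> pos h"
    using connected_subset_pos[OF c(1) connected_mid_pos[OF c(2)]] xy hk by blast
qed

lemma before_trans: "before h k \<Longrightarrow> before k l \<Longrightarrow> before h l"
  using before_neg[of k l] before_pos[of h k] unfolding before_def by blast

lemma before_flip: "before h k \<Longrightarrow> before (flip k) (flip h)"
  by (auto simp: before_def flip_parts is_curtain_flip)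

text \<open>Each of two disjoint curtains lies on one side of the other, which leaves four
  configurations. The common positive point \<open>x\<close> and the common negative point
  \<open>a\<close> each exclude one of the two in which the orientations disagree.\<close>

lemma before_total:
  assumes c: "is_curtain h" "is_curtain k" and d: "mid h \<inter> mid k = {}"
    and a: "a \<in> neg h" "a \<in> neg k" and x: "x \<in> pos h" "x \<in> pos k"
  shows "before h k \<or> before k h"
proof -
  obtain u v where uv: "u \<in> mid h" "v \<in> mid k" using mid_nonempty c by blast
  have h: "mid h \<subseteq> neg k \<or> mid h \<subseteq> pos k"
    using connected_subset_neg[OF c(2) connected_mid[OF c(1)]]
      connected_subset_pos[OF c(2) connected_mid[OF c(1)]] d curtain_cases[OF c(2)] uv by blast
  have k: "mid k \<subseteq> neg h \<or> mid k \<subseteq> pos h"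
    using connected_subset_neg[OF c(1) connected_mid[OF c(2)]]
      connected_subset_pos[OF c(1) connected_mid[OF c(2)]] d curtain_cases[OF c(1)] uv by blast
  have "\<not> (mid h \<subseteq> neg k \<and> mid k \<subseteq> neg h)"
  proof
    assume *: "mid h \<subseteq> neg k \<and> mid k \<subseteq> neg h"
    then have "(mid h \<union> pos h) \<inter> mid k = {}" using neg_not_pos[OF c(1)] d by blast
    then have "mid h \<union> pos h \<subseteq> neg k"
      using connected_subset_neg[OF c(2) connected_mid_pos[OF c(1)]] uv * by blast
    then show False using x neg_not_pos[OF c(2)] by blast
  qed
  moreover have "\<not> (mid h \<subseteq> pos k \<and> mid k \<subseteq> pos h)"
  proof
    assume *: "mid h \<subseteq> pos k \<and> mid k \<subseteq> pos h"
    then have "(neg h \<union> mid h) \<inter> mid k = {}" using neg_not_pos[OF c(1)] d by blast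
    then have "neg h \<union> mid h \<subseteq> pos k"
      using connected_subset_pos[OF c(2) connected_neg_mid[OF c(1)]] uv * by blast
    then show False using a neg_not_pos[OF c(2)] by blast
  qed
  ultimately show ?thesis using h k c by (auto simp: before_def)
qed

lemma connected_between:
  assumes "before h k" "connected S" "S \<inter> mid h \<noteq> {}" "S \<inter> (mid k \<union> pos k) \<noteq> {}"
  shows "S \<inter> mid k \<noteq> {}"
  using assms connected_crosses[of k S] unfolding before_def by blast

text \<open>\<open>sorted_wrt\<close> relates all pairs and not only consecutive ones, so every
  sublist is again an ordered chain.\<close>

definition ochain :: "nat \<Rightarrow> 'a curtain list \<Rightarrow> bool" where
  "ochain L hs \<longleftrightarrow> (\<forall>h\<in>set hs. is_curtain h) \<and> sorted_wrt (\<lambda>h k. before h k \<and> L_separated L h k) hs"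

lemma ochain_filter: "ochain L hs \<Longrightarrow> ochain L (filter P hs)"
  by (auto simp: ochain_def sorted_wrt_filter)

lemma ochain_append:
  "ochain L (hs @ ks) \<longleftrightarrow> ochain L hs \<and> ochain L ks \<and>
    (\<forall>h\<in>set hs. \<forall>k\<in>set ks. before h k \<and> L_separated L h k)"
  by (auto simp: ochain_def sorted_wrt_append)

lemma ochain_Cons:
  "ochain L (h # hs) \<longleftrightarrow> is_curtain h \<and> ochain L hs \<and> (\<forall>k\<in>set hs. before h k \<and> L_separated L h k)"
  by (auto simp: ochain_def)

lemma ochain_Nil [simp]: "ochain L []"
  by (simp add: ochain_def)

lemma ochain_rev_flip: "ochain L hs \<Longrightarrow> ochain L (rev (map flip hs))"
proof (induction hs)
  case (Cons h hs)
  have "L_separated L (flip k) (flip h) \<longleftrightarrow> L_separated L h k" for k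
    using L_separated_cong[of "flip k" k "flip h" h] by (simp add: flip_parts L_separated_commute)
  with Cons show ?case
    by (auto simp: ochain_Cons ochain_append before_flip is_curtain_flip)
qed simp

lemma sorted_wrt_before_chain:
  assumes hs: "\<And>h. h \<in> set hs \<Longrightarrow> is_curtain h" "sorted_wrt before hs"
  shows "chain hs"
proof -
  have b: "before (hs ! i) (hs ! j)" if "i < j" "j < length hs" for i j
    using hs(2) that by (simp add: sorted_wrt_iff_nth_less)
  have "disjnt (mid (hs ! i)) (mid (hs ! Suc i))" if "Suc i < length hs" for i
  proof -
    have "before (hs ! i) (hs ! Suc i)" using b that by simp
    then show ?thesis using neg_not_mid[of "hs ! Suc i"] unfolding before_def disjnt_def by blast
  qed
  moreover have "separates (hs ! Suc i) (mid (hs ! i)) (mid (hs ! Suc (Suc i)))"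
    if "Suc (Suc i) < length hs" for i
    using b[of i "Suc i"] b[of "Suc i" "Suc (Suc i)"] that by (simp add: before_def separates_def)
  ultimately show ?thesis using hs(1) by (simp add: chain_def)
qed

lemma ochain_chain: "ochain L hs \<Longrightarrow> chain hs"
  unfolding ochain_def by (blast intro: sorted_wrt_before_chain sorted_wrt_mono_rel[rotated])

lemma ochain_L_chain:
  assumes "ochain L hs"
  shows "L_chain L hs"
proof -
  have "L_separated L (hs ! i) (hs ! j)" if "i < length hs" "j < length hs" "i \<noteq> j" for i j
  proof -
    have "\<And>i j. i < j \<Longrightarrow> j < length hs \<Longrightarrow> L_separated L (hs ! i) (hs ! j)"
      using assms by (simp add: ochain_def sorted_wrt_iff_nth_less)
    then show ?thesis using that L_separated_commute by (metis linorder_neqE_nat)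
  qed
  with ochain_chain[OF assms] show ?thesis by (simp add: L_chain_def)
qed

section \<open>Chains between two sets, oriented from the first to the second\<close>

definition sepchain :: "nat \<Rightarrow> 'a curtain list \<Rightarrow> 'a set \<Rightarrow> 'a set \<Rightarrow> bool" where
  "sepchain L hs A B \<longleftrightarrow> ochain L hs \<and> (\<forall>h\<in>set hs. A \<subseteq> neg h \<and> B \<subseteq> pos h)"

lemma sepchain_rev_flip: "sepchain L hs A B \<Longrightarrow> sepchain L (rev (map flip hs)) B A"
  by (auto simp: sepchain_def ochain_rev_flip flip_parts)

lemma sepchain_mono: "sepchain L hs A B \<Longrightarrow> A' \<subseteq> A \<Longrightarrow> B' \<subseteq> B \<Longrightarrow> sepchain L hs A' B'"
  unfolding sepchain_def by blast

lemma sepchain_append: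
  "sepchain L (hs @ ks) A B \<Longrightarrow> sepchain L hs A B \<and> sepchain L ks A B"
  by (auto simp: sepchain_def ochain_append)

text \<open>Each curtain is flipped, if necessary, so that \<open>a\<close> is on its negative side.
  Consecutive curtains are then comparable, always in the same direction, so the list or its reverse
  is ordered.\<close>

lemma L_chain_orient:
  assumes hs: "L_chain L hs" and sep: "\<And>h. h \<in> set hs \<Longrightarrow> separates h {a} {x}"
  obtains ks where "sepchain L ks {a} {x}" "length ks = length hs"
proof -
  define n where "n = length hs"
  define ks where "ks = map (\<lambda>h. if a \<in> neg h then h else flip h) hs"
  have len: "length ks = n" by (simp add: ks_def n_def)
  have mids: "mid (ks ! i) = mid (hs ! i)" if "i < n" for i
    using that by (simp add: ks_def n_def flip_parts)
  have ch: "chain hs" using hs by (simp add: L_chain_def)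
  have cur: "is_curtain h" if "h \<in> set ks" for h
    using that ch is_curtain_flip by (fastforce simp: ks_def chain_def)
  have side: "a \<in> neg h" "x \<in> pos h" if h: "h \<in> set ks" for h
  proof -
    obtain k where k: "k \<in> set hs" "h = (if a \<in> neg k then k else flip k)"
      using h unfolding ks_def set_map by blast
    have "is_curtain k" using ch k by (auto simp: chain_def)
    then show "a \<in> neg h" "x \<in> pos h"
      using sep[OF k(1)] k(2) neg_not_pos[of k] by (auto simp: separates_singletons flip_parts)
  qed
  have nth: "ks ! i \<in> set ks" if "i < n" for i using that len by simp
  have tot: "before (ks ! i) (ks ! Suc i) \<or> before (ks ! Suc i) (ks ! i)" if "Suc i < n" for i
  proof (rule before_total[where a = a and x = x])
    show "mid (ks ! i) \<inter> mid (ks ! Suc i) = {}"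
      using ch that mids[of i] mids[of "Suc i"] by (simp add: chain_def disjnt_def n_def)
  qed (use nth[of i] nth[of "Suc i"] that cur side in auto)
  \<comment> \<open>The middle curtain separates its neighbours, so the direction cannot change
    along the list.\<close>
  have step: "before (ks ! i) (ks ! Suc i) \<longleftrightarrow> before (ks ! Suc i) (ks ! Suc (Suc i))"
    if i: "Suc (Suc i) < n" for i
  proof -
    let ?h = "ks ! i" and ?k = "ks ! Suc i" and ?l = "ks ! Suc (Suc i)"
    have sepk: "separates (hs ! Suc i) (mid ?h) (mid ?l)"
      using ch i mids[of i] mids[of "Suc (Suc i)"] by (simp add: chain_def n_def)
    have eq: "?k = hs ! Suc i \<or> ?k = flip (hs ! Suc i)" using i by (simp add: ks_def n_def)
    have s: "mid ?h \<subseteq> neg ?k \<and> mid ?l \<subseteq> pos ?k \<or> mid ?l \<subseteq> neg ?k \<and> mid ?h \<subseteq> pos ?k"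
      using sepk eq by (auto simp: separates_def flip_parts)
    have c: "is_curtain ?h" "is_curtain ?k" "is_curtain ?l"
      using nth cur i by auto
    have t: "before ?h ?k \<or> before ?k ?h" "before ?k ?l \<or> before ?l ?k"
      using tot i by auto
    have ne: "mid ?h \<noteq> {}" "mid ?l \<noteq> {}" using mid_nonempty c by auto
    show ?thesis
      using s t ne neg_not_pos[OF c(2)] unfolding before_def by blast
  qed
  have *: "sepchain L ks' {a} {x}" if s: "sorted_wrt before ks'" and e: "ks' = ks \<or> ks' = rev ks" for ks'
  proof -
    have Ls: "L_separated L (ks ! i) (ks ! j)" if "i < n" "j < n" "i \<noteq> j" for i j
      using hs that mids L_separated_cong[of "ks ! i" "hs ! i" "ks ! j" "hs ! j" L]
      by (simp add: L_chain_def n_def)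
    have "L_separated L (ks' ! i) (ks' ! j)" if "i < j" "j < length ks'" for i j
      using e Ls that len by (auto simp: rev_nth)
    with s have "sorted_wrt (\<lambda>h k. before h k \<and> L_separated L h k) ks'"
      by (simp add: sorted_wrt_iff_nth_less)
    moreover have "set ks' = set ks" using e by auto
    ultimately show ?thesis using cur side by (auto simp: sepchain_def ochain_def)
  qed
  \<comment> \<open>By transitivity consecutive comparisons suffice; the first pair decides between
    \<open>ks\<close> and \<open>rev ks\<close>.\<close>
  have tr: "transp before" using before_trans by (auto intro: transpI)
  show thesis
  proof (cases "Suc 0 < n \<and> \<not> before (ks ! 0) (ks ! Suc 0)")
    case False
    have "before (ks ! i) (ks ! Suc i)" if "Suc i < n" for i
      using that by (induction i) (use False step in auto)
    then have "sorted_wrt before ks"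
      using len by (simp add: sorted_wrt_iff_nth_Suc_transp[OF tr])
    from *[OF this] show thesis by (intro that[of ks]) (simp_all add: len n_def)
  next
    case True
    have nb: "\<not> before (ks ! i) (ks ! Suc i)" if "Suc i < n" for i
      using that by (induction i) (use True step in auto)
    have "transp (\<lambda>x y. before y x)" using before_trans by (auto intro: transpI)
    then have "sorted_wrt (\<lambda>x y. before y x) ks"
      using len nb tot by (simp add: sorted_wrt_iff_nth_Suc_transp)
    then have "sorted_wrt before (rev ks)" by (simp add: sorted_wrt_rev)
    from *[OF this] show thesis by (intro that[of "rev ks"]) (simp_all add: len n_def)
  qed
qed

lemma geod_props:
  "continuous_on {0..dist x y} (geod x y)" "geod x y 0 = x" "geod x y (dist x y) = y"
  "geodesic_on {0..dist x y} (geod x y)"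
  using geodesic_segment_geod[of x y] geodesic_on_continuous unfolding geodesic_segment_def by blast+

text \<open>The geodesic from \<open>a\<close> to \<open>x\<close> meets the second curtain
  \<open>k\<close> in a point beyond \<open>h\<close>, hence at distance more than 1 from
  \<open>a\<close>. That point is on the negative side of all later curtains, and the argument
  repeats from there, two curtains at a time.\<close>

lemma length_le_dist:
  "2 * m \<le> length hs \<Longrightarrow> sepchain L hs {a} {x} \<Longrightarrow> real m \<le> dist a x"
proof (induction m arbitrary: hs a)
  case (Suc m)
  then obtain h k rest where hs: "hs = h # k # rest" "2 * m \<le> length rest"
    by (cases hs; cases "tl hs") auto
  have hk: "before h k" "is_curtain k" "is_curtain h" and ax: "a \<in> neg h" "a \<in> neg k" "x \<in> pos k"
    using Suc.prems(2) unfolding hs by (auto simp: sepchain_def ochain_Cons)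
  let ?g = "geod a x"
  note g = geod_props[of a x]
  have "connected (?g ` {0..dist a x})"
    using g(1) by (intro connected_continuous_image) auto
  moreover have "a \<in> ?g ` {0..dist a x}" "x \<in> ?g ` {0..dist a x}"
    using g(2,3) by (metis atLeastAtMost_iff image_eqI order_refl zero_le_dist)+
  ultimately obtain s where s: "s \<in> {0..dist a x}" "?g s \<in> mid k"
    using connected_crosses[OF hk(2)] ax by blast
  have d: "dist a (?g s) = s" "dist (?g s) x = dist a x - s"
    using geodesic_on_dist[OF g(4), of 0 s] geodesic_on_dist[OF g(4), of s "dist a x"] s(1) g(2,3) by auto
  have "?g s \<in> pos h" using s hk(1) by (auto simp: before_def)
  then have "dist a (?g s) > 1" using dist_neg_pos[OF hk(3)] ax by blast
  moreover have "sepchain L rest {?g s} {x}"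
    using Suc.prems(2) s(2) before_neg[of k] unfolding hs sepchain_def ochain_Cons
    by (simp add: subset_iff)
  then have "real m \<le> dist (?g s) x" using Suc.IH[OF hs(2)] by blast
  ultimately show ?case using d by simp
qed simp

lemma length_le:
  assumes "sepchain L hs {a} {x}"
  shows "real (length hs) \<le> 2 * dist a x + 1"
proof -
  have "real (length hs div 2) \<le> dist a x"
    using length_le_dist[OF _ assms] by simp
  moreover have "length hs \<le> 2 * (length hs div 2) + 1" by presburger
  then have "real (length hs) \<le> 2 * real (length hs div 2) + 1" by linarith
  ultimately show ?thesis by simp
qed

text \<open>A point lies in at most one curtain of an ordered chain: if it is not beyond a curtain,
  it is on the negative side of all later ones.\<close>

lemma length_split:
  "ochain L hs \<Longrightarrow> length hs \<le> length (filter (\<lambda>h. z \<in> neg h) hs) + length (filter (\<lambda>h. z \<in> pos h) hs) + 1"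
proof (induction hs)
  case (Cons h hs)
  show ?case
  proof (cases "z \<in> pos h")
    case True
    with Cons show ?thesis by (simp add: ochain_Cons)
  next
    case False
    then have "\<forall>k\<in>set hs. z \<in> neg k"
      using Cons.prems curtain_cases[of h z] before_neg unfolding ochain_Cons by blast
    then have "filter (\<lambda>h. z \<in> neg h) hs = hs" by (simp add: filter_id_conv)
    then show ?thesis by simp
  qed
qed simp

section \<open>The largest number of separating curtains\<close>

definition sepnum :: "nat \<Rightarrow> 'a \<Rightarrow> 'a \<Rightarrow> nat" where
  "sepnum L x y = Max {length hs | hs. L_chain L hs \<and> (\<forall>h\<in>set hs. separates h {x} {y})}"

lemma sepnum_commute: "sepnum L x y = sepnum L y x"
  unfolding sepnum_def separates_singletons by (simp add: disj_commute)

text \<open>Makes the maximum in \<open>d_L\<close> a genuine one. A separating chain can be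
  oriented without changing its length, and then \<open>length_le\<close> bounds it.\<close>

lemma sepnum_set:
  fixes x y :: 'a
  shows "finite {length hs | hs. L_chain L hs \<and> (\<forall>h\<in>set hs. separates h {x} {y})}" (is "finite ?S")
  "0 \<in> {length hs | hs. L_chain L hs \<and> (\<forall>h\<in>set hs. separates h {x} {y})}"
proof -
  have "n \<le> nat \<lceil>2 * dist x y + 1\<rceil>" if n: "n \<in> ?S" for n
  proof -
    obtain hs where hs: "n = length hs" "L_chain L hs" "\<forall>h\<in>set hs. separates h {x} {y}"
      using n by blast
    then obtain ks where "sepchain L ks {x} {y}" "length ks = n"
      using L_chain_orient by metis
    then show ?thesis using length_le[of L ks x y] by linarith
  qed
  then have "?S \<subseteq> {..nat \<lceil>2 * dist x y + 1\<rceil>}" by blast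
  then show "finite ?S" by (rule finite_subset) simp
  have "L_chain L ([] :: 'a curtain list)" by (simp add: L_chain_def chain_def)
  then show "0 \<in> ?S" by (intro CollectI exI[of _ "[]"]) simp
qed

lemma sepnum_attained:
  obtains hs where "sepchain L hs {x} {y}" "length hs = sepnum L x y"
proof -
  have "sepnum L x y \<in> {length hs | hs. L_chain L hs \<and> (\<forall>h\<in>set hs. separates h {x} {y})}"
    unfolding sepnum_def using sepnum_set[of L x y] by (intro Max_in) auto
  then obtain hs where "sepnum L x y = length hs" "L_chain L hs" "\<forall>h\<in>set hs. separates h {x} {y}"
    by blast
  then show thesis using that L_chain_orient by metis
qed

lemma sepnum_ge:
  assumes "sepchain L hs {x} {y}"
  shows "length hs \<le> sepnum L x y"
  unfolding sepnum_def
  by (rule Max_ge[OF sepnum_set(1)])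
    (use assms in \<open>auto simp: sepchain_def separates_singletons intro: ochain_L_chain\<close>)

text \<open>Two bounds instead of an equation, so as to cover \<open>x = y\<close>, where
  \<open>d_L\<close> is 0 and no curtain separates.\<close>

lemma d_L_bounds: "real (sepnum L x y) \<le> d_L L x y" "d_L L x y \<le> real (sepnum L x y) + 1"
proof -
  have "sepnum L x x = 0"
  proof -
    obtain hs where hs: "sepchain L hs {x} {x}" "length hs = sepnum L x x"
      using sepnum_attained .
    then have "hs = []" using neg_not_pos by (cases hs) (auto simp: sepchain_def ochain_Cons)
    with hs show ?thesis by simp
  qed
  then show "real (sepnum L x y) \<le> d_L L x y" "d_L L x y \<le> real (sepnum L x y) + 1"
    by (auto simp: d_L_def sepnum_def)
qed

section \<open>Gromov products count separating curtains\<close>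

text \<open>A curtain of \<open>ks\<close> that is not contained in \<open>pos h\<close> meets both
  \<open>h\<close> and \<open>h'\<close>: it reaches back to \<open>h\<close> or behind it, and it
  also has a point in or beyond \<open>h'\<close>.\<close>

lemma few_crossing:
  assumes h: "before h h'" "L_separated L h h'" and ks: "ochain L ks"
    and uv: "\<And>k. k \<in> set ks \<Longrightarrow> \<exists>u v. u \<in> neg k \<and> v \<in> pos k \<and> u \<in> pos h' \<and> v \<in> pos h'"
  shows "length (filter (\<lambda>k. \<not> mid k \<subseteq> pos h) ks) \<le> L"
proof -
  let ?cs = "filter (\<lambda>k. \<not> mid k \<subseteq> pos h) ks"
  have c: "is_curtain h" "is_curtain h'" using h by (auto simp: before_def)
  have "chain ?cs" using ochain_chain ochain_filter ks by blast
  moreover have "mid k \<inter> mid h \<noteq> {} \<and> mid k \<inter> mid h' \<noteq> {}" if k: "k \<in> set ?cs" for k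
  proof -
    have ck: "is_curtain k" using k ks by (auto simp: ochain_def)
    obtain u v where "u \<in> neg k" "v \<in> pos k" "u \<in> pos h'" "v \<in> pos h'" using uv[of k] k unfolding set_filter by blast
    \<comment> \<open>The closed positive side of \<open>h'\<close> is connected and contains points
      on both sides of \<open>k\<close>.\<close>
    then have "(mid h' \<union> pos h') \<inter> mid k \<noteq> {}"
      using connected_crosses[OF ck connected_mid_pos[OF c(2)]] by blast
    then obtain z where z: "z \<in> mid k" "z \<in> mid h' \<union> pos h'" by blast
    obtain w where w: "w \<in> mid k" "w \<in> neg h \<union> mid h"
      using k curtain_cases[OF c(1)] by fastforce
    have zh: "z \<in> pos h" using z before_pos[OF h(1)] by blast
    have wh: "w \<in> neg h'" using w before_neg[OF h(1)] by blast
    have "mid k \<inter> mid h \<noteq> {}"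
      using connected_crosses[OF c(1) connected_mid[OF ck], of w z] w z zh by blast
    moreover have "mid k \<inter> mid h' \<noteq> {}"
      using connected_crosses[OF c(2) connected_mid[OF ck], of w z] w z wh by blast
    ultimately show ?thesis ..
  qed
  ultimately show ?thesis using h(2) unfolding L_separated_def by blast
qed

text \<open>The last curtain \<open>k0\<close> is given up as a buffer: whatever meets some
  \<open>k\<close> in \<open>ks\<close> and some \<open>h\<close> in \<open>hs\<close> must cross
  \<open>k0\<close>, so \<open>k\<close> and \<open>h\<close> inherit L-separation from
  \<open>k\<close> and \<open>k0\<close>.\<close>

lemma ochain_glue:
  assumes ks: "ochain L (ks @ [k0])" and hs: "ochain L hs"
    and b: "\<And>k h. k \<in> set (ks @ [k0]) \<Longrightarrow> h \<in> set hs \<Longrightarrow> before k h"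
  shows "ochain L (ks @ hs)"
proof -
  have "L_separated L k h" if k: "k \<in> set ks" and h: "h \<in> set hs" for k h
    unfolding L_separated_def
  proof (intro allI impI)
    fix cs assume cs: "chain cs \<and> (\<forall>c\<in>set cs. mid c \<inter> mid k \<noteq> {} \<and> mid c \<inter> mid h \<noteq> {})"
    have kk0: "before k k0" "L_separated L k k0" using ks k by (auto simp: ochain_append)
    have k0h: "before k0 h" using b h by auto
    have "mid c \<inter> mid k0 \<noteq> {}" if c: "c \<in> set cs" for c
    proof (rule connected_between[OF kk0(1) connected_mid])
      show "is_curtain c" using cs c by (auto simp: chain_def)
      show "mid c \<inter> mid k \<noteq> {}" using cs c by blast
      show "mid c \<inter> (mid k0 \<union> pos k0) \<noteq> {}" using cs c k0h by (auto simp: before_def)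
    qed
    then show "length cs \<le> L" using kk0(2) cs unfolding L_separated_def by blast
  qed
  then show ?thesis using ks hs b by (simp add: ochain_append)
qed

text \<open>Reversing \<open>hs\<close> and putting \<open>ks\<close> in front of it gives a chain
  from \<open>x\<close> to \<open>p\<close>. The cost is the last curtain of \<open>hs\<close>, at
  most \<open>L\<close> curtains of \<open>ks\<close> that reach back too far, and one buffer
  curtain for gluing, hence \<open>L + 2\<close>.\<close>

lemma sepchain_join:
  assumes hs: "sepchain L hs {p} {x, y}" and ks: "sepchain L ks {x} {p, y}"
  shows "length hs + length ks \<le> sepnum L x p + L + 2"
proof -
  have ks0: "length ks \<le> sepnum L x p" using sepnum_ge sepchain_mono[OF ks] by simp
  consider "hs = []" | h' where "hs = [h']" | hs0 h h' where "hs = (hs0 @ [h]) @ [h']"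
    by (metis append_Nil rev_exhaust)
  then show ?thesis
  proof cases
    case (3 hs0 h h')
    have hh': "before h h'" "L_separated L h h'" using hs unfolding 3 by (auto simp: sepchain_def ochain_append ochain_Cons)
    define ks' where "ks' = filter (\<lambda>k. mid k \<subseteq> pos h) ks"
    \<comment> \<open>\<open>x\<close> and \<open>y\<close> are both beyond \<open>h'\<close> and on
      different sides of every curtain of \<open>ks\<close>, as \<open>few_crossing\<close>
      requires.\<close>
    have "length (filter (\<lambda>k. \<not> mid k \<subseteq> pos h) ks) \<le> L"
      by (rule few_crossing[OF hh']) (use hs ks in \<open>auto simp: 3 sepchain_def\<close>)
    then have lks: "length ks \<le> length ks' + L"
      using sum_length_filter_compl[of "\<lambda>k. mid k \<subseteq> pos h" ks] by (simp add: ks'_def)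
    define fs where "fs = rev (map flip (hs0 @ [h]))"
    have fs: "sepchain L fs {x} {p}"
      unfolding fs_def using sepchain_mono[OF sepchain_rev_flip] sepchain_append hs unfolding 3
      by (metis insert_subset order_refl empty_subsetI singletonI subset_insertI)
    have lfs: "length fs + 1 = length hs" by (simp add: fs_def 3)
    have ks': "sepchain L ks' {x} {p}"
      using ks by (auto simp: ks'_def sepchain_def ochain_filter)
    have b: "before k f" if k: "k \<in> set ks'" and f: "f \<in> set fs" for k f
    proof -
      obtain g where g: "g \<in> set (hs0 @ [h])" "f = flip g" using f unfolding fs_def set_rev set_map by blast
      have c: "is_curtain g" "is_curtain k"
        using g hs k ks' unfolding 3 by (auto simp: sepchain_def ochain_def)
      have "pos h \<subseteq> pos g"
        using g hs before_pos[of g h] unfolding 3 by (auto simp: sepchain_def ochain_append)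
      then have kg: "mid k \<subseteq> pos g" using k by (auto simp: ks'_def)
      have "p \<in> neg g" using g hs unfolding 3 by (auto simp: sepchain_def)
      moreover have "(neg g \<union> mid g) \<inter> mid k = {}"
        using kg neg_not_pos[OF c(1)] mid_not_pos[OF c(1)] by blast
      moreover have "p \<in> pos k" using k ks' by (auto simp: sepchain_def)
      \<comment> \<open>The closed side of \<open>g\<close> containing \<open>p\<close> is connected
        and avoids \<open>k\<close>, so all of it is on the side of \<open>k\<close> that contains
        \<open>p\<close>.\<close>
      ultimately have "neg g \<union> mid g \<subseteq> pos k"
        using connected_subset_pos[OF c(2) connected_neg_mid[OF c(1)]] by blast
      with kg c show ?thesis by (simp add: g before_def flip_parts is_curtain_flip)
    qed
    show ?thesis
    proof (cases ks' rule: rev_cases)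
      case Nil
      then show ?thesis using lks lfs sepnum_ge[OF fs] by simp
    next
      case (snoc ks'' k0)
      have "ochain L (ks'' @ fs)"
        by (rule ochain_glue[of L ks'' k0]) (use ks' fs b snoc in \<open>auto simp: sepchain_def\<close>)
      then have "sepchain L (ks'' @ fs) {x} {p}"
        using ks' fs by (auto simp: sepchain_def snoc)
      from sepnum_ge[OF this] show ?thesis using lks lfs by (simp add: snoc)
    qed
  qed (use ks0 in auto)
qed

text \<open>Working substitute for a Gromov product of at least \<open>n\<close>; the next two
  lemmas show agreement up to an additive constant. With \<open>x = y\<close> it speaks of a chain
  from \<open>p\<close> to \<open>x\<close>.\<close>

definition csep :: "nat \<Rightarrow> nat \<Rightarrow> 'a \<Rightarrow> 'a \<Rightarrow> 'a \<Rightarrow> bool" where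
  "csep L n p x y \<longleftrightarrow> (\<exists>hs. sepchain L hs {p} {x, y} \<and> n \<le> length hs)"

text \<open>A longest chain from \<open>x\<close> to \<open>y\<close> is split according to the side
  of \<open>p\<close>. Each part is joined to the chain between \<open>p\<close> and the two points,
  giving long chains from \<open>x\<close> to \<open>p\<close> and from \<open>y\<close> to
  \<open>p\<close>.\<close>

lemma csep_imp_gromov_product:
  assumes "csep L n p x y"
  shows "gromov_product (d_L L) p x y \<ge> real n - real L - 3"
proof -
  obtain hs where hs: "sepchain L hs {p} {x, y}" "n \<le> length hs" using assms csep_def by blast
  obtain ks where ks: "sepchain L ks {x} {y}" "length ks = sepnum L x y" using sepnum_attained .
  define k1 where "k1 = filter (\<lambda>k. p \<in> pos k) ks"
  define k2 where "k2 = filter (\<lambda>k. p \<in> neg k) ks"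
  have l: "length ks \<le> length k2 + length k1 + 1"
    unfolding k1_def k2_def by (rule length_split[of L]) (use ks in \<open>simp add: sepchain_def\<close>)
  have "sepchain L k1 {x} {p, y}"
    using ks by (auto simp: k1_def sepchain_def ochain_filter)
  from sepchain_join[OF hs(1) this] have 1: "length hs + length k1 \<le> sepnum L x p + L + 2" .
  have "sepchain L k2 {p, x} {y}"
    using ks by (auto simp: k2_def sepchain_def ochain_filter)
  moreover have "sepchain L hs {p} {y, x}" using hs(1) by (simp add: insert_commute)
  ultimately have 2: "length hs + length k2 \<le> sepnum L y p + L + 2"
    using sepchain_join[of L hs p y x "rev (map flip k2)"] sepchain_rev_flip by fastforce
  \<comment> \<open>Two joins cost \<open>2 * L + 4\<close> and the split costs 1; passing from
    \<open>sepnum\<close> to \<open>d_L\<close> costs another 1 before halving.\<close>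
  have "real (2 * n + sepnum L x y) \<le> real (sepnum L x p + sepnum L y p + 2 * L + 5)"
    using 1 2 l ks(2) hs(2) by linarith
  then show ?thesis
    using d_L_bounds[of L x p] d_L_bounds[of L y p] d_L_bounds[of L x y]
    unfolding gromov_product_def by (simp add: field_simps)
qed

text \<open>Longest chains from \<open>p\<close> to \<open>x\<close> and to \<open>y\<close> are
  split by the other endpoint. The parts that separate \<open>x\<close> from \<open>y\<close> join
  to a chain bounded by the distance of \<open>x\<close> and \<open>y\<close>, so the remaining
  parts have total length at least \<open>2 * n\<close>, and one of them has length at least
  \<open>n\<close>.\<close>

lemma gromov_product_imp_csep:
  assumes "gromov_product (d_L L) p x y \<ge> real n + real L + 3"
  shows "csep L n p x y"
proof -
  obtain hs where hs: "sepchain L hs {p} {x}" "length hs = sepnum L p x" using sepnum_attained .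
  obtain ks where ks: "sepchain L ks {p} {y}" "length ks = sepnum L p y" using sepnum_attained .
  define h1 where "h1 = filter (\<lambda>h. y \<in> pos h) hs"
  define h2 where "h2 = filter (\<lambda>h. y \<in> neg h) hs"
  define k1 where "k1 = filter (\<lambda>k. x \<in> pos k) ks"
  define k2 where "k2 = filter (\<lambda>k. x \<in> neg k) ks"
  have lh: "length hs \<le> length h2 + length h1 + 1"
    unfolding h1_def h2_def by (rule length_split[of L]) (use hs in \<open>simp add: sepchain_def\<close>)
  have lk: "length ks \<le> length k2 + length k1 + 1"
    unfolding k1_def k2_def by (rule length_split[of L]) (use ks in \<open>simp add: sepchain_def\<close>)
  have "sepchain L h2 {y, p} {x}" "sepchain L k2 {x, p} {y}"
    using hs ks by (auto simp: h2_def k2_def sepchain_def ochain_filter)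
  then have "length h2 + length k2 \<le> sepnum L y x + L + 2"
    using sepchain_join[of L "rev (map flip h2)" x y p "rev (map flip k2)"] sepchain_rev_flip by fastforce
  then have "real (sepnum L p x + sepnum L p y) \<le> real (length h1 + length k1 + sepnum L x y + L + 4)"
    using lh lk hs(2) ks(2) sepnum_commute[of L x y] by linarith
  moreover have "2 * (real n + real L + 3) \<le> real (sepnum L p x) + 1 + (real (sepnum L p y) + 1) - sepnum L x y"
    using assms d_L_bounds[of L x p] d_L_bounds[of L y p] d_L_bounds[of L x y]
      sepnum_commute[of L x p] sepnum_commute[of L y p]
    unfolding gromov_product_def by (simp add: field_simps)
  ultimately have "real (2 * n) \<le> real (length h1 + length k1)" by simp
  then have "2 * n \<le> length h1 + length k1" by (simp only: of_nat_le_iff)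
  then have "n \<le> length h1 \<or> n \<le> length k1" by arith
  moreover have "sepchain L h1 {p} {x, y}" "sepchain L k1 {p} {x, y}"
    using hs ks by (auto simp: h1_def k1_def sepchain_def ochain_filter)
  ultimately show ?thesis unfolding csep_def by blast
qed

text \<open>At most \<open>2 * dist p q + 1\<close> curtains of the chain separate \<open>p\<close>
  from \<open>q\<close>, and at most one contains \<open>q\<close>; the others keep \<open>q\<close>
  on the side of \<open>p\<close>.\<close>

lemma csep_change_basepoint:
  assumes "csep L (n + nat \<lceil>2 * dist p q\<rceil> + 2) p x y"
  shows "csep L n q x y"
proof -
  obtain hs where hs: "sepchain L hs {p} {x, y}" "n + nat \<lceil>2 * dist p q\<rceil> + 2 \<le> length hs"
    using assms csep_def by blast
  define h1 where "h1 = filter (\<lambda>h. q \<in> neg h) hs"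
  define h2 where "h2 = filter (\<lambda>h. q \<in> pos h) hs"
  have l: "length hs \<le> length h1 + length h2 + 1"
    unfolding h1_def h2_def by (rule length_split[of L]) (use hs in \<open>simp add: sepchain_def\<close>)
  have "sepchain L h2 {p} {q}" "sepchain L h1 {q} {x, y}"
    using hs by (auto simp: h1_def h2_def sepchain_def ochain_filter)
  then show ?thesis
    using length_le[of L h2 p q] l hs(2) unfolding csep_def by (intro exI[of _ h1]) linarith
qed

end

context cat0
begin

section \<open>Geodesics crossing long chains\<close>

lemma dual_curtain:
  assumes "geodesic_on I c" "closed I" "{t - 1/2..t + 1/2} \<subseteq> I"
  shows "is_curtain (I, c, t)"
    and "x \<in> mid (I, c, t) \<longleftrightarrow> foot I c x \<in> {t - 1/2..t + 1/2}"
    and "x \<in> neg (I, c, t) \<longleftrightarrow> foot I c x < t - 1/2"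
    and "x \<in> pos (I, c, t) \<longleftrightarrow> foot I c x > t + 1/2"
proof -
  show *: "is_curtain (I, c, t)" using assms by (simp add: is_curtain.simps)
  show "x \<in> mid (I, c, t) \<longleftrightarrow> foot I c x \<in> {t - 1/2..t + 1/2}"
    "x \<in> neg (I, c, t) \<longleftrightarrow> foot I c x < t - 1/2"
    "x \<in> pos (I, c, t) \<longleftrightarrow> foot I c x > t + 1/2"
    using curtain_parts_foot[OF *] by auto
qed

text \<open>Produces the contradictions of \<open>bottleneck\<close> and \<open>no_return\<close>: a
  stretch of length \<open>2 * n\<close> carries a chain of \<open>n\<close> dual curtains.\<close>

lemma dual_chain_length:
  fixes c :: "real \<Rightarrow> 'a"
  assumes g: "geodesic_on I c" "closed I" and sub: "{a..a + 2 * real n} \<subseteq> I"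
    and sep: "L_separated L h k"
    and meet: "\<And>t. {t - 1/2..t + 1/2} \<subseteq> {a..a + 2 * real n} \<Longrightarrow>
      mid (I, c, t) \<inter> mid h \<noteq> {} \<and> mid (I, c, t) \<inter> mid k \<noteq> {}"
  shows "n \<le> L"
proof -
  \<comment> \<open>Centres two apart leave gaps of length 1 between the unit intervals and margins
    of 1/2 at both ends.\<close>
  define t where "t j = a + 2 * real j + 1" for j :: nat
  have tI: "{t j - 1/2..t j + 1/2} \<subseteq> {a..a + 2 * real n}" if "j < n" for j
  proof -
    have "real j + 1 \<le> real n" using that by linarith
    then show ?thesis by (auto simp: t_def)
  qed
  let ?cs = "map (\<lambda>j. (I, c, t j)) [0..<n]"
  have "before (I, c, t i) (I, c, t j)" if "i < j" "j < n" for i j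
  proof -
    have i: "{t i - 1/2..t i + 1/2} \<subseteq> I" and j: "{t j - 1/2..t j + 1/2} \<subseteq> I"
      using tI[of i] tI[of j] that sub by (blast intro: less_trans)+
    have "t i + 2 \<le> t j" using that by (simp add: t_def)
    then show ?thesis
      unfolding before_def subset_iff dual_curtain(2-4)[OF g i] dual_curtain(2-4)[OF g j]
      using dual_curtain(1)[OF g i] dual_curtain(1)[OF g j] by auto
  qed
  then have "sorted_wrt before ?cs"
    by (simp add: sorted_wrt_iff_nth_less)
  moreover have "is_curtain k'" if k': "k' \<in> set ?cs" for k'
  proof -
    obtain j where "j < n" "k' = (I, c, t j)" using k' by auto
    then show ?thesis using dual_curtain(1)[OF g order_trans[OF tI sub]] by simp
  qed
  ultimately have "chain ?cs" by (intro sorted_wrt_before_chain)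
  moreover have "\<forall>k'\<in>set ?cs. mid k' \<inter> mid h \<noteq> {} \<and> mid k' \<inter> mid k \<noteq> {}"
    using meet tI by auto
  ultimately have "length ?cs \<le> L" using sep unfolding L_separated_def by blast
  then show ?thesis by simp
qed

text \<open>Convexity: \<open>c t\<close> divides the way from the foot to \<open>c l\<close>, and
  the foot is strictly nearer to \<open>x\<close> than \<open>c l\<close>.\<close>

lemma dist_less_beyond_foot:
  assumes g: "geodesic_on I c" "closed I" and l: "l \<in> I" and t: "foot I c x \<le> t" "t < l"
  shows "dist x (c t) < dist x (c l)"
proof -
  let ?a = "foot I c x"
  have a: "?a \<in> I" using foot_in[OF g] l by blast
  define r where "r = (t - ?a) / (l - ?a)"
  have r: "0 \<le> r" "r < 1" using t by (auto simp: r_def)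
  have "r * (l - ?a) = t - ?a" using t by (simp add: r_def)
  then have eq: "(1 - r) * ?a + r * l = t" by (simp add: algebra_simps)
  have "(dist x (c ?a))\<^sup>2 + (l - ?a)\<^sup>2 \<le> (dist x (c l))\<^sup>2" by (rule foot_pythagoras[OF g l])
  moreover have "0 < (l - ?a)\<^sup>2" using t by (intro zero_less_power) simp
  ultimately have "(dist x (c ?a))\<^sup>2 < (dist x (c l))\<^sup>2" by linarith
  then have less: "(1 - r) * (dist x (c ?a))\<^sup>2 < (1 - r) * (dist x (c l))\<^sup>2" using r by simp
  have "(dist x (c t))\<^sup>2 \<le> (1 - r) * (dist x (c ?a))\<^sup>2 + r * (dist x (c l))\<^sup>2 - r * (1 - r) * (?a - l)\<^sup>2"
    using CN[OF g(1) a l, of r x] r unfolding eq by simp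
  moreover have "0 \<le> r * (1 - r) * (?a - l)\<^sup>2" using r by simp
  ultimately have "(dist x (c t))\<^sup>2 < (dist x (c l))\<^sup>2" using less by (simp add: algebra_simps)
  then show ?thesis using power_less_imp_less_base by fastforce
qed

text \<open>A geodesic through the endpoint \<open>c l\<close> cannot make an acute angle with \<open>c\<close> on both sides.\<close>

lemma foot_end:
  assumes g: "geodesic_on {0..l} c" "0 \<le> l"
    and uv: "dist u v = dist u (c l) + dist (c l) v"
  shows "foot {0..l} c u = l \<or> foot {0..l} c v = l"
proof (rule ccontr)
  assume n: "\<not> ?thesis"
  have cl: "closed {0..l}" "l \<in> {0..l}" using g by auto
  have f: "foot {0..l} c x \<in> {0..l}" for x using foot_in[OF g(1) cl(1)] g(2) by auto
  \<comment> \<open>From the later of the two feet onwards the distances to both \<open>u\<close>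
    and \<open>v\<close> increase strictly, so \<open>c t\<close> would give a shortcut from
    \<open>u\<close> to \<open>v\<close>.\<close>
  define t where "t = max (foot {0..l} c u) (foot {0..l} c v)"
  have t: "t < l" using n f[of u] f[of v] by (auto simp: t_def)
  have "dist u (c t) < dist u (c l)" "dist v (c t) < dist v (c l)"
    using dist_less_beyond_foot[OF g(1) cl _ t] by (auto simp: t_def)
  then show False using uv dist_triangle[of u v "c t"] by (simp add: dist_commute)
qed

text \<open>Let \<open>e\<close> be the perpendicular from its foot on \<open>g\<close> to
  \<open>p\<close>. All of \<open>g\<close> projects to the start of \<open>e\<close>, while
  \<open>p\<close> and one of \<open>u\<close>, \<open>v\<close> project to its end. If
  \<open>e\<close> is too long, \<open>L + 1\<close> curtains dual to it meet \<open>h2\<close> and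
  the curtain of that \<open>u\<close> or \<open>v\<close>.\<close>

lemma bottleneck:
  assumes h: "is_curtain h1" "is_curtain h2" "is_curtain h3" "L_separated L h1 h2" "L_separated L h3 h2"
    and g: "geodesic_on I g" "closed I"
    and gh: "g ` I \<inter> mid h1 \<noteq> {}" "g ` I \<inter> mid h2 \<noteq> {}" "g ` I \<inter> mid h3 \<noteq> {}"
    and uv: "u \<in> mid h1" "p \<in> mid h2" "v \<in> mid h3" "dist u v = dist u p + dist p v"
  shows "dist p (g (foot I g p)) \<le> 2 * real L + 3"
proof (rule ccontr)
  assume n: "\<not> ?thesis"
  have ne: "I \<noteq> {}" using gh by blast
  define z where "z = g (foot I g p)"
  define l where "l = dist p z"
  have l: "l > 2 * real L + 3" using n by (simp add: l_def z_def)
  \<comment> \<open>Directed towards \<open>p\<close>, so that \<open>p\<close> is the endpoint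
    required by \<open>foot_end\<close>.\<close>
  define e where "e s = geod p z (l - s)" for s
  have e: "geodesic_segment z p e"
    using geodesic_segment_reverse[OF geodesic_segment_geod[of p z]] by (simp add: e_def[abs_def] l_def)
  have el: "geodesic_on {0..l} e" "e 0 = z" "e l = p"
    using e by (auto simp: geodesic_segment_def l_def dist_commute)
  have cl: "closed {0..l}" "{0..l} \<noteq> {}" "l \<in> {0..l}" using l by auto
  have f0: "foot {0..l} e w = 0" if w: "w \<in> g ` I" for w
  proof (rule foot_eqI[OF el(1) cl(1)])
    show "0 \<in> {0..l}" using l by simp
    obtain t where t: "t \<in> I" "w = g t" using w by blast
    fix s assume s: "s \<in> {0..l}"
    \<comment> \<open>Points of the perpendicular have the same foot on \<open>g\<close> as
      \<open>p\<close>, so by Pythagoras they are at least as far from \<open>w\<close> as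
      \<open>z\<close> is.\<close>
    have fs: "foot I g (e s) = foot I g p"
      unfolding e_def using s
      by (intro foot_on_segment[OF g ne]) (auto simp: l_def z_def geodesic_segment_geod[of p "g (foot I g p)"])
    have "(dist w z)\<^sup>2 = (t - foot I g p)\<^sup>2"
      using geodesic_on_dist[OF g(1) t(1) foot_in[OF g ne]] by (simp add: z_def t)
    also have "\<dots> \<le> (dist (e s) w)\<^sup>2"
      using foot_pythagoras[OF g t(1), of "e s"] zero_le_power2[of "dist (e s) (g (foot I g (e s)))"]
      unfolding fs t(2) by linarith
    finally show "dist w (e 0) \<le> dist w (e s)"
      unfolding el(2) dist_commute[of w "e s"] by (rule power2_le_imp_le) simp
  qed
  have fp: "foot {0..l} e p = l"
    using foot_geodesic[OF el(1) cl(1,3)] el(3) by simp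
  \<comment> \<open>The range from 1 to \<open>2 * L + 3\<close> lies strictly inside
    \<open>{0..l}\<close>, so the feet 0 and \<open>l\<close> fall on opposite sides of each dual
    curtain.\<close>
  have meets: "mid ({0..l}, e, t) \<inter> mid k \<noteq> {}"
    if t: "{t - 1/2..t + 1/2} \<subseteq> {1..1 + 2 * real (Suc L)}"
      and k: "is_curtain k" "g ` I \<inter> mid k \<noteq> {}" and x: "x \<in> mid k" "foot {0..l} e x = l" for t k x
  proof -
    have t': "1 \<le> t - 1/2" "t + 1/2 \<le> 2 * real L + 3" using t[unfolded atLeastatMost_subset_iff] by auto
    then have "{t - 1/2..t + 1/2} \<subseteq> {0..l}" using l by auto
    note d = dual_curtain[OF el(1) cl(1) this]
    obtain w where "w \<in> g ` I" "w \<in> mid k" using k(2) by blast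
    then have "w \<in> neg ({0..l}, e, t)" "w \<in> mid k" using f0 t' by (auto simp: d(3))
    moreover have "x \<in> pos ({0..l}, e, t)" using x t' l by (simp add: d(4))
    ultimately show ?thesis
      using connected_crosses[OF d(1) connected_mid[OF k(1)]] x by blast
  qed
  have "foot {0..l} e u = l \<or> foot {0..l} e v = l"
    using foot_end[OF el(1), of u v] l uv(4) by (simp add: el(3))
  then obtain h x where hx: "is_curtain h" "L_separated L h h2" "g ` I \<inter> mid h \<noteq> {}" "x \<in> mid h"
    "foot {0..l} e x = l"
    using h gh uv by blast
  have "Suc L \<le> L"
  proof (rule dual_chain_length[OF el(1) cl(1) _ hx(2)])
    show "{1..1 + 2 * real (Suc L)} \<subseteq> {0..l}" using l by auto
  qed (use meets[OF _ hx(1,3,4,5)] meets[OF _ h(2) gh(2) uv(2) fp] in auto)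
  then show False by simp
qed

lemma geodesic_crosses:
  fixes c :: "real \<Rightarrow> 'a"
  assumes g: "geodesic_on {a..b} c" "a \<le> b" and h: "is_curtain h" "c a \<in> neg h" "c b \<in> pos h"
  obtains s where "s \<in> {a..b}" "c s \<in> mid h"
proof -
  have "connected (c ` {a..b})"
    using geodesic_on_continuous[OF g(1)] by (intro connected_continuous_image) auto
  then have "c ` {a..b} \<inter> mid h \<noteq> {}"
    using connected_crosses[OF h(1) _ _ h(2) _ h(3)] g(2) by auto
  then show thesis using that by blast
qed

text \<open>Close to time \<open>T\<close> the geodesic stays beyond \<open>h2\<close>, because
  \<open>hs\<close> is too long to be crossed so quickly. A return to \<open>h1\<close> would yield
  points of \<open>h1\<close> before and after this stretch, and \<open>L + 1\<close> dual curtains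
  in it would meet both \<open>h1\<close> and \<open>h2\<close>.\<close>

lemma no_return:
  assumes h: "before h1 h2" "L_separated L h1 h2"
    and hs: "ochain L hs" "\<And>h. h \<in> set hs \<Longrightarrow> before h2 h" "4 * L + 9 \<le> length hs"
    and g: "geodesic_on {0..l} c" and T: "0 \<le> T" "T \<le> t" "t \<le> l"
    and c0: "c 0 \<in> neg h1" and cT: "\<And>h. h \<in> set hs \<Longrightarrow> c T \<in> pos h"
  shows "c t \<in> pos h1"
proof (rule ccontr)
  assume n: "c t \<notin> pos h1"
  have cur: "is_curtain h1" "is_curtain h2" using h by (auto simp: before_def)
  \<comment> \<open>Otherwise \<open>hs\<close> separates \<open>c s\<close> from
    \<open>c T\<close>, and its length is at most \<open>2 * (2 * L + 3) + 1 = 4 * L + 7\<close>,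
    less than \<open>4 * L + 9\<close>.\<close>
  have near: "c s \<in> pos h2" if s: "s \<in> {0..l}" "\<bar>s - T\<bar> \<le> 2 * real L + 3" for s
  proof (rule ccontr)
    assume "c s \<notin> pos h2"
    then have "c s \<in> neg h2 \<union> mid h2" using curtain_cases[OF cur(2)] by blast
    then have "sepchain L hs {c s} {c T}"
      using hs(1,2) cT before_neg unfolding sepchain_def by blast
    then have "real (length hs) \<le> 2 * dist (c s) (c T) + 1" by (rule length_le)
    moreover have "dist (c s) (c T) = \<bar>s - T\<bar>" using geodesic_on_dist[OF g] s T by simp
    ultimately show False using s(2) hs(3) by linarith
  qed
  have far: "\<bar>s - T\<bar> > 2 * real L + 3" if "s \<in> {0..l}" "c s \<notin> pos h1" for s
    using near[OF that(1)] that(2) before_pos[OF h(1)] by (meson UnCI not_le subsetD)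
  have cT1: "c T \<in> pos h1" using far[of T] T by fastforce
  obtain a where a: "a \<in> {0..T}" "c a \<in> mid h1"
    using geodesic_crosses[OF _ T(1) cur(1) c0 cT1] geodesic_on_subset[OF g] T
    by (metis atLeastatMost_subset_iff is_interval_cc order_refl order_trans)
  obtain b where b: "b \<in> {T..t}" "c b \<in> mid h1"
  proof (cases "c t \<in> mid h1")
    case True
    with T show thesis by (intro that[of t]) auto
  next
    case False
    then have ct: "c t \<in> neg h1" using n curtain_cases[OF cur(1)] by blast
    have "connected (c ` {T..t})"
      using geodesic_on_continuous[OF g] T
      by (intro connected_continuous_image) (auto intro: continuous_on_subset)
    then have "c ` {T..t} \<inter> mid h1 \<noteq> {}"
      using connected_crosses[OF cur(1) _ _ ct _ cT1] T by auto
    then show thesis using that by blast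
  qed
  have b': "b > T + 2 * real L + 3"
    using far[of b] b T mid_not_pos[OF cur(1)] by auto
  have cl: "closed {0..l}" by simp
  \<comment> \<open>The dual curtains lie between \<open>a\<close> and \<open>b\<close>, so they
    separate two points of the connected set \<open>mid h1\<close>; their centres \<open>c s\<close>
    are beyond \<open>h2\<close>.\<close>
  have "Suc L \<le> L"
  proof (rule dual_chain_length[OF g cl _ h(2)])
    show "{T..T + 2 * real (Suc L)} \<subseteq> {0..l}" using T b b' by auto
    fix s assume s: "{s - 1/2..s + 1/2} \<subseteq> {T..T + 2 * real (Suc L)}"
    then have s': "T \<le> s - 1/2" "s + 1/2 \<le> T + 2 * real L + 2" using s[unfolded atLeastatMost_subset_iff] by auto
    then have "{s - 1/2..s + 1/2} \<subseteq> {0..l}" using T b b' by auto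
    note d = dual_curtain[OF g cl this]
    have "c b \<in> pos ({0..l}, c, s)"
      using foot_geodesic[OF g cl, of b] b b' s' T by (simp add: d(4))
    moreover have "a < s - 1/2"
    proof -
      have "\<bar>a - T\<bar> > 2 * real L + 3"
        using far[of a] a T mid_not_pos[OF cur(1)] by auto
      then show ?thesis using a s' by auto
    qed
    then have "c a \<in> neg ({0..l}, c, s)"
      using foot_geodesic[OF g cl, of a] a T by (simp add: d(3))
    ultimately have 1: "mid ({0..l}, c, s) \<inter> mid h1 \<noteq> {}"
      using connected_crosses[OF d(1) connected_mid[OF cur(1)] a(2) _ b(2)] by blast
    have "c s \<in> mid ({0..l}, c, s)"
      using foot_geodesic[OF g cl, of s] s' T b b' by (simp add: d(2))
    moreover have "c s \<in> pos h2" using near[of s] s' T b b' by auto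
    ultimately have "mid ({0..l}, c, s) \<inter> mid h2 \<noteq> {}"
      using connected_between[OF h(1) connected_mid[OF d(1)] 1] by blast
    with 1 show "mid ({0..l}, c, s) \<inter> mid h1 \<noteq> {} \<and> mid ({0..l}, c, s) \<inter> mid h2 \<noteq> {}" ..
  qed
  then show False by simp
qed

text \<open>The \<open>4 * L + 11\<close> extra curtains are \<open>h2\<close> and the
  \<open>4 * L + 9\<close> curtains for \<open>no_return\<close>, followed by one last curtain
  \<open>b\<close>. Its thickness ensures that \<open>c T\<close>, within 1 of \<open>z\<close>, has
  passed every curtain before \<open>b\<close>.\<close>

lemma sepchain_return:
  assumes s: "sepchain L (hs @ ks) {q} {z}" and ks: "length ks = 4 * L + 11"
    and c: "geodesic_segment q y c" and T: "T \<in> {0..dist q y}" "dist (c T) z \<le> 1"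
  shows "sepchain L hs {q} {y}"
proof -
  obtain h2 ks1 where 1: "ks = h2 # ks1" "length ks1 = 4 * L + 10" using ks by (cases ks) auto
  then obtain ks' b where 2: "ks1 = ks' @ [b]" "length ks' = 4 * L + 9"
    by (cases ks1 rule: rev_cases) auto
  have all: "ochain L (hs @ h2 # ks' @ [b])" and qz: "\<And>h. h \<in> set (hs @ h2 # ks' @ [b]) \<Longrightarrow> q \<in> neg h \<and> z \<in> pos h"
    using s unfolding 1 2 sepchain_def by auto
  have cT: "c T \<in> pos h" if h: "before h b" for h
  proof (rule ccontr)
    assume "c T \<notin> pos h"
    then have "c T \<in> neg b" using h curtain_cases[of h "c T"] before_neg[OF h] by (auto simp: before_def)
    moreover have "z \<in> pos b" "is_curtain b" using qz h by (auto simp: before_def)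
    ultimately show False using dist_neg_pos[of b "c T" z] T(2) by simp
  qed
  have g: "geodesic_on {0..dist q y} c" "c 0 = q" "c (dist q y) = y"
    using c by (auto simp: geodesic_segment_def)
  have "y \<in> pos h" if h: "h \<in> set hs" for h
  proof -
    have "c (dist q y) \<in> pos h"
    proof (rule no_return[where hs = ks'])
      show "before h h2" "L_separated L h h2" using all h by (auto simp: ochain_append ochain_Cons)
      show "ochain L ks'" "\<And>k. k \<in> set ks' \<Longrightarrow> before h2 k"
        using all by (auto simp: ochain_append ochain_Cons)
      show "c 0 \<in> neg h" using qz h g by simp
      show "c T \<in> pos k" if "k \<in> set ks'" for k
        using cT all that by (auto simp: ochain_append ochain_Cons)
    qed (use g T 2 in auto)
    then show ?thesis using g by simp
  qed
  then show ?thesis using all qz by (auto simp: sepchain_def ochain_append)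
qed

lemma csep_mono: "csep L n q x y \<Longrightarrow> m \<le> n \<Longrightarrow> csep L m q x y"
  unfolding csep_def using order_trans by blast

text \<open>A chain from \<open>q\<close> to \<open>z\<close>, shortened at its end, separates
  \<open>q\<close> from any two points whose geodesics from \<open>q\<close> pass within 1 of
  \<open>z\<close>. The same initial part serves both points.\<close>

lemma csep_return:
  assumes s: "csep L (n + 4 * L + 11) q z z"
    and c: "geodesic_segment q y c" "T \<in> {0..dist q y}" "dist (c T) z \<le> 1"
    and c': "geodesic_segment q y' c'" "T' \<in> {0..dist q y'}" "dist (c' T') z \<le> 1"
  shows "csep L n q y y'"
proof -
  obtain fs where fs: "sepchain L fs {q} {z}" "n + 4 * L + 11 \<le> length fs"
    using s by (auto simp: csep_def)
  define hs ks where "hs = take (length fs - (4 * L + 11)) fs" and "ks = drop (length fs - (4 * L + 11)) fs"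
  have hk: "sepchain L (hs @ ks) {q} {z}" "length ks = 4 * L + 11" "n \<le> length hs"
    using fs by (simp_all add: hs_def ks_def)
  have "sepchain L hs {q} {y}" "sepchain L hs {q} {y'}"
    using sepchain_return[OF hk(1,2)] c c' by blast+
  then have "sepchain L hs {q} {y, y'}" by (simp add: sepchain_def)
  with hk(3) show ?thesis unfolding csep_def by blast
qed

text \<open>The last three curtains feed \<open>bottleneck\<close> at a point of the middle one; the
  \<open>n\<close> curtains before them separate \<open>q\<close> from this point.\<close>

lemma csep_geodesics_close:
  assumes "csep L (n + 3) q x y"
  obtains s t where "s \<in> {0..dist q y}" "t \<in> {0..dist q x}"
    "dist (geod q y s) (geod q x t) \<le> 2 * real L + 3" "csep L n q (geod q y s) (geod q y s)"
proof -
  obtain fs where fs: "sepchain L fs {q} {x, y}" "n + 3 \<le> length fs"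
    using assms by (auto simp: csep_def)
  obtain fs1 h3 where 1: "fs = fs1 @ [h3]" using fs(2) by (cases fs rule: rev_cases) auto
  then obtain fs2 h2 where 2: "fs1 = fs2 @ [h2]" using fs(2) by (cases fs1 rule: rev_cases) auto
  then obtain A h1 where 3: "fs2 = A @ [h1]" using fs(2) 1 by (cases fs2 rule: rev_cases) auto
  have o: "ochain L (A @ [h1, h2, h3])" and side: "\<And>h. h \<in> set (A @ [h1, h2, h3]) \<Longrightarrow> q \<in> neg h \<and> x \<in> pos h \<and> y \<in> pos h"
    and len: "n \<le> length A"
    using fs unfolding 1 2 3 by (auto simp: sepchain_def)
  have cur: "is_curtain h1" "is_curtain h2" "is_curtain h3" and b: "before h1 h2" "before h2 h3"
    and sep: "L_separated L h1 h2" "L_separated L h2 h3"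
    using o by (auto simp: ochain_append ochain_Cons)
  let ?g = "geod q x" and ?c = "geod q y"
  note g = geod_props[of q x] and c = geod_props[of q y]
  have gm: "?g ` {0..dist q x} \<inter> mid h \<noteq> {}" if "h \<in> {h1, h2, h3}" for h
  proof -
    have "is_curtain h" "?g 0 \<in> neg h" "?g (dist q x) \<in> pos h" using cur side[of h] g that by auto
    then obtain s where "s \<in> {0..dist q x}" "?g s \<in> mid h"
      using geodesic_crosses[of 0 "dist q x" ?g h] g(4) by auto
    then show ?thesis by blast
  qed
  obtain s where s: "s \<in> {0..dist q y}" "?c s \<in> mid h2"
    using geodesic_crosses[OF c(4) _ cur(2)] c side[of h2] by auto
  have gs: "geodesic_on {0..s} ?c" "geodesic_on {s..dist q y} ?c"
    using geodesic_on_subset[OF c(4)] s by auto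
  have cs: "?c s \<in> pos h1" "?c s \<in> neg h3" using s(2) b by (auto simp: before_def)
  obtain r1 where r1: "r1 \<in> {0..s}" "?c r1 \<in> mid h1"
    using geodesic_crosses[OF gs(1) _ cur(1) _ cs(1)] s c side[of h1] by auto
  obtain r3 where r3: "r3 \<in> {s..dist q y}" "?c r3 \<in> mid h3"
    using geodesic_crosses[OF gs(2) _ cur(3) cs(2)] s c side[of h3] by auto
  note r = r1 r3
  define t where "t = foot {0..dist q x} ?g (?c s)"
  have "t \<in> {0..dist q x}" unfolding t_def using foot_in[OF g(4)] by simp
  moreover have "dist (?c s) (?g t) \<le> 2 * real L + 3"
    unfolding t_def
  proof (rule bottleneck[OF cur sep(1) _ g(4) _ _ _ _ r(2) s(2) r(4)])
    show "L_separated L h3 h2" using sep(2) L_separated_commute by blast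
    show "dist (?c r1) (?c r3) = dist (?c r1) (?c s) + dist (?c s) (?c r3)"
      using geodesic_on_dist[OF c(4)] r s by auto
  qed (use gm in auto)
  moreover have "?c s \<in> pos h" if h: "h \<in> set A" for h
  proof -
    have "before h h2" using h o by (auto simp: ochain_append)
    then show ?thesis using s(2) by (auto simp: before_def)
  qed
  then have "sepchain L A {q} {?c s, ?c s}"
    using o side by (auto simp: sepchain_def ochain_append)
  then have "csep L n q (?c s) (?c s)" using len unfolding csep_def by blast
  ultimately show thesis using that s(1) by blast
qed

section \<open>Fellow travelling of geodesics\<close>

lemma csep_imp_dist:
  assumes "csep L n q x y"
  shows "real n \<le> 2 * dist q x + 1" "real n \<le> 2 * dist q y + 1"
proof -
  obtain hs where hs: "sepchain L hs {q} {x, y}" "n \<le> length hs" using assms csep_def by blast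
  then have "sepchain L hs {q} {x}" "sepchain L hs {q} {y}" by (auto simp: sepchain_def)
  then show "real n \<le> 2 * dist q x + 1" "real n \<le> 2 * dist q y + 1"
    using hs(2) length_le by fastforce+
qed

lemma dist_geod_le:
  assumes m: "m \<in> {0..dist q x}" "m \<in> {0..dist q y}" "m > 0" and r: "r \<in> {0..m}"
  shows "dist (geod q x r) (geod q y r) \<le> r / m * dist (geod q x m) (geod q y m)"
proof -
  note gx = geod_props[of q x] and gy = geod_props[of q y]
  have "geodesic_segment (geod q x 0) (geod q x m) (\<lambda>r. geod q x (0 + r))"
    "geodesic_segment (geod q y 0) (geod q y m) (\<lambda>r. geod q y (0 + r))"
    using geodesic_on_segment[OF gx(4), of 0 m] geodesic_on_segment[OF gy(4), of 0 m] m by auto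
  then have s: "geodesic_segment q (geod q x m) (geod q x)" "geodesic_segment q (geod q y m) (geod q y)"
    using gx gy by simp_all
  have d: "dist q (geod q x m) = m" "dist q (geod q y m) = m"
    using geodesic_on_dist[OF gx(4), of 0 m] geodesic_on_dist[OF gy(4), of 0 m] gx gy m by auto
  show ?thesis
    using dist_segments_common_start[OF s, of "r / m"] r m unfolding d by simp
qed

text \<open>The geodesics are close at some time beyond \<open>m\<close>; convexity carries the
  bound back to \<open>r\<close> with the factor \<open>r / m\<close>.\<close>

lemma csep_fellow_travel:
  assumes cs: "csep L (2 * m + 4 * L + 10) q x y" and m: "0 < m" and r: "0 \<le> r" "r \<le> real m"
  shows "dist (geod q x r) (geod q y r) \<le> r / real m * (4 * real L + 6)"
    and "real m \<le> dist q x" "real m \<le> dist q y"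
proof -
  have "csep L ((2 * m + 4 * L + 7) + 3) q x y" by (rule csep_mono[OF cs]) simp
  then obtain s t where st: "s \<in> {0..dist q y}" "t \<in> {0..dist q x}"
    "dist (geod q y s) (geod q x t) \<le> 2 * real L + 3"
    "csep L (2 * m + 4 * L + 7) q (geod q y s) (geod q y s)"
    by (rule csep_geodesics_close)
  note gx = geod_props[of q x] and gy = geod_props[of q y]
  have d: "dist q (geod q x t) = t" "dist q (geod q y s) = s"
    using geodesic_on_dist[OF gx(4), of 0 t] geodesic_on_dist[OF gy(4), of 0 s] gx gy st by auto
  \<comment> \<open>A chain of length \<open>2 * m + 4 * L + 7\<close> forces this distance; the
    surplus \<open>2 * L + 3\<close> covers the difference of \<open>s\<close> and
    \<open>t\<close>.\<close>
  have s: "real m + 2 * real L + 3 \<le> s" using csep_imp_dist[OF st(4)] d by simp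
  have ts: "\<bar>t - s\<bar> \<le> 2 * real L + 3"
    using st(3) d dist_triangle[of q "geod q x t" "geod q y s"] dist_triangle[of q "geod q y s" "geod q x t"]
    by (simp add: dist_commute abs_le_iff)
  \<comment> \<open>A common time for both geodesics, at the price of moving by
    \<open>\<bar>t - s\<bar>\<close> along one of them.\<close>
  define k where "k = min s t"
  have k: "real m \<le> k" using s ts by (auto simp: k_def)
  have kx: "k \<in> {0..dist q x}" "k \<in> {0..dist q y}" using st k by (auto simp: k_def)
  have "dist (geod q x k) (geod q x t) = t - k" "dist (geod q y s) (geod q y k) = s - k"
    using geodesic_on_dist[OF gx(4) kx(1) st(2)] geodesic_on_dist[OF gy(4) st(1) kx(2)] by (auto simp: k_def)
  then have "dist (geod q x k) (geod q y k) \<le> (t - k) + (2 * real L + 3) + (s - k)"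
    using st(3) dist_triangle[of "geod q x k" "geod q y k" "geod q x t"]
      dist_triangle[of "geod q x t" "geod q y k" "geod q y s"] by (simp add: dist_commute)
  then have dk: "dist (geod q x k) (geod q y k) \<le> 4 * real L + 6"
    using ts by (auto simp: k_def min_def split: if_splits)
  have "dist (geod q x r) (geod q y r) \<le> r / k * dist (geod q x k) (geod q y k)"
    using kx k m r by (intro dist_geod_le) auto
  also have "\<dots> \<le> r / real m * (4 * real L + 6)"
    using dk k m r by (intro mult_mono divide_left_mono) auto
  finally show "dist (geod q x r) (geod q y r) \<le> r / real m * (4 * real L + 6)" .
  show "real m \<le> dist q x" "real m \<le> dist q y" using kx k by auto
qed

section \<open>Isometries\<close>

lemma inv_isometry_group:
  assumes "g \<in> isometry_group"
  shows "inv g \<in> isometry_group"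
proof -
  have "dist (inv g x) (inv g y) = dist x y" for x y
  proof -
    have "dist (inv g x) (inv g y) = dist (g (inv g x)) (g (inv g y))"
      using assms by (simp add: isometry_group_def)
    also have "\<dots> = dist x y"
      using assms by (simp add: isometry_group_def bij_is_surj surj_f_inv_f)
    finally show ?thesis .
  qed
  then show ?thesis using assms by (simp add: isometry_group_def bij_imp_bij_inv)
qed

definition move :: "('a \<Rightarrow> 'a) \<Rightarrow> 'a curtain \<Rightarrow> 'a curtain" where
  "move g = (\<lambda>(I, c, t). (I, g \<circ> c, t))"

text \<open>The foot of \<open>g x\<close> on the moved geodesic has the same parameter as the foot
  of \<open>x\<close> on the original one.\<close>

lemma move_parts:
  assumes g: "g \<in> isometry_group" and h: "is_curtain h"
  shows "is_curtain (move g h)" "mid (move g h) = g ` mid h" "neg (move g h) = g ` neg h" "pos (move g h) = g ` pos h"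
proof -
  obtain I c t where I: "h = (I, c, t)" by (cases h)
  have b: "bij g" and d: "\<And>x y. dist (g x) (g y) = dist x y" using g by (auto simp: isometry_group_def)
  have m: "move g h = (I, g \<circ> c, t)" by (simp add: I move_def)
  show c: "is_curtain (move g h)"
    unfolding m using h[unfolded I] by (simp add: is_curtain.simps geodesic_on_def d)
  have f: "foot I (g \<circ> c) (g x) = foot I c x" for x by (simp add: foot_def d)
  have v: "foot I (g \<circ> c) -` J = g ` (foot I c -` J)" for J
  proof (rule set_eqI)
    fix y
    obtain x where "y = g x" using b by (metis bij_pointE)
    then show "y \<in> foot I (g \<circ> c) -` J \<longleftrightarrow> y \<in> g ` (foot I c -` J)"
      using f b by (auto simp: inj_image_mem_iff bij_is_inj)
  qed
  show "mid (move g h) = g ` mid h" "neg (move g h) = g ` neg h" "pos (move g h) = g ` pos h"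
    using curtain_parts_foot[OF h[unfolded I]] curtain_parts_foot[OF c[unfolded m]] v
    unfolding m by (simp_all add: I)
qed

lemma chain_move:
  assumes g: "g \<in> isometry_group" and cs: "chain cs"
  shows "chain (map (move g) cs)"
proof -
  have "inj g" using g by (simp add: isometry_group_def bij_is_inj)
  then show ?thesis
    using cs move_parts[OF g]
    by (simp add: chain_def separates_def disjnt_def inj_image_subset_iff image_Int[symmetric])
qed

text \<open>A chain meeting both moved curtains is pulled back by \<open>inv g\<close>.\<close>

lemma L_separated_move:
  assumes g: "g \<in> isometry_group" and h: "is_curtain h" "is_curtain k" and s: "L_separated L h k"
  shows "L_separated L (move g h) (move g k)"
  unfolding L_separated_def
proof (intro allI impI)
  fix cs assume cs: "chain cs \<and> (\<forall>c\<in>set cs. mid c \<inter> mid (move g h) \<noteq> {} \<and> mid c \<inter> mid (move g k) \<noteq> {})"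
  note g' = inv_isometry_group[OF g]
  have b: "bij g" using g by (simp add: isometry_group_def)
  let ?cs = "map (move (inv g)) cs"
  have "chain ?cs" using cs chain_move[OF g'] by blast
  moreover have "inv g ` mid c \<inter> mid l \<noteq> {}" if m: "mid c \<inter> mid (move g l) \<noteq> {}" and l: "is_curtain l" for c l
  proof -
    obtain x where "x \<in> mid l" "g x \<in> mid c" using m move_parts(2)[OF g l] by auto
    then show ?thesis using b by (metis IntI bij_inv_eq_iff empty_iff image_eqI)
  qed
  then have "\<forall>c\<in>set ?cs. mid c \<inter> mid h \<noteq> {} \<and> mid c \<inter> mid k \<noteq> {}"
    using cs h move_parts(2)[OF g'] by (simp add: chain_def)
  ultimately have "length ?cs \<le> L" using s unfolding L_separated_def by blast
  then show "length cs \<le> L" by simp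
qed

lemma csep_move:
  assumes g: "g \<in> isometry_group" and s: "csep L n q x y"
  shows "csep L n (g q) (g x) (g y)"
proof -
  obtain hs where hs: "sepchain L hs {q} {x, y}" "n \<le> length hs" using s by (auto simp: csep_def)
  have b: "before (move g h) (move g k)" if "before h k" for h k
    using that move_parts[OF g] by (auto simp: before_def)
  have o: "ochain L hs" using hs by (simp add: sepchain_def)
  then have "ochain L (map (move g) hs)"
  proof (induction hs)
    case (Cons h hs)
    then show ?case
      using b move_parts(1)[OF g] L_separated_move[OF g] by (auto simp: ochain_Cons before_def)
  qed simp
  moreover have "is_curtain h" if "h \<in> set hs" for h using that o by (simp add: ochain_def)
  ultimately have "sepchain L (map (move g) hs) {g q} {g x, g y}"
    using hs(1) move_parts(3,4)[OF g] by (simp add: sepchain_def)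
  then show ?thesis using hs(2) unfolding csep_def by (intro exI[of _ "map (move g) hs"]) simp
qed

end

section \<open>Rays and the visual boundary\<close>

lemma equiv_asymptotic: "equiv {c. geodesic_ray c} (asymptotic :: ((real \<Rightarrow> 'a::metric_space) \<times> _) set)"
proof (rule equivI)
  show "refl_on {c :: real \<Rightarrow> 'a. geodesic_ray c} asymptotic"
    by (auto simp: refl_on_def asymptotic_def intro!: exI[of _ 0])
  show "sym (asymptotic :: ((real \<Rightarrow> 'a) \<times> _) set)"
    by (auto simp: sym_def asymptotic_def dist_commute)
  show "trans (asymptotic :: ((real \<Rightarrow> 'a) \<times> _) set)"
  proof (rule transI)
    fix a b c :: "real \<Rightarrow> 'a" assume ab: "(a, b) \<in> asymptotic" and bc: "(b, c) \<in> asymptotic"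
    then obtain K K' where "\<forall>t\<ge>0. dist (a t) (b t) \<le> K" "\<forall>t\<ge>0. dist (b t) (c t) \<le> K'"
      by (auto simp: asymptotic_def)
    then have "\<forall>t\<ge>0. dist (a t) (c t) \<le> K + K'"
      by (meson add_mono dist_triangle order_trans)
    with ab bc show "(a, c) \<in> asymptotic" by (auto simp: asymptotic_def)
  qed
  show "(asymptotic :: ((real \<Rightarrow> 'a) \<times> _) set) \<subseteq> {c. geodesic_ray c} \<times> {c. geodesic_ray c}"
    by (auto simp: asymptotic_def)
qed

abbreviation ray_class :: "(real \<Rightarrow> 'a::metric_space) \<Rightarrow> (real \<Rightarrow> 'a) set" where
  "ray_class b \<equiv> asymptotic `` {b}"

lemma ray_class_in: "geodesic_ray b \<Longrightarrow> ray_class b \<in> visual_boundary"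
  unfolding visual_boundary_def by (rule quotientI) simp

lemma ray_in_class: "geodesic_ray b \<Longrightarrow> b \<in> ray_class b"
  using equiv_class_self[OF equiv_asymptotic] by simp

lemma visual_boundary_class:
  assumes "\<eta> \<in> visual_boundary" "b \<in> \<eta>"
  shows "geodesic_ray b" "\<eta> = ray_class b"
proof -
  obtain c where c: "geodesic_ray c" "\<eta> = ray_class c"
    using assms(1) unfolding visual_boundary_def by (auto elim: quotientE)
  then have "(c, b) \<in> asymptotic" using assms(2) by simp
  then show "\<eta> = ray_class b"
    unfolding c(2) by (rule equiv_class_eq[OF equiv_asymptotic])
  show "geodesic_ray b"
    using \<open>(c, b) \<in> asymptotic\<close> by (simp add: asymptotic_def)
qed

lemma asymptotic_cong:
  assumes "geodesic_ray b" "\<And>t. t \<ge> 0 \<Longrightarrow> b' t = b t"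
  shows "(b, b') \<in> asymptotic"
  using assms by (auto simp: asymptotic_def geodesic_ray_def geodesic_on_def intro!: exI[of _ 0])

lemma geodesic_ray_segment:
  assumes "geodesic_ray b" "0 \<le> t"
  shows "geodesic_segment (b 0) (b t) b" "dist (b 0) (b t) = t"
proof -
  have b: "geodesic_on {0..} b" using assms by (simp add: geodesic_ray_def)
  show "geodesic_segment (b 0) (b t) b"
    using geodesic_on_segment[OF b, of 0 t] assms by simp
  show "dist (b 0) (b t) = t" using geodesic_on_dist[OF b, of 0 t] assms by simp
qed

section \<open>Asymptotic rays and segments with a common end\<close>

context cat0
begin

text \<open>By convexity the distance at time \<open>r\<close> is at most \<open>r * K / t\<close>
  for every later \<open>t\<close>.\<close>

lemma asymptotic_rays_eq:
  fixes b c :: "real \<Rightarrow> 'a"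
  assumes bc: "(b, c) \<in> asymptotic" "b 0 = c 0" and r: "0 \<le> r"
  shows "b r = c r"
proof -
  obtain K where K: "\<And>t. t \<ge> 0 \<Longrightarrow> dist (b t) (c t) \<le> K" and ray: "geodesic_ray b" "geodesic_ray c"
    using bc by (auto simp: asymptotic_def)
  have "dist (b r) (c r) \<le> r * K / t" if t: "t > r" for t
  proof -
    have d: "dist (b 0) (b t) = t" "dist (b 0) (c t) = t"
      using geodesic_ray_segment(2)[OF ray(1), of t] geodesic_ray_segment(2)[OF ray(2), of t] t r bc(2) by auto
    have "dist (b (r / t * dist (b 0) (b t))) (c (r / t * dist (b 0) (c t))) \<le> r / t * dist (b t) (c t)"
      using geodesic_ray_segment(1)[OF ray(1), of t] geodesic_ray_segment(1)[OF ray(2), of t] t r bc(2)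
      by (intro dist_segments_common_start) auto
    then have "dist (b r) (c r) \<le> r / t * dist (b t) (c t)" using t r by (simp add: d)
    also have "\<dots> \<le> r / t * K" using K[of t] t r by (intro mult_left_mono) auto
    finally show ?thesis by simp
  qed
  then have "\<forall>\<^sub>F t in at_top. dist (b r) (c r) \<le> r * K / t"
    by (rule eventually_mono[OF eventually_gt_at_top])
  moreover have "((\<lambda>t. r * K / t) \<longlongrightarrow> 0) at_top"
    by (intro real_tendsto_divide_at_top[OF tendsto_const filterlim_ident])
  ultimately have "dist (b r) (c r) \<le> 0"
    using tendsto_lowerbound trivial_limit_at_top_linorder by blast
  then show ?thesis by simp
qed

text \<open>The points dividing both segments in the ratio \<open>k\<close>, seen from
  \<open>y\<close>, are at distance at most \<open>k * dist x x'\<close>. Correcting for the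
  different lengths costs at most the remaining \<open>(1 - k) * dist x x'\<close>.\<close>

lemma dist_segments_common_end:
  fixes x x' y :: 'a
  assumes c: "geodesic_segment x y c" and c': "geodesic_segment x' y c'"
    and r: "0 \<le> r" "r \<le> dist x y" "r \<le> dist x' y"
  shows "dist (c r) (c' r) \<le> dist x x'"
proof (cases "x = y")
  case True
  then show ?thesis using c c' r by (simp add: geodesic_segment_def)
next
  case False
  define l where "l = dist x y"
  define l' where "l' = dist x' y"
  have l: "l > 0" using False by (simp add: l_def)
  define k where "k = (l - r) / l"
  have k: "0 \<le> k" "k \<le> 1" using r l by (auto simp: k_def l_def[symmetric])
  have kl: "k * l = l - r" using l by (simp add: k_def)
  have "dist (c (dist x y - k * dist y x)) (c' (dist x' y - k * dist y x')) \<le> k * dist x x'"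
    using dist_segments_common_start[OF geodesic_segment_reverse[OF c] geodesic_segment_reverse[OF c'] k] .
  then have 1: "dist (c r) (c' (l' - k * l')) \<le> k * dist x x'"
    by (simp add: dist_commute[of y] l_def[symmetric] l'_def[symmetric] kl)
  have g: "geodesic_on {0..l'} c'" using c' by (simp add: geodesic_segment_def l'_def)
  have "0 \<le> l'" by (simp add: l'_def)
  then have "l' - k * l' \<in> {0..l'}" using k by (auto simp: mult_left_le_one_le)
  then have "dist (c' (l' - k * l')) (c' r) = \<bar>l' - k * l' - r\<bar>"
    using geodesic_on_dist[OF g] r by (simp add: l'_def)
  also have "l' - k * l' - r = (1 - k) * (l' - l)" using kl by (simp add: algebra_simps)
  also have "\<bar>\<dots>\<bar> = (1 - k) * \<bar>l' - l\<bar>" using k by (simp add: abs_mult)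
  also have "\<dots> \<le> (1 - k) * dist x x'"
    using k abs_dist_diff_le[of x' y x]
    by (intro mult_left_mono) (auto simp: l_def l'_def dist_commute)
  finally have "dist (c r) (c' r) \<le> k * dist x x' + (1 - k) * dist x x'"
    using 1 dist_triangle[of "c r" "c' r" "c' (l' - k * l')"] by linarith
  then show ?thesis by (simp add: algebra_simps)
qed

section \<open>Sequences converging at infinity in the curtain metric\<close>

text \<open>Translates all convergence statements to \<open>csep\<close>, and at the same time
  passes from the base point \<open>p\<close> of the Gromov boundary to any
  \<open>q\<close>.\<close>

lemma filterlim_gromov_product_iff:
  "filterlim (\<lambda>z. gromov_product (d_L L) p (f z) (g z)) at_top F \<longleftrightarrow>
    (\<forall>n. \<forall>\<^sub>F z in F. csep L n q (f z) (g z))"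
proof
  assume lim: "filterlim (\<lambda>z. gromov_product (d_L L) p (f z) (g z)) at_top F"
  show "\<forall>n. \<forall>\<^sub>F z in F. csep L n q (f z) (g z)"
  proof
    fix n
    have "\<forall>\<^sub>F z in F. real (n + nat \<lceil>2 * dist p q\<rceil> + 2) + real L + 3 \<le> gromov_product (d_L L) p (f z) (g z)"
      using lim by (auto simp: filterlim_at_top)
    then show "\<forall>\<^sub>F z in F. csep L n q (f z) (g z)"
      by (rule eventually_mono) (blast intro: csep_change_basepoint gromov_product_imp_csep)
  qed
next
  assume ev: "\<forall>n. \<forall>\<^sub>F z in F. csep L n q (f z) (g z)"
  show "filterlim (\<lambda>z. gromov_product (d_L L) p (f z) (g z)) at_top F"
    unfolding filterlim_at_top
  proof
    fix Z :: real
    define n where "n = nat \<lceil>Z + real L + 3\<rceil>"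
    have n: "Z \<le> real n - real L - 3" unfolding n_def by linarith
    have "\<forall>\<^sub>F z in F. csep L (n + nat \<lceil>2 * dist q p\<rceil> + 2) q (f z) (g z)" using ev by blast
    then show "\<forall>\<^sub>F z in F. Z \<le> gromov_product (d_L L) p (f z) (g z)"
      by (rule eventually_mono)
        (use n csep_change_basepoint csep_imp_gromov_product order_trans in blast)
  qed
qed

lemma converges_iff:
  "converges_at_infinity (d_L L) p s \<longleftrightarrow> (\<forall>n. \<exists>N. \<forall>i\<ge>N. \<forall>j\<ge>N. csep L n q (s i) (s j))"
  unfolding converges_at_infinity_def case_prod_unfold
    filterlim_gromov_product_iff[where q = q] eventually_prod_sequentially
  by (simp, meson)

lemma gromov_equiv_iff:
  "(s, t) \<in> gromov_equiv (d_L L) p \<longleftrightarrow> converges_at_infinity (d_L L) p s \<and> converges_at_infinity (d_L L) p t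
    \<and> (\<forall>n. \<forall>\<^sub>F i in sequentially. csep L n q (s i) (t i))"
  unfolding gromov_equiv_def by (simp add: filterlim_gromov_product_iff[where q = q])

text \<open>Cone convergence in terms of \<open>geod\<close>. The last clause guarantees that
  \<open>geod q (s n) r\<close> is eventually a point of the segment, as \<open>geod\<close> is
  arbitrary beyond its end.\<close>

definition tends_to :: "'a \<Rightarrow> (nat \<Rightarrow> 'a) \<Rightarrow> (real \<Rightarrow> 'a) \<Rightarrow> bool" where
  "tends_to q s b \<longleftrightarrow> geodesic_ray b \<and> b 0 = q \<and>
     (\<forall>r\<ge>0. (\<lambda>n. geod q (s n) r) \<longlonglongrightarrow> b r) \<and> (\<forall>r. \<forall>\<^sub>F n in sequentially. r < dist q (s n))"

lemma tends_to_cong: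
  assumes "tends_to q s b" "\<And>r. 0 \<le> r \<Longrightarrow> b' r = b r"
  shows "tends_to q s b'"
  using assms asymptotic_cong[of b b'] by (auto simp: tends_to_def asymptotic_def)

lemma tends_to_unique:
  assumes "tends_to q s b" "tends_to q s b'" "0 \<le> r"
  shows "b' r = b r"
  using assms by (auto simp: tends_to_def intro: LIMSEQ_unique)

lemma converges_dist:
  fixes s :: "nat \<Rightarrow> 'a"
  assumes "converges_at_infinity (d_L L) p s"
  shows "\<forall>\<^sub>F n in sequentially. r < dist q (s n)"
proof -
  obtain N where N: "\<And>i. i \<ge> N \<Longrightarrow> csep L (nat \<lceil>2 * r + 2\<rceil>) q (s i) (s i)"
    using assms unfolding converges_iff[where q = q] by meson
  have "r < dist q (s i)" if "i \<ge> N" for i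
    using csep_imp_dist(1)[OF N[OF that]] by linarith
  then show ?thesis by (auto simp: eventually_sequentially)
qed

text \<open>The constant depends on \<open>r\<close>, \<open>e\<close> and \<open>L\<close> only and
  is uniform in \<open>q\<close>, \<open>x\<close>, \<open>y\<close>: choose \<open>m\<close> larger
  than \<open>r * (4 * L + 6) / e\<close>.\<close>

lemma fellow_travel_constant:
  fixes r e :: real
  assumes "0 \<le> r" "0 < e"
  obtains n where "\<And>q x y :: 'a. csep L n q x y \<Longrightarrow> dist (geod q x r) (geod q y r) < e"
proof -
  define m where "m = nat \<lceil>r\<rceil> + nat \<lceil>r * (4 * real L + 6) / e\<rceil> + 1"
  have m: "0 < m" "r \<le> real m" unfolding m_def by linarith+
  have "0 \<le> r * (4 * real L + 6) / e" using assms by simp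
  then have "r * (4 * real L + 6) / e < real m" using assms unfolding m_def by linarith
  then have "r / real m * (4 * real L + 6) < e"
    using assms m(1) by (simp add: field_simps)
  then show thesis
    using csep_fellow_travel(1)[OF _ m(1) assms(1) m(2)] by (intro that) force
qed

lemma tends_to_close:
  fixes r e :: real
  assumes "0 \<le> r" "0 < e"
  obtains n where "\<forall>q s t b b'. tends_to q s b \<longrightarrow> tends_to q t b' \<longrightarrow>
    (\<forall>\<^sub>F i in sequentially. csep L n q (s i) (t i)) \<longrightarrow> dist (b r) (b' r) < e"
proof -
  \<comment> \<open>Half of \<open>e\<close>, because strict inequalities become weak in the
    limit.\<close>
  obtain n where n: "\<And>q x y :: 'a. csep L n q x y \<Longrightarrow> dist (geod q x r) (geod q y r) < e / 2"
    using fellow_travel_constant[of r "e / 2" L] assms by auto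
  have "dist (b r) (b' r) < e" if "tends_to q s b" "tends_to q t b'"
    "\<forall>\<^sub>F i in sequentially. csep L n q (s i) (t i)" for q s t b b'
  proof -
    have "(\<lambda>i. dist (geod q (s i) r) (geod q (t i) r)) \<longlonglongrightarrow> dist (b r) (b' r)"
      using that assms by (intro tendsto_dist) (auto simp: tends_to_def)
    moreover have "\<forall>\<^sub>F i in sequentially. dist (geod q (s i) r) (geod q (t i) r) \<le> e / 2"
      using that(3) by (rule eventually_mono) (use n in \<open>auto intro: less_imp_le\<close>)
    ultimately have "dist (b r) (b' r) \<le> e / 2"
      using tendsto_upperbound trivial_limit_sequentially by blast
    then show ?thesis using assms by simp
  qed
  then show thesis using that by blast
qed

text \<open>A fixed term \<open>s M\<close> bounds the time at which the geodesics to all later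
  terms have crossed a long chain. At a time \<open>t\<close> after that they still have, and so has
  the nearby point \<open>b t\<close>.\<close>

lemma tends_to_reaches:
  assumes s: "converges_at_infinity (d_L L) p s" and b: "tends_to q s b"
  obtains t where "0 < t" "csep L n q (b t) (b t)"
proof -
  \<comment> \<open>The cost of one application of \<open>csep_return\<close>; it is paid twice, for
    \<open>geod q (s j) t\<close> and for \<open>b t\<close>.\<close>
  define k where "k = 4 * L + 11"
  obtain M where M: "\<And>i j. i \<ge> M \<Longrightarrow> j \<ge> M \<Longrightarrow> csep L (n + k + k + 3) q (s i) (s j)"
    using s unfolding converges_iff[where q = q] by meson
  \<comment> \<open>Independent of \<open>j\<close>: the crossing time \<open>s1\<close> exceeds a
    time on the segment to \<open>s M\<close> by at most \<open>2 * L + 3\<close>.\<close>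
  define t where "t = dist q (s M) + 2 * real L + 4"
  have t: "0 < t" unfolding t_def by (smt (verit) of_nat_0_le_iff zero_le_dist)
  have ray: "geodesic_ray b" "b 0 = q" using b by (auto simp: tends_to_def)
  have "(\<lambda>n. geod q (s n) t) \<longlonglongrightarrow> b t" using b t by (simp add: tends_to_def)
  then have "\<forall>\<^sub>F j in sequentially. dist (geod q (s j) t) (b t) < 1" by (rule tendstoD) simp
  moreover have "\<forall>\<^sub>F j in sequentially. t < dist q (s j)" using b by (simp add: tends_to_def)
  ultimately have "\<forall>\<^sub>F j in sequentially. dist (geod q (s j) t) (b t) < 1 \<and> t < dist q (s j) \<and> j \<ge> M"
    using eventually_ge_at_top[of M] by eventually_elim simp
  then obtain j where j: "dist (geod q (s j) t) (b t) < 1" "t < dist q (s j)" "j \<ge> M"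
    by (auto simp: eventually_sequentially)
  let ?c = "geod q (s j)"
  note c = geod_props[of q "s j"]
  have "csep L ((n + k + k) + 3) q (s M) (s j)" using M j(3) by simp
  then obtain s1 s2 where s12: "s1 \<in> {0..dist q (s j)}" "s2 \<in> {0..dist q (s M)}"
    "dist (?c s1) (geod q (s M) s2) \<le> 2 * real L + 3" "csep L (n + k + k) q (?c s1) (?c s1)"
    by (rule csep_geodesics_close)
  have "dist q (?c s1) = s1" "dist q (geod q (s M) s2) = s2"
    using geodesic_on_dist[OF c(4), of 0 s1] geodesic_on_dist[OF geod_props(4)[of q "s M"], of 0 s2]
      c geod_props[of q "s M"] s12 by auto
  then have s1: "s1 \<le> t"
    using s12(2,3) dist_triangle[of q "?c s1" "geod q (s M) s2"] by (simp add: t_def dist_commute)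
  have seg: "geodesic_segment q (?c t) ?c"
    using geodesic_on_segment[OF c(4), of 0 t] c(2) t j(2) by simp
  have dt: "dist q (?c t) = t" using geodesic_on_dist[OF c(4), of 0 t] c(2) t j(2) by simp
  have "csep L (n + k) q (?c t) (?c t)"
    by (rule csep_return[OF _ seg _ _ seg, of L "n + k" "?c s1" s1 s1]) (use s12 s1 dt in \<open>auto simp: k_def add.assoc\<close>)
  moreover have "geodesic_segment q (b t) b" "dist q (b t) = t"
    using geodesic_ray_segment[OF ray(1), of t] t ray(2) by auto
  ultimately have "csep L n q (b t) (b t)"
    using csep_return[of L n q "?c t" "b t" b t "b t" b t] t j(1)
    by (simp add: k_def add.assoc dist_commute)
  then show thesis using that t by blast
qed

text \<open>The segments to late terms pass within 1 of \<open>z\<close> at time \<open>t\<close>,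
  so \<open>csep_return\<close> applies to them.\<close>

lemma csep_near_ray:
  assumes z: "csep L (n + 4 * L + 11) q z z" and t: "0 \<le> t"
    and s: "tends_to q s b" "dist (b t) z < 1" and s': "tends_to q s' b'" "dist (b' t) z < 1"
  shows "\<forall>\<^sub>F i in sequentially. csep L n q (s i) (s' i)"
proof -
  have ev: "\<forall>\<^sub>F i in sequentially. dist (geod q (s i) t) z < 1 \<and> t < dist q (s i)"
    if "tends_to q s b" "dist (b t) z < 1" for s b
  proof -
    have "(\<lambda>i. dist (geod q (s i) t) z) \<longlonglongrightarrow> dist (b t) z"
      using that(1) t by (intro tendsto_intros) (simp add: tends_to_def)
    then have "\<forall>\<^sub>F i in sequentially. dist (geod q (s i) t) z < 1"
      using that(2) by (rule order_tendstoD(2))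
    moreover have "\<forall>\<^sub>F i in sequentially. t < dist q (s i)" using that(1) by (simp add: tends_to_def)
    ultimately show ?thesis by (rule eventually_conj)
  qed
  show ?thesis
    using ev[OF s] ev[OF s']
  proof eventually_elim
    case (elim i)
    then show ?case
      using t by (intro csep_return[where T = t and T' = t, OF z geodesic_segment_geod _ _ geodesic_segment_geod]) auto
  qed
qed

text \<open>Equivalent sequences have arbitrarily close limiting rays by
  \<open>tends_to_close\<close>. Conversely the common ray crosses arbitrarily long chains, which
  separate \<open>q\<close> from late terms of both sequences.\<close>

lemma gromov_equiv_iff_tends_to:
  assumes "tends_to q s b" "tends_to q t b'"
    and s: "converges_at_infinity (d_L L) p s" and t: "converges_at_infinity (d_L L) p t"
  shows "(s, t) \<in> gromov_equiv (d_L L) p \<longleftrightarrow> (\<forall>r\<ge>0. b r = b' r)"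
proof
  assume e: "(s, t) \<in> gromov_equiv (d_L L) p"
  show "\<forall>r\<ge>0. b r = b' r"
  proof (intro allI impI)
    fix r :: real assume r: "0 \<le> r"
    have "dist (b r) (b' r) < e" if e0: "0 < e" for e
    proof -
      obtain n where "\<forall>q s t b b'. tends_to q s b \<longrightarrow> tends_to q t b' \<longrightarrow>
        (\<forall>\<^sub>F i in sequentially. csep L n q (s i) (t i)) \<longrightarrow> dist (b r) (b' r) < e"
        using tends_to_close[OF r e0, of L] .
      then show ?thesis using e assms(1,2) unfolding gromov_equiv_iff[where q = q] by blast
    qed
    then show "b r = b' r" by (metis dist_pos_lt less_irrefl)
  qed
next
  assume eq: "\<forall>r\<ge>0. b r = b' r"
  have "\<forall>\<^sub>F i in sequentially. csep L n q (s i) (t i)" for n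
  proof -
    obtain r where r: "0 < r" "csep L (n + 4 * L + 11) q (b r) (b r)"
      using tends_to_reaches[OF s assms(1)] .
    then show ?thesis
      using eq by (intro csep_near_ray[where t = r, OF r(2) _ assms(1) _ assms(2)]) auto
  qed
  with s t show "(s, t) \<in> gromov_equiv (d_L L) p" unfolding gromov_equiv_iff[where q = q] by blast
qed

section \<open>Limits in the cone topology\<close>

lemma openin_cone_nbhd:
  assumes "geodesic_ray c" "0 < r" "0 < e"
  shows "openin (cone_topology (c 0)) (cone_nbhd c r e)"
  unfolding cone_topology_def using assms by (intro topology_generated_by_Basis) blast

text \<open>The existential in \<open>cone_nbhd\<close> has only one candidate on nonnegative times:
  asymptotic rays with the same origin agree there.\<close>

lemma Inr_in_cone_nbhd:
  fixes b :: "real \<Rightarrow> 'a"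
  assumes b: "geodesic_ray b" "b 0 = c 0" and r: "0 < r"
  shows "Inr (ray_class b) \<in> cone_nbhd c r e \<longleftrightarrow> dist (b r) (c r) < e"
proof
  assume "Inr (ray_class b) \<in> cone_nbhd c r e"
  then obtain b1 where "(b, b1) \<in> asymptotic" "b1 0 = c 0" "dist (b1 r) (c r) < e"
    by (auto simp: cone_nbhd_def)
  then show "dist (b r) (c r) < e" using asymptotic_rays_eq[of b b1 r] b r by simp
next
  assume "dist (b r) (c r) < e"
  then show "Inr (ray_class b) \<in> cone_nbhd c r e"
    using ray_in_class[OF b(1)] ray_class_in[OF b(1)] b(2) by (auto simp: cone_nbhd_def)
qed

lemma Inl_in_cone_nbhd:
  assumes "0 < r"
  shows "Inl (x :: 'a) \<in> cone_nbhd c r e \<longleftrightarrow> r < dist (c 0) x \<and> dist (geod (c 0) x r) (c r) < e"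
proof -
  have "d r = geod (c 0) x r" if "geodesic_segment (c 0) x d" "r < dist (c 0) x" for d
    using geodesic_segment_unique[OF that(1) geodesic_segment_geod] that(2) assms by simp
  then have "(\<exists>d. geodesic_segment (c 0) x d \<and> dist (d r) (c r) < e) \<longleftrightarrow> dist (geod (c 0) x r) (c r) < e"
    if "r < dist (c 0) x"
    using that geodesic_segment_geod[of "c 0" x] by (metis (no_types, lifting))
  moreover have "Inl x \<in> cone_nbhd c r e \<longleftrightarrow>
      r < dist (c 0) x \<and> (\<exists>d. geodesic_segment (c 0) x d \<and> dist (d r) (c r) < e)"
    unfolding cone_nbhd_def by blast
  ultimately show ?thesis by blast
qed

text \<open>Neighbourhoods of the ray itself give one direction. For the other, generation of the
  topology reduces the claim to the sets \<open>cone_nbhd\<close>, for which it is convergence at a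
  single time.\<close>

lemma limitin_cone_iff:
  fixes s :: "nat \<Rightarrow> 'a"
  assumes \<eta>: "\<eta> \<in> visual_boundary"
  shows "limitin (cone_topology q) (\<lambda>n. Inl (s n)) (Inr \<eta>) sequentially \<longleftrightarrow> (\<exists>b\<in>\<eta>. tends_to q s b)"
proof
  assume lim: "limitin (cone_topology q) (\<lambda>n. Inl (s n)) (Inr \<eta>) sequentially"
  \<comment> \<open>A generating set containing \<open>Inr \<eta>\<close> exhibits a ray in the
    class that starts at \<open>q\<close>.\<close>
  then have "Inr \<eta> \<in> topspace (cone_topology q)" by (simp add: limitin_def)
  then have "Inr \<eta> \<in> \<Union>({Inl ` ball x e | x e. e > 0} \<union>
      {cone_nbhd c r e | c r e. geodesic_ray c \<and> c 0 = q \<and> r > 0 \<and> e > 0})"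
    unfolding cone_topology_def by (simp add: topology_generated_by_topspace)
  then obtain c r e where "Inr \<eta> \<in> cone_nbhd c r e" "c 0 = q" by blast
  then obtain b where b: "b \<in> \<eta>" "b 0 = q" by (auto simp: cone_nbhd_def)
  note bb = visual_boundary_class[OF \<eta> b(1)]
  have ev: "\<forall>\<^sub>F n in sequentially. r < dist q (s n) \<and> dist (geod q (s n) r) (b r) < e"
    if re: "0 < r" "0 < e" for r e
  proof -
    have "openin (cone_topology q) (cone_nbhd b r e)" using openin_cone_nbhd[OF bb(1) re] b(2) by simp
    moreover have "Inr \<eta> \<in> cone_nbhd b r e"
      using Inr_in_cone_nbhd[of b b r e] re bb b(2) by simp
    ultimately have "\<forall>\<^sub>F n in sequentially. Inl (s n) \<in> cone_nbhd b r e"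
      using lim by (simp add: limitin_def)
    then show ?thesis unfolding Inl_in_cone_nbhd[OF re(1)] b(2) .
  qed
  have "tends_to q s b"
    unfolding tends_to_def
  proof (intro conjI allI impI bb(1) b(2))
    fix r :: real assume r: "0 \<le> r"
    show "(\<lambda>n. geod q (s n) r) \<longlonglongrightarrow> b r"
    proof (cases "r = 0")
      case True
      then show ?thesis using geod_props(2) b(2) by simp
    next
      case False
      then have r0: "0 < r" using r by simp
      show ?thesis
      proof (rule tendstoI)
        fix e :: real assume "0 < e"
        from ev[OF r0 this] show "\<forall>\<^sub>F n in sequentially. dist (geod q (s n) r) (b r) < e"
          by (rule eventually_mono) simp
      qed
    qed
  next
    \<comment> \<open>A cone neighbourhood has positive radius, so \<open>r\<close> is replaced by
      \<open>max r 1\<close>.\<close>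
    fix r :: real
    have "\<forall>\<^sub>F n in sequentially. max r 1 < dist q (s n) \<and> dist (geod q (s n) (max r 1)) (b (max r 1)) < 1"
      by (rule ev) auto
    then show "\<forall>\<^sub>F n in sequentially. r < dist q (s n)" by (rule eventually_mono) simp
  qed
  with b show "\<exists>b\<in>\<eta>. tends_to q s b" by blast
next
  assume "\<exists>b\<in>\<eta>. tends_to q s b"
  then obtain b where b: "b \<in> \<eta>" "tends_to q s b" by blast
  then have b0: "b 0 = q" by (simp add: tends_to_def)
  note bb = visual_boundary_class[OF \<eta> b(1)]
  define S where "S = {Inl ` ball x e | (x :: 'a) e. e > 0} \<union>
      {cone_nbhd c r e | c r e. geodesic_ray c \<and> c 0 = q \<and> r > 0 \<and> e > 0}"
  have T: "cone_topology q = topology_generated_by S" by (simp add: cone_topology_def S_def)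
  have "\<forall>\<^sub>F n in sequentially. Inl (s n) \<in> U" if "generate_topology_on S U" "Inr \<eta> \<in> U" for U
    using that
  proof (induction rule: generate_topology_on.induct)
    case (Int A B)
    then show ?case by (auto intro: eventually_conj)
  next
    case (UN K)
    then obtain k where "k \<in> K" "Inr \<eta> \<in> k" by blast
    with UN.IH show ?case by (blast intro: eventually_mono)
  next
    case (Basis U)
    then obtain c r e where c: "U = cone_nbhd c r e" "c 0 = q" "r > 0" "e > 0" by (auto simp: S_def)
    then have "dist (b r) (c r) < e"
      using Basis Inr_in_cone_nbhd[OF bb(1), of c r e] b0 bb(2) by simp
    moreover have "(\<lambda>n. dist (geod q (s n) r) (c r)) \<longlonglongrightarrow> dist (b r) (c r)"
      using b(2) c(3) by (intro tendsto_intros) (simp add: tends_to_def)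
    ultimately have "\<forall>\<^sub>F n in sequentially. dist (geod q (s n) r) (c r) < e"
      by (intro order_tendstoD(2))
    moreover have "\<forall>\<^sub>F n in sequentially. r < dist q (s n)" using b(2) by (simp add: tends_to_def)
    ultimately show ?case
      unfolding c(1) Inl_in_cone_nbhd[OF c(3)] c(2) by eventually_elim simp
  qed simp
  moreover have "Inr \<eta> \<in> topspace (cone_topology q)"
    using openin_subset[OF openin_cone_nbhd[OF bb(1), of 1 1]] Inr_in_cone_nbhd[of b b 1 1] b0 bb
    by auto
  ultimately show "limitin (cone_topology q) (\<lambda>n. Inl (s n)) (Inr \<eta>) sequentially"
    unfolding limitin_def T openin_topology_generated_by_iff by blast
qed

end

section \<open>The boundary map of a complete space\<close>

locale hadamard = cat0 X for X :: "'a::complete_space itself"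
begin

text \<open>Fellow travelling makes the points at time \<open>r\<close> a Cauchy sequence,
  completeness gives their limits, and distances pass to the limit.\<close>

lemma tends_to_exists:
  fixes s :: "nat \<Rightarrow> 'a"
  assumes s: "converges_at_infinity (d_L L) p s"
  shows "\<exists>b. tends_to q s b"
proof -
  have far: "\<forall>\<^sub>F n in sequentially. r < dist q (s n)" for r by (rule converges_dist[OF s])
  have "Cauchy (\<lambda>n. geod q (s n) r)" if r: "0 \<le> r" for r
  proof (rule metric_CauchyI)
    fix e :: real assume e: "0 < e"
    obtain n where n: "\<And>q x y :: 'a. csep L n q x y \<Longrightarrow> dist (geod q x r) (geod q y r) < e"
      using fellow_travel_constant[OF r e] by blast
    then show "\<exists>M. \<forall>i\<ge>M. \<forall>j\<ge>M. dist (geod q (s i) r) (geod q (s j) r) < e"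
      using s unfolding converges_iff[where q = q] by meson
  qed
  then have "\<exists>z. (\<lambda>n. geod q (s n) r) \<longlonglongrightarrow> z" if "0 \<le> r" for r
    using that Cauchy_convergent convergent_def by blast
  then obtain b where b: "\<And>r. 0 \<le> r \<Longrightarrow> (\<lambda>n. geod q (s n) r) \<longlonglongrightarrow> b r" by metis
  have "dist (b r) (b r') = \<bar>r - r'\<bar>" if "0 \<le> r" "0 \<le> r'" for r r'
  proof -
    have "\<forall>\<^sub>F n in sequentially. \<bar>r - r'\<bar> = dist (geod q (s n) r) (geod q (s n) r')"
      using far[of "max r r'"]
      by (rule eventually_mono) (use that geodesic_on_dist[OF geod_props(4)] in auto)
    then have "(\<lambda>n. dist (geod q (s n) r) (geod q (s n) r')) \<longlonglongrightarrow> \<bar>r - r'\<bar>"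
      by (rule Lim_transform_eventually[OF tendsto_const])
    then show ?thesis
      using LIMSEQ_unique tendsto_dist[OF b[OF that(1)] b[OF that(2)]] by blast
  qed
  then have "geodesic_ray b" by (simp add: geodesic_ray_def geodesic_on_def is_interval_ci)
  moreover have "b 0 = q" using b[of 0] geod_props(2) LIMSEQ_unique[OF _ tendsto_const] by fastforce
  ultimately show ?thesis using b far unfolding tends_to_def by blast
qed

text \<open>The relation amounts to equality of limiting rays on nonnegative times, which is visibly
  transitive.\<close>

lemma equiv_gromov:
  "equiv {s :: nat \<Rightarrow> 'a. converges_at_infinity (d_L L) p s} (gromov_equiv (d_L L) p)"
proof -
  define B where "B s = (SOME b. tends_to p s b)" for s
  have B: "tends_to p s (B s)" if "converges_at_infinity (d_L L) p s" for s
    unfolding B_def by (rule someI_ex[OF tends_to_exists[OF that]])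
  have iff: "(s, t) \<in> gromov_equiv (d_L L) p \<longleftrightarrow> converges_at_infinity (d_L L) p s \<and>
    converges_at_infinity (d_L L) p t \<and> (\<forall>r\<ge>0. B s r = B t r)" for s t :: "nat \<Rightarrow> 'a"
    using gromov_equiv_iff_tends_to[OF B B, of s t L p] gromov_equiv_iff[of s t L p p] by blast
  show ?thesis
    by (rule equivI) (auto simp: refl_on_def sym_def trans_def iff)
qed

lemma boundary_class:
  fixes \<xi> :: "(nat \<Rightarrow> 'a) set"
  assumes "\<xi> \<in> gromov_boundary (d_L L) p" "s \<in> \<xi>"
  shows "converges_at_infinity (d_L L) p s" "\<xi> = gromov_equiv (d_L L) p `` {s}"
proof -
  obtain t where t: "\<xi> = gromov_equiv (d_L L) p `` {t}"
    using assms(1) unfolding gromov_boundary_def by (auto elim: quotientE)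
  then have ts: "(t, s) \<in> gromov_equiv (d_L L) p" using assms(2) by simp
  then show "converges_at_infinity (d_L L) p s" by (simp add: gromov_equiv_def)
  show "\<xi> = gromov_equiv (d_L L) p `` {s}"
    unfolding t by (rule equiv_class_eq[OF equiv_gromov ts])
qed

lemma boundary_nonempty:
  fixes \<xi> :: "(nat \<Rightarrow> 'a) set"
  assumes "\<xi> \<in> gromov_boundary (d_L L) p"
  obtains s where "s \<in> \<xi>" "converges_at_infinity (d_L L) p s"
  using assms in_quotient_imp_non_empty[OF equiv_gromov] boundary_class(1)
  unfolding gromov_boundary_def by blast

text \<open>One ray serves all representatives of the class, since equivalent sequences have the
  same limiting ray from \<open>q\<close>.\<close>

lemma cone_limit_exists:
  fixes \<xi> :: "(nat \<Rightarrow> 'a) set"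
  assumes \<xi>: "\<xi> \<in> gromov_boundary (d_L L) p"
  obtains b where "\<And>s. s \<in> \<xi> \<Longrightarrow> tends_to q s b"
    "\<And>\<eta>. is_cone_limit q \<xi> \<eta> \<longleftrightarrow> \<eta> = ray_class b" "boundary_map q \<xi> = ray_class b"
proof -
  obtain s where s: "s \<in> \<xi>" "converges_at_infinity (d_L L) p s" using boundary_nonempty[OF \<xi>] .
  obtain b where b: "tends_to q s b" using tends_to_exists[OF s(2)] by blast
  have ray: "geodesic_ray b" using b by (simp add: tends_to_def)
  have all: "tends_to q t b" if t: "t \<in> \<xi>" for t
  proof -
    have tc: "converges_at_infinity (d_L L) p t" by (rule boundary_class(1)[OF \<xi> t])
    obtain b' where b': "tends_to q t b'" using tends_to_exists[OF tc] by blast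
    have "(s, t) \<in> gromov_equiv (d_L L) p" using boundary_class(2)[OF \<xi> s(1)] t by simp
    then have "\<forall>r\<ge>0. b r = b' r" using gromov_equiv_iff_tends_to[OF b b' s(2) tc] by simp
    then show ?thesis by (intro tends_to_cong[OF b']) simp
  qed
  have iff: "is_cone_limit q \<xi> \<eta> \<longleftrightarrow> \<eta> = ray_class b" for \<eta>
  proof
    assume "is_cone_limit q \<xi> \<eta>"
    then have \<eta>: "\<eta> \<in> visual_boundary"
      and "limitin (cone_topology q) (\<lambda>n. Inl (s n)) (Inr \<eta>) sequentially"
      using s(1) by (auto simp: is_cone_limit_def)
    then obtain c where c: "c \<in> \<eta>" "tends_to q s c" using limitin_cone_iff by blast
    then have "(b, c) \<in> asymptotic" using asymptotic_cong[OF ray] tends_to_unique[OF b c(2)] by blast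
    then show "\<eta> = ray_class b"
      using visual_boundary_class(2)[OF \<eta> c(1)] equiv_class_eq[OF equiv_asymptotic] by metis
  next
    assume "\<eta> = ray_class b"
    then show "is_cone_limit q \<xi> \<eta>"
      unfolding is_cone_limit_def
      using limitin_cone_iff[OF ray_class_in[OF ray]] ray_class_in[OF ray] ray_in_class[OF ray] all by blast
  qed
  then have "boundary_map q \<xi> = ray_class b" by (simp add: boundary_map_def)
  with all iff show thesis using that by blast
qed

text \<open>Equal images give asymptotic limiting rays from \<open>q\<close>; these coincide, so the
  sequences are equivalent.\<close>

lemma inj_on_boundary_map: "inj_on (boundary_map q) (gromov_boundary (d_L L) (p :: 'a))"
proof (rule inj_onI)
  fix \<xi> \<zeta> :: "(nat \<Rightarrow> 'a) set"
  assume \<xi>: "\<xi> \<in> gromov_boundary (d_L L) p" and \<zeta>: "\<zeta> \<in> gromov_boundary (d_L L) p"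
    and eq: "boundary_map q \<xi> = boundary_map q \<zeta>"
  obtain b where b: "\<And>s. s \<in> \<xi> \<Longrightarrow> tends_to q s b" "boundary_map q \<xi> = ray_class b"
    using cone_limit_exists[OF \<xi>] by metis
  obtain c where c: "\<And>s. s \<in> \<zeta> \<Longrightarrow> tends_to q s c" "boundary_map q \<zeta> = ray_class c"
    using cone_limit_exists[OF \<zeta>] by metis
  obtain s where s: "s \<in> \<xi>" "converges_at_infinity (d_L L) p s" using boundary_nonempty[OF \<xi>] .
  obtain t where t: "t \<in> \<zeta>" "converges_at_infinity (d_L L) p t" using boundary_nonempty[OF \<zeta>] .
  note bs = b(1)[OF s(1)] and ct = c(1)[OF t(1)]
  have "(b, c) \<in> asymptotic"
    using eq b(2) c(2) ray_in_class[of c] ct by (auto simp: tends_to_def)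
  then have "\<forall>r\<ge>0. b r = c r"
    using asymptotic_rays_eq bs ct by (simp add: tends_to_def)
  then have "(s, t) \<in> gromov_equiv (d_L L) p"
    using gromov_equiv_iff_tends_to[OF bs ct s(2) t(2)] by blast
  then show "\<xi> = \<zeta>"
    unfolding boundary_class(2)[OF \<xi> s(1)] boundary_class(2)[OF \<zeta> t(1)]
    by (rule equiv_class_eq[OF equiv_gromov])
qed

subsection \<open>Equivariance\<close>

lemma isometry_inverse:
  assumes "g \<in> isometry_group"
  shows "g (inv g x) = x" "inv g (g x) = x"
  using assms by (simp_all add: isometry_group_def bij_is_surj surj_f_inv_f bij_is_inj)

text \<open>\<open>g\<close> moves the base point to \<open>g p\<close>; freedom of the base point
  in the \<open>csep\<close> criteria brings it back to \<open>p\<close>.\<close>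

lemma gromov_equiv_isometry:
  assumes g: "g \<in> isometry_group" and st: "(s, t) \<in> gromov_equiv (d_L L) (p :: 'a)"
  shows "(g \<circ> s, g \<circ> t) \<in> gromov_equiv (d_L L) p"
proof -
  have conv: "converges_at_infinity (d_L L) p (g \<circ> s)" if "converges_at_infinity (d_L L) p s" for s :: "nat \<Rightarrow> 'a"
  proof -
    have "\<forall>n. \<exists>N. \<forall>i\<ge>N. \<forall>j\<ge>N. csep L n (g p) (g (s i)) (g (s j))"
      using that csep_move[OF g] unfolding converges_iff[where q = p and s = s] by meson
    then show ?thesis unfolding converges_iff[where q = "g p" and s = "g \<circ> s"] by simp
  qed
  have "\<forall>\<^sub>F i in sequentially. csep L n (g p) (g (s i)) (g (t i))" for n
    using st unfolding gromov_equiv_iff[where q = p] by (auto elim!: eventually_mono intro: csep_move[OF g])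
  with st conv show ?thesis
    unfolding gromov_equiv_iff[where q = "g p" and s = "g \<circ> s"] by (simp add: gromov_equiv_def)
qed

lemma image_gromov_class:
  assumes g: "g \<in> isometry_group" and \<xi>: "\<xi> \<in> gromov_boundary (d_L L) (p :: 'a)"
  shows "(\<lambda>s. g \<circ> s) ` \<xi> \<in> gromov_boundary (d_L L) p"
proof -
  obtain s where s: "s \<in> \<xi>" "converges_at_infinity (d_L L) p s" using boundary_nonempty[OF \<xi>] .
  note cls = boundary_class(2)[OF \<xi> s(1)]
  have "(\<lambda>s. g \<circ> s) ` \<xi> = gromov_equiv (d_L L) p `` {g \<circ> s}"
  proof
    show "(\<lambda>s. g \<circ> s) ` \<xi> \<subseteq> gromov_equiv (d_L L) p `` {g \<circ> s}"
      unfolding cls using gromov_equiv_isometry[OF g] by blast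
    show "gromov_equiv (d_L L) p `` {g \<circ> s} \<subseteq> (\<lambda>s. g \<circ> s) ` \<xi>"
    proof
      fix u assume "u \<in> gromov_equiv (d_L L) p `` {g \<circ> s}"
      then have "(inv g \<circ> (g \<circ> s), inv g \<circ> u) \<in> gromov_equiv (d_L L) p"
        using gromov_equiv_isometry[OF inv_isometry_group[OF g]] by blast
      moreover have "inv g \<circ> (g \<circ> s) = s" "u = g \<circ> (inv g \<circ> u)"
        using isometry_inverse[OF g] by (simp_all add: fun_eq_iff)
      ultimately show "u \<in> (\<lambda>s. g \<circ> s) ` \<xi>" unfolding cls by auto
    qed
  qed
  moreover have "(s, s) \<in> gromov_equiv (d_L L) p" using cls s(1) by blast
  then have "converges_at_infinity (d_L L) p (g \<circ> s)"
    using gromov_equiv_isometry[OF g] by (simp add: gromov_equiv_def)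
  ultimately show ?thesis unfolding gromov_boundary_def by (auto intro: quotientI)
qed

lemma asymptotic_isometry:
  assumes g: "g \<in> isometry_group" and bc: "(b, c) \<in> (asymptotic :: ((real \<Rightarrow> 'a) \<times> _) set)"
  shows "(g \<circ> b, g \<circ> c) \<in> asymptotic"
  using assms by (simp add: asymptotic_def isometry_group_def geodesic_ray_def geodesic_on_def)

lemma image_ray_class:
  assumes g: "g \<in> isometry_group"
  shows "(\<lambda>c. g \<circ> c) ` ray_class b = ray_class (g \<circ> (b :: real \<Rightarrow> 'a))"
proof
  show "(\<lambda>c. g \<circ> c) ` ray_class b \<subseteq> ray_class (g \<circ> b)"
    using asymptotic_isometry[OF g] by blast
  show "ray_class (g \<circ> b) \<subseteq> (\<lambda>c. g \<circ> c) ` ray_class b"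
  proof
    fix u assume "u \<in> ray_class (g \<circ> b)"
    then have "(inv g \<circ> (g \<circ> b), inv g \<circ> u) \<in> asymptotic"
      using asymptotic_isometry[OF inv_isometry_group[OF g]] by blast
    moreover have "inv g \<circ> (g \<circ> b) = b" "u = g \<circ> (inv g \<circ> u)"
      using isometry_inverse[OF g] by (simp_all add: fun_eq_iff)
    ultimately show "u \<in> (\<lambda>c. g \<circ> c) ` ray_class b" by auto
  qed
qed

text \<open>Both rays are limits of segments to the same points \<open>g (s n)\<close>, starting at
  \<open>g q\<close> and at \<open>q\<close>, so they stay within
  \<open>dist (g q) q\<close>.\<close>

lemma tends_to_isometry:
  assumes g: "g \<in> isometry_group" and b: "tends_to q s b" and c: "tends_to q (g \<circ> s) c"
  shows "(g \<circ> b, c) \<in> asymptotic"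
proof -
  have iso: "dist (g x) (g y) = dist x y" for x y using g by (simp add: isometry_group_def)
  have "dist (g (b r)) (c r) \<le> dist (g q) q" if r: "0 \<le> r" for r
  proof -
    have "(\<lambda>n. geod q (s n) r) \<longlonglongrightarrow> b r" using b r by (simp add: tends_to_def)
    then have "(\<lambda>n. g (geod q (s n) r)) \<longlonglongrightarrow> g (b r)"
      unfolding tendsto_iff iso .
    moreover have "(\<lambda>n. geod q (g (s n)) r) \<longlonglongrightarrow> c r" using c r by (simp add: tends_to_def)
    ultimately have "(\<lambda>n. dist (g (geod q (s n) r)) (geod q (g (s n)) r)) \<longlonglongrightarrow> dist (g (b r)) (c r)"
      by (rule tendsto_dist)
    moreover have "\<forall>\<^sub>F n in sequentially. r < dist q (s n)" "\<forall>\<^sub>F n in sequentially. r < dist q (g (s n))"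
      using b c by (simp_all add: tends_to_def)
    then have "\<forall>\<^sub>F n in sequentially. dist (g (geod q (s n) r)) (geod q (g (s n)) r) \<le> dist (g q) q"
    proof eventually_elim
      case (elim n)
      have "geodesic_segment (g q) (g (s n)) (\<lambda>t. g (geod q (s n) t))"
        using geodesic_segment_geod[of q "s n"] by (simp add: geodesic_segment_def geodesic_on_def iso)
      from dist_segments_common_end[OF this geodesic_segment_geod[of q]] elim r show ?case
        by (simp add: iso)
    qed
    ultimately show ?thesis using tendsto_upperbound trivial_limit_sequentially by blast
  qed
  moreover have "geodesic_ray (g \<circ> b)"
    using b by (simp add: tends_to_def geodesic_ray_def geodesic_on_def iso)
  ultimately show ?thesis using c by (auto simp: asymptotic_def tends_to_def)
qed

lemma boundary_map_equivariant:
  assumes g: "g \<in> isometry_group" and \<xi>: "\<xi> \<in> gromov_boundary (d_L L) (p :: 'a)"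
  shows "boundary_map q ((\<lambda>s. g \<circ> s) ` \<xi>) = (\<lambda>c. g \<circ> c) ` boundary_map q \<xi>"
proof -
  obtain b where b: "\<And>s. s \<in> \<xi> \<Longrightarrow> tends_to q s b" "boundary_map q \<xi> = ray_class b"
    using cone_limit_exists[OF \<xi>] by metis
  obtain c where c: "\<And>s. s \<in> (\<lambda>s. g \<circ> s) ` \<xi> \<Longrightarrow> tends_to q s c"
    "boundary_map q ((\<lambda>s. g \<circ> s) ` \<xi>) = ray_class c"
    using cone_limit_exists[OF image_gromov_class[OF g \<xi>]] by metis
  obtain s where s: "s \<in> \<xi>" using boundary_nonempty[OF \<xi>] .
  have "(g \<circ> b, c) \<in> asymptotic" using tends_to_isometry[OF g b(1) c(1)] s by blast
  then show ?thesis
    unfolding b(2) c(2) image_ray_class[OF g] by (rule equiv_class_eq[OF equiv_asymptotic, symmetric])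
qed

subsection \<open>The topology\<close>

lemma Inr_boundary_in_topspace:
  assumes "\<xi> \<in> gromov_boundary (d_L L) (p :: 'a)"
  shows "Inr (boundary_map q \<xi>) \<in> topspace (cone_topology q)" "boundary_map q \<xi> \<in> visual_boundary"
proof -
  obtain b where b: "\<And>s. s \<in> \<xi> \<Longrightarrow> tends_to q s b" "boundary_map q \<xi> = ray_class b"
    using cone_limit_exists[OF assms] by metis
  obtain s where s: "s \<in> \<xi>" using boundary_nonempty[OF assms] .
  have r: "geodesic_ray b" "b 0 = q" using b(1)[OF s] by (auto simp: tends_to_def)
  then show v: "boundary_map q \<xi> \<in> visual_boundary" using ray_class_in b(2) by simp
  have "\<exists>b\<in>boundary_map q \<xi>. tends_to q s b" using b s ray_in_class r by auto
  then show "Inr (boundary_map q \<xi>) \<in> topspace (cone_topology q)"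
    by (rule limitin_topspace[OF iffD2[OF limitin_cone_iff[OF v]]])
qed

text \<open>The threshold adds the cost of changing the base point from \<open>p\<close> to
  \<open>q\<close> and that of \<open>gromov_product_imp_csep\<close>.\<close>

lemma gromov_product_at_infinity_gt:
  assumes "gromov_product_at_infinity (d_L L) p \<xi> \<zeta> > ereal (real (n + nat \<lceil>2 * dist p q\<rceil> + 2) + real L + 3)"
  obtains s t where "s \<in> \<xi>" "t \<in> \<zeta>" "\<forall>\<^sub>F i in sequentially. csep L n q (s i) (t i)"
proof -
  let ?R = "real (n + nat \<lceil>2 * dist p q\<rceil> + 2) + real L + 3"
  obtain s t where st: "s \<in> \<xi>" "t \<in> \<zeta>" and
    "ereal ?R < liminf (\<lambda>i. ereal (gromov_product (d_L L) p (s i) (t i)))"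
    using assms unfolding gromov_product_at_infinity_def less_SUP_iff by auto
  then have "\<forall>\<^sub>F i in sequentially. ereal ?R < ereal (gromov_product (d_L L) p (s i) (t i))"
    by (intro less_LiminfD)
  then have "\<forall>\<^sub>F i in sequentially. csep L n q (s i) (t i)"
  proof (rule eventually_mono)
    fix i assume "ereal ?R < ereal (gromov_product (d_L L) p (s i) (t i))"
    then show "csep L n q (s i) (t i)"
      by (intro csep_change_basepoint[where p = p, OF gromov_product_imp_csep]) simp
  qed
  with st show thesis using that by blast
qed

lemma gromov_product_at_infinity_ge:
  assumes st: "s \<in> \<xi>" "t \<in> \<zeta>"
    and ev: "\<forall>\<^sub>F i in sequentially. csep L (n + nat \<lceil>2 * dist q p\<rceil> + 2) q (s i) (t i)"
  shows "gromov_product_at_infinity (d_L L) p \<xi> \<zeta> \<ge> ereal (real n - real L - 3)"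
proof -
  have "\<forall>\<^sub>F i in sequentially. ereal (real n - real L - 3) \<le> ereal (gromov_product (d_L L) p (s i) (t i))"
    using ev by (rule eventually_mono) (use csep_change_basepoint csep_imp_gromov_product in simp)
  then have "ereal (real n - real L - 3) \<le> liminf (\<lambda>i. ereal (gromov_product (d_L L) p (s i) (t i)))"
    by (rule Liminf_bounded)
  also have "\<dots> \<le> gromov_product_at_infinity (d_L L) p \<xi> \<zeta>"
    unfolding gromov_product_at_infinity_def
    by (rule SUP_upper2[of "(s, t)"]) (use st in auto)
  finally show ?thesis .
qed

text \<open>A large Gromov product with \<open>\<xi>\<close> forces the limiting rays to be closer
  at time \<open>r\<close> than the slack \<open>e - dist (b r) (c r)\<close>.\<close>

lemma openin_vimage_cone_nbhd:
  assumes c: "c 0 = q" "0 < r"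
  shows "openin (gromov_topology (d_L L) p)
    {\<xi> \<in> gromov_boundary (d_L L) (p :: 'a). Inr (boundary_map q \<xi>) \<in> cone_nbhd c r e}" (is "openin _ ?U")
  unfolding openin_gromov_topology
proof (intro conjI ballI)
  fix \<xi> assume \<xi>: "\<xi> \<in> ?U"
  obtain b where b: "\<And>s. s \<in> \<xi> \<Longrightarrow> tends_to q s b" "boundary_map q \<xi> = ray_class b"
    using cone_limit_exists \<xi> by (metis (no_types, lifting) mem_Collect_eq)
  obtain s0 where "s0 \<in> \<xi>" using boundary_nonempty \<xi> by blast
  then have ray: "geodesic_ray b" "b 0 = c 0" using b(1) c by (auto simp: tends_to_def)
  have "dist (b r) (c r) < e" using \<xi> b(2) Inr_in_cone_nbhd[where c = c and r = r and e = e, OF ray c(2)] by simp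
  then have e: "0 < e - dist (b r) (c r)" by simp
  obtain n where n: "\<forall>q s t a a'. tends_to q s a \<longrightarrow> tends_to q t a' \<longrightarrow>
    (\<forall>\<^sub>F i in sequentially. csep L n q (s i) (t i)) \<longrightarrow> dist (a r) (a' r) < e - dist (b r) (c r)"
    using tends_to_close[OF less_imp_le[OF c(2)] e, of L] .
  let ?R = "real (n + nat \<lceil>2 * dist p q\<rceil> + 2) + real L + 3"
  have "\<zeta> \<in> ?U" if \<zeta>: "\<zeta> \<in> gromov_boundary (d_L L) p" "gromov_product_at_infinity (d_L L) p \<xi> \<zeta> > ereal ?R" for \<zeta>
  proof -
    obtain b' where b': "\<And>s. s \<in> \<zeta> \<Longrightarrow> tends_to q s b'" "boundary_map q \<zeta> = ray_class b'"
      using cone_limit_exists[OF \<zeta>(1)] by metis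
    obtain s t where st: "s \<in> \<xi>" "t \<in> \<zeta>" "\<forall>\<^sub>F i in sequentially. csep L n q (s i) (t i)"
      using gromov_product_at_infinity_gt[OF \<zeta>(2)] .
    then have ray': "geodesic_ray b'" "b' 0 = c 0" using b'(1) c by (auto simp: tends_to_def)
    have "dist (b r) (b' r) < e - dist (b r) (c r)" using n b(1)[OF st(1)] b'(1)[OF st(2)] st(3) by blast
    then have "dist (b' r) (c r) < e" using dist_triangle[of "b' r" "c r" "b r"] by (simp add: dist_commute)
    then show ?thesis using \<zeta>(1) b'(2) Inr_in_cone_nbhd[where c = c and r = r and e = e, OF ray' c(2)] by simp
  qed
  then show "\<exists>R. {\<zeta> \<in> gromov_boundary (d_L L) p. gromov_product_at_infinity (d_L L) p \<xi> \<zeta> > ereal R} \<subseteq> ?U"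
    by (intro exI[of _ ?R]) blast
qed blast

text \<open>Checked on generating sets; balls consist of points of the space and have empty
  preimage.\<close>

lemma continuous_boundary_map:
  "continuous_map (gromov_topology (d_L L) (p :: 'a)) (visual_topology q) (boundary_map q)"
  unfolding visual_topology_def
proof (rule continuous_map_pullback')
  show "topspace (gromov_topology (d_L L) p) \<subseteq> boundary_map q -` visual_boundary"
    using Inr_boundary_in_topspace(2) by (auto simp: topspace_gromov_topology)
  show "continuous_map (gromov_topology (d_L L) p) (cone_topology q) (Inr \<circ> boundary_map q)"
    unfolding cone_topology_def
  proof (rule continuous_on_generated_topo)
    let ?S = "{Inl ` ball x e | x e. e > 0} \<union> {cone_nbhd c r e | c r e. geodesic_ray c \<and> c 0 = q \<and> r > 0 \<and> e > 0}"
    show "(Inr \<circ> boundary_map q) ` topspace (gromov_topology (d_L L) p) \<subseteq> \<Union>?S"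
    proof -
      have "topspace (cone_topology q) = \<Union>?S"
        by (simp add: cone_topology_def topology_generated_by_topspace)
      then show ?thesis
        unfolding topspace_gromov_topology
        by (metis (no_types, lifting) Inr_boundary_in_topspace(1) comp_apply image_subsetI)
    qed
    fix U assume "U \<in> ?S"
    then consider x e where "U = Inl ` ball x e" | c r e where "U = cone_nbhd c r e" "c 0 = q" "r > 0" by blast
    then show "openin (gromov_topology (d_L L) p) ((Inr \<circ> boundary_map q) -` U \<inter> topspace (gromov_topology (d_L L) p))"
    proof cases
      case 1
      then have "(Inr \<circ> boundary_map q) -` U = {}" by auto
      then show ?thesis by simp
    next
      case 2
      have "(Inr \<circ> boundary_map q) -` U \<inter> topspace (gromov_topology (d_L L) p) =
        {\<xi> \<in> gromov_boundary (d_L L) p. Inr (boundary_map q \<xi>) \<in> cone_nbhd c r e}"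
        by (auto simp: topspace_gromov_topology 2)
      then show ?thesis using openin_vimage_cone_nbhd[of c q r L p e] 2 by simp
    qed
  qed
qed

text \<open>At a time \<open>t\<close> by which the ray \<open>b\<close> has crossed a long chain,
  any limiting ray passing within 1 of \<open>b t\<close> has a class with large Gromov product with
  \<open>\<xi>\<close>, hence a class in \<open>U\<close>.\<close>

lemma boundary_map_open:
  assumes U: "openin (gromov_topology (d_L L) (p :: 'a)) U"
  shows "openin (subtopology (visual_topology q) (boundary_map q ` gromov_boundary (d_L L) p)) (boundary_map q ` U)"
proof (subst openin_subopen, rule ballI)
  fix \<eta> assume "\<eta> \<in> boundary_map q ` U"
  then obtain \<xi> where \<xi>U: "\<xi> \<in> U" "\<eta> = boundary_map q \<xi>" by blast
  have Usub: "U \<subseteq> gromov_boundary (d_L L) p" using U by (simp add: openin_gromov_topology)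
  then have \<xi>: "\<xi> \<in> gromov_boundary (d_L L) p" using \<xi>U by blast
  obtain R :: real where R: "{\<zeta> \<in> gromov_boundary (d_L L) p. gromov_product_at_infinity (d_L L) p \<xi> \<zeta> > R} \<subseteq> U"
    using U \<xi>U(1) unfolding openin_gromov_topology by blast
  \<comment> \<open>\<open>gromov_product_at_infinity_ge\<close> loses \<open>L + 3\<close>; one
    more unit makes the inequality with \<open>R\<close> strict.\<close>
  define n where "n = nat \<lceil>R + real L + 4\<rceil>"
  have n: "R < real n - real L - 3" unfolding n_def by linarith
  obtain b where b: "\<And>s. s \<in> \<xi> \<Longrightarrow> tends_to q s b" "boundary_map q \<xi> = ray_class b"
    using cone_limit_exists[OF \<xi>] by metis
  obtain s where s: "s \<in> \<xi>" "converges_at_infinity (d_L L) p s" using boundary_nonempty[OF \<xi>] .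
  note bs = b(1)[OF s(1)]
  have ray: "geodesic_ray b" "b 0 = q" using bs by (auto simp: tends_to_def)
  obtain t where t: "0 < t" "csep L (n + nat \<lceil>2 * dist q p\<rceil> + 2 + 4 * L + 11) q (b t) (b t)"
    using tends_to_reaches[OF s(2) bs] .
  let ?V = "cone_nbhd b t 1"
  let ?W = "Inr -` ?V \<inter> visual_boundary"
  let ?B = "boundary_map q ` gromov_boundary (d_L L) p"
  have "openin (cone_topology q) ?V" using openin_cone_nbhd[OF ray(1) t(1), of 1] ray(2) by simp
  then have "openin (visual_topology q) ?W"
    unfolding visual_topology_def openin_pullback_topology by blast
  then have "openin (subtopology (visual_topology q) ?B) (?W \<inter> ?B)"
    by (auto simp: openin_subtopology)
  moreover have "\<eta> \<in> ?B" unfolding \<xi>U(2) using \<xi> by (rule imageI)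
  moreover have "\<eta> \<in> ?W"
    using \<xi> Inr_boundary_in_topspace(2)[OF \<xi>, of q] Inr_in_cone_nbhd[of b b t 1] ray(1) t(1) b(2)
    unfolding \<xi>U(2) by simp
  moreover have "?W \<inter> ?B \<subseteq> boundary_map q ` U"
  proof
    fix \<theta> assume \<theta>: "\<theta> \<in> ?W \<inter> ?B"
    then obtain \<zeta> where \<zeta>: "\<zeta> \<in> gromov_boundary (d_L L) p" "\<theta> = boundary_map q \<zeta>" by blast
    obtain b' where b': "\<And>s. s \<in> \<zeta> \<Longrightarrow> tends_to q s b'" "boundary_map q \<zeta> = ray_class b'"
      using cone_limit_exists[OF \<zeta>(1)] by metis
    obtain u where u: "u \<in> \<zeta>" "converges_at_infinity (d_L L) p u" using boundary_nonempty[OF \<zeta>(1)] .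
    note bu = b'(1)[OF u(1)]
    have ray': "geodesic_ray b'" "b' 0 = b 0" using bu ray by (auto simp: tends_to_def)
    have "dist (b' t) (b t) < 1"
      using \<theta> Inr_in_cone_nbhd[where c = b and r = t and e = 1, OF ray' t(1)] by (simp add: \<zeta>(2) b'(2))
    then have "\<forall>\<^sub>F i in sequentially. csep L (n + nat \<lceil>2 * dist q p\<rceil> + 2) q (s i) (u i)"
      using csep_near_ray[where t = t, OF t(2) _ bs _ bu] t(1) by simp
    then have "gromov_product_at_infinity (d_L L) p \<xi> \<zeta> \<ge> ereal (real n - real L - 3)"
      using gromov_product_at_infinity_ge s(1) u(1) by blast
    moreover have "ereal R < ereal (real n - real L - 3)" using n by simp
    ultimately have "ereal R < gromov_product_at_infinity (d_L L) p \<xi> \<zeta>" by (rule order.strict_trans2[rotated])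
    then show "\<theta> \<in> boundary_map q ` U" using R \<zeta> by blast
  qed
  ultimately show "\<exists>T. openin (subtopology (visual_topology q) ?B) T \<and> \<eta> \<in> T \<and> T \<subseteq> boundary_map q ` U"
    by (intro exI[of _ "?W \<inter> ?B"]) blast
qed

lemma embedding_boundary_map:
  "embedding_map (gromov_topology (d_L L) (p :: 'a)) (visual_topology q) (boundary_map q)"
  unfolding embedding_map_def topspace_gromov_topology
proof (rule bijective_open_imp_homeomorphic_map)
  let ?X = "gromov_topology (d_L L) p"
  let ?B = "boundary_map q ` gromov_boundary (d_L L) p"
  let ?Y = "subtopology (visual_topology q) ?B"
  show "continuous_map ?X ?Y (boundary_map q)"
    using continuous_boundary_map
    by (intro continuous_map_into_subtopology) (auto simp: topspace_gromov_topology)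
  show "open_map ?X ?Y (boundary_map q)"
    using boundary_map_open by (simp add: open_map_def)
  have "?B \<subseteq> topspace (visual_topology q)"
    using continuous_map_image_subset_topspace[OF continuous_boundary_map]
    by (simp add: topspace_gromov_topology)
  then show "boundary_map q ` topspace ?X = topspace ?Y"
    by (auto simp: topspace_gromov_topology)
  show "inj_on (boundary_map q) (topspace ?X)"
    by (simp add: topspace_gromov_topology inj_on_boundary_map)
qed

end

text \<open>The base points \<open>p\<close> of the Gromov boundary and \<open>q\<close> of the cone
  topology are independent. The first conjunct gives meaning to the description operator in
  \<open>boundary_map\<close>.\<close>

theorem mainTheorem5:
  fixes L :: nat and p q :: "'a::complete_space"
  assumes "CAT0_space TYPE('a)" and "L \<ge> 1"
  shows "(\<forall>\<xi> \<in> gromov_boundary (d_L L) p. \<exists>!\<eta>. is_cone_limit q \<xi> \<eta>) \<and>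
    (\<forall>g \<in> isometry_group. \<forall>\<xi> \<in> gromov_boundary (d_L L) p.
       (\<lambda>s. g \<circ> s) ` \<xi> \<in> gromov_boundary (d_L L) p \<and>
       boundary_map q ((\<lambda>s. g \<circ> s) ` \<xi>) = (\<lambda>c. g \<circ> c) ` boundary_map q \<xi>) \<and>
    embedding_map (gromov_topology (d_L L) p) (visual_topology q) (boundary_map q)"
proof -
  interpret hadamard "TYPE('a)" by unfold_locales (rule assms(1))
  have "\<exists>!\<eta>. is_cone_limit q \<xi> \<eta>" if "\<xi> \<in> gromov_boundary (d_L L) p" for \<xi>
    using cone_limit_exists[OF that, of q] by metis
  then show ?thesis
    by (intro conjI ballI image_gromov_class boundary_map_equivariant embedding_boundary_map)
qed

end
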